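(* Let $R$ be a Noetherian local ring and let $M$ and $N$ be nonzero finitely generated $R$-modules. Then $$\operatorname{depth}(N,M)\geq\operatorname{depth}(M)-\dim(N).$$
   Context: Rings are commutative. For $R$-modules $N,M$, $\operatorname{depth}(N,M)\in\mathbb{N}\cup\{\infty\}$ is the least $i$ with $\operatorname{Ext}^i_R(N,M)\neq0$ (and $\infty$ if there is no such $i$). For $R$ local with maximal ideal $\mathfrak{m}$, $\operatorname{depth}(M):=\operatorname{depth}(R/\mathfrak{m},M)$. $\dim(N)$ is the Krull dimension of the support of $N$. *)

theory Defs
  imports
    "HOL-Library.Extended_Real"
    "HOL-Library.FSet"
    "HOL-Algebra.Algebra"
begin

section \<open>Modules\<close>

text \<open>
  In all module records constructed below, the components \<open>mult\<close> and \<open>one\<close> (which the record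
  type \<open>module\<close> inherits from \<open>ring\<close>) carry no meaning, unless the module is the ring itself.
\<close>

definition nonzero_module :: "('a, 'b, 'x) module_scheme \<Rightarrow> bool"
  where "nonzero_module M \<longleftrightarrow> carrier M \<noteq> {\<zero>\<^bsub>M\<^esub>}"

definition module_span :: "('a, 'r) ring_scheme \<Rightarrow> ('a, 'b, 'x) module_scheme \<Rightarrow> 'b set \<Rightarrow> 'b set"
  where "module_span R M A = \<Inter>{S. submodule S R M \<and> A \<subseteq> S}"

definition fin_gen_module :: "('a, 'r) ring_scheme \<Rightarrow> ('a, 'b, 'x) module_scheme \<Rightarrow> bool"
  where "fin_gen_module R M \<longleftrightarrow>
    (\<exists>A. finite A \<and> A \<subseteq> carrier M \<and> module_span R M A = carrier M)"

definition ring_as_module :: "('a, 'r) ring_scheme \<Rightarrow> ('a, 'a) module"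
  where "ring_as_module R =
    \<lparr>carrier = carrier R, monoid.mult = monoid.mult R, monoid.one = \<one>\<^bsub>R\<^esub>, ring.zero = \<zero>\<^bsub>R\<^esub>, add = add R, smult = monoid.mult R\<rparr>"

definition quot_module :: "('a, 'b, 'x) module_scheme \<Rightarrow> 'b set \<Rightarrow> ('a, 'b set) module"
  where "quot_module M S =
    \<lparr>carrier = a_rcosets\<^bsub>M\<^esub> S, monoid.mult = undefined, monoid.one = undefined,
     ring.zero = S, add = set_add M,
     smult = (\<lambda>a C. \<Union>x\<in>C. S +>\<^bsub>M\<^esub> (a \<odot>\<^bsub>M\<^esub> x))\<rparr>"

text \<open>
  Homomorphisms are taken to be \<open>undefined\<close> outside the carrier of their domain, so that equality
  of functions is equality of homomorphisms.
\<close>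

definition module_homs ::
    "('a, 'r) ring_scheme \<Rightarrow> ('a, 'b, 'x) module_scheme \<Rightarrow> ('a, 'c, 'y) module_scheme \<Rightarrow> ('b \<Rightarrow> 'c) set"
  where "module_homs R N M = {f \<in> carrier N \<rightarrow>\<^sub>E carrier M.
    (\<forall>x\<in>carrier N. \<forall>y\<in>carrier N. f (x \<oplus>\<^bsub>N\<^esub> y) = f x \<oplus>\<^bsub>M\<^esub> f y) \<and>
    (\<forall>a\<in>carrier R. \<forall>x\<in>carrier N. f (a \<odot>\<^bsub>N\<^esub> x) = a \<odot>\<^bsub>M\<^esub> f x)}"

definition Hom_module ::
    "('a, 'r) ring_scheme \<Rightarrow> ('a, 'b, 'x) module_scheme \<Rightarrow> ('a, 'c, 'y) module_scheme \<Rightarrow> ('a, 'b \<Rightarrow> 'c) module"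
  where "Hom_module R N M =
    \<lparr>carrier = module_homs R N M, monoid.mult = undefined, monoid.one = undefined,
     ring.zero = (\<lambda>x\<in>carrier N. \<zero>\<^bsub>M\<^esub>),
     add = (\<lambda>f g. \<lambda>x\<in>carrier N. f x \<oplus>\<^bsub>M\<^esub> g x),
     smult = (\<lambda>a f. \<lambda>x\<in>carrier N. a \<odot>\<^bsub>M\<^esub> f x)\<rparr>"


section \<open>The standard free resolution\<close>

definition free_module :: "('a, 'r) ring_scheme \<Rightarrow> 'i set \<Rightarrow> ('a, 'i \<Rightarrow> 'a) module"
  where "free_module R I =
    \<lparr>carrier = {f. (\<forall>i. f i \<in> carrier R) \<and> {i. f i \<noteq> \<zero>\<^bsub>R\<^esub>} \<subseteq> I \<and> finite {i. f i \<noteq> \<zero>\<^bsub>R\<^esub>}},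
     monoid.mult = undefined, monoid.one = undefined,
     ring.zero = (\<lambda>i. \<zero>\<^bsub>R\<^esub>),
     add = (\<lambda>f g i. f i \<oplus>\<^bsub>R\<^esub> g i),
     smult = (\<lambda>a f i. a \<otimes>\<^bsub>R\<^esub> f i)\<rparr>"

text \<open>
  The free module on the underlying set of \<open>K\<close> with its canonical map onto \<open>K\<close>. Basis elements
  are the elements of \<open>K\<close>, renamed by a map \<open>e\<close> which has to be injective on \<open>K\<close>.
\<close>

definition free_cover ::
    "('a, 'r) ring_scheme \<Rightarrow> ('b \<Rightarrow> 'i) \<Rightarrow> ('a, 'b, 'x) module_scheme \<Rightarrow> ('a, 'i \<Rightarrow> 'a) module"
  where "free_cover R e K = free_module R (e ` carrier K)"

definition cover_map ::
    "('a, 'r) ring_scheme \<Rightarrow> ('b \<Rightarrow> 'i) \<Rightarrow> ('a, 'b, 'x) module_scheme \<Rightarrow> ('i \<Rightarrow> 'a) \<Rightarrow> 'b"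
  where "cover_map R e K =
    (\<lambda>f\<in>carrier (free_cover R e K).
       \<Oplus>\<^bsub>K\<^esub>x\<in>{x \<in> carrier K. f (e x) \<noteq> \<zero>\<^bsub>R\<^esub>}. f (e x) \<odot>\<^bsub>K\<^esub> x)"

definition cover_kernel ::
    "('a, 'r) ring_scheme \<Rightarrow> ('b \<Rightarrow> 'i) \<Rightarrow> ('a, 'b, 'x) module_scheme \<Rightarrow> ('a, 'i \<Rightarrow> 'a) module"
  where "cover_kernel R e K =
    (free_cover R e K)\<lparr>carrier := a_kernel (free_cover R e K) K (cover_map R e K)\<rparr>"

text \<open>
  Every step of the resolution covers the previous syzygy module \<open>K\<close> by the free module on the
  set \<open>K\<close>. To let all of these free modules live in a single type, basis elements are named by a
  datatype: \<open>Gen x\<close> stands for an element \<open>x\<close> of the resolved module, and \<open>Rel G\<close> for a finitely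
  supported function on earlier names, \<open>G\<close> being its graph over its support.
\<close>

datatype ('a, 'b) syz_name = Gen 'b | Rel "(('a, 'b) syz_name \<times> 'a) fset"

definition rel_name ::
    "('a, 'r) ring_scheme \<Rightarrow> (('a, 'b) syz_name \<Rightarrow> 'a) \<Rightarrow> ('a, 'b) syz_name"
  where "rel_name R f = Rel (Abs_fset {(i, f i) |i. f i \<noteq> \<zero>\<^bsub>R\<^esub>})"

primrec syzygy ::
    "('a, 'r) ring_scheme \<Rightarrow> ('a, 'b, 'x) module_scheme \<Rightarrow> nat \<Rightarrow> ('a, ('a, 'b) syz_name \<Rightarrow> 'a) module"
  where
    "syzygy R N 0 = cover_kernel R Gen N"
  | "syzygy R N (Suc n) = cover_kernel R (rel_name R) (syzygy R N n)"

primrec std_res ::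
    "('a, 'r) ring_scheme \<Rightarrow> ('a, 'b, 'x) module_scheme \<Rightarrow> nat \<Rightarrow> ('a, ('a, 'b) syz_name \<Rightarrow> 'a) module"
  where
    "std_res R N 0 = free_cover R Gen N"
  | "std_res R N (Suc n) = free_cover R (rel_name R) (syzygy R N n)"

definition std_aug ::
    "('a, 'r) ring_scheme \<Rightarrow> ('a, 'b, 'x) module_scheme \<Rightarrow> (('a, 'b) syz_name \<Rightarrow> 'a) \<Rightarrow> 'b"
  where "std_aug R N = cover_map R Gen N"

text \<open>\<open>std_diff R N n\<close> is the differential from degree \<open>n + 1\<close> to degree \<open>n\<close>.\<close>

definition std_diff ::
    "('a, 'r) ring_scheme \<Rightarrow> ('a, 'b, 'x) module_scheme \<Rightarrow> nat
      \<Rightarrow> (('a, 'b) syz_name \<Rightarrow> 'a) \<Rightarrow> (('a, 'b) syz_name \<Rightarrow> 'a)"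
  where "std_diff R N n = cover_map R (rel_name R) (syzygy R N n)"


text \<open>
  The free modules \<open>std_res R N n\<close> do form a resolution of \<open>N\<close>: the maps are linear
  (\<open>cover_map_hom\<close>, \<open>std_diff_hom\<close>) and the augmented complex is exact (\<open>std_res_exact\<close>).
\<close>

lemma free_module_simps:
  "carrier (free_module R I) =
    {f. (\<forall>i. f i \<in> carrier R) \<and> {i. f i \<noteq> \<zero>\<^bsub>R\<^esub>} \<subseteq> I \<and> finite {i. f i \<noteq> \<zero>\<^bsub>R\<^esub>}}"
  "\<zero>\<^bsub>free_module R I\<^esub> = (\<lambda>i. \<zero>\<^bsub>R\<^esub>)"
  "f \<oplus>\<^bsub>free_module R I\<^esub> g = (\<lambda>i. f i \<oplus>\<^bsub>R\<^esub> g i)"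
  "a \<odot>\<^bsub>free_module R I\<^esub> f = (\<lambda>i. a \<otimes>\<^bsub>R\<^esub> f i)"
  by (simp_all add: free_module_def)

lemma module_free_module:
  fixes R (structure)
  assumes "cring R"
  shows "Module.module R (free_module R I)"
proof -
  interpret cring R by fact
  have add: "f \<oplus>\<^bsub>free_module R I\<^esub> g \<in> carrier (free_module R I)"
    if "f \<in> carrier (free_module R I)" "g \<in> carrier (free_module R I)" for f g
  proof -
    have "{i. f i \<oplus> g i \<noteq> \<zero>} \<subseteq> {i. f i \<noteq> \<zero>} \<union> {i. g i \<noteq> \<zero>}" by auto
    moreover have "finite ({i. f i \<noteq> \<zero>} \<union> {i. g i \<noteq> \<zero>})" "{i. f i \<noteq> \<zero>} \<union> {i. g i \<noteq> \<zero>} \<subseteq> I"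
      using that by (auto simp: free_module_simps)
    ultimately have "finite {i. f i \<oplus> g i \<noteq> \<zero>}" "{i. f i \<oplus> g i \<noteq> \<zero>} \<subseteq> I"
      by (meson finite_subset subset_trans)+
    then show ?thesis using that by (auto simp: free_module_simps)
  qed
  have smult: "a \<odot>\<^bsub>free_module R I\<^esub> f \<in> carrier (free_module R I)"
    if "a \<in> carrier R" "f \<in> carrier (free_module R I)" for a f
  proof -
    have "{i. a \<otimes> f i \<noteq> \<zero>} \<subseteq> {i. f i \<noteq> \<zero>}" using that by auto
    moreover have "finite {i. f i \<noteq> \<zero>}" "{i. f i \<noteq> \<zero>} \<subseteq> I"
      using that by (auto simp: free_module_simps)
    ultimately have "finite {i. a \<otimes> f i \<noteq> \<zero>}" "{i. a \<otimes> f i \<noteq> \<zero>} \<subseteq> I"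
      by (meson finite_subset subset_trans)+
    then show ?thesis using that by (auto simp: free_module_simps)
  qed
  show ?thesis
  proof (rule moduleI)
    show "abelian_group (free_module R I)"
    proof (rule abelian_groupI)
      fix f assume f: "f \<in> carrier (free_module R I)"
      have "{i. \<ominus> f i \<noteq> \<zero>} \<subseteq> {i. f i \<noteq> \<zero>}" by auto
      moreover have "finite {i. f i \<noteq> \<zero>}" "{i. f i \<noteq> \<zero>} \<subseteq> I"
        using f by (auto simp: free_module_simps)
      ultimately have "finite {i. \<ominus> f i \<noteq> \<zero>}" "{i. \<ominus> f i \<noteq> \<zero>} \<subseteq> I"
        by (meson finite_subset subset_trans)+
      then show "\<exists>g\<in>carrier (free_module R I). g \<oplus>\<^bsub>free_module R I\<^esub> f = \<zero>\<^bsub>free_module R I\<^esub>"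
        using f by (intro bexI[of _ "\<lambda>i. \<ominus> f i"]) (auto simp: free_module_simps l_neg)
    qed (use add in \<open>auto simp: free_module_simps a_assoc intro!: ext intro: a_comm\<close>)
  qed (use assms add smult in \<open>auto simp: free_module_simps l_distr r_distr m_assoc\<close>)
qed

lemma cover_map_eq:
  assumes "Module.module R K" and "inj_on e (carrier K)" and f: "f \<in> carrier (free_cover R e K)"
    and A: "finite A" "A \<subseteq> carrier K" "{x \<in> carrier K. f (e x) \<noteq> \<zero>\<^bsub>R\<^esub>} \<subseteq> A"
  shows "cover_map R e K f = (\<Oplus>\<^bsub>K\<^esub>x\<in>A. f (e x) \<odot>\<^bsub>K\<^esub> x)"
proof -
  interpret Module.module R K by fact
  have c: "f i \<in> carrier R" for i
    using f by (auto simp: free_cover_def free_module_simps)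
  show ?thesis
    unfolding cover_map_def using f A c
    by (auto intro!: M.add.finprod_mono_neutral_cong_left)
qed

lemma finite_cover_support:
  assumes "inj_on e (carrier K)" and f: "f \<in> carrier (free_cover R e K)"
  shows "finite {x \<in> carrier K. f (e x) \<noteq> \<zero>\<^bsub>R\<^esub>}"
proof (rule finite_imageD)
  show "finite (e ` {x \<in> carrier K. f (e x) \<noteq> \<zero>\<^bsub>R\<^esub>})"
  proof (rule finite_subset)
    show "finite {i. f i \<noteq> \<zero>\<^bsub>R\<^esub>}" using f by (auto simp: free_cover_def free_module_simps)
  qed auto
  show "inj_on e {x \<in> carrier K. f (e x) \<noteq> \<zero>\<^bsub>R\<^esub>}"
    using assms(1) by (rule inj_on_subset) auto
qed

lemma cover_map_hom:
  fixes R (structure)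
  assumes "Module.module R K" and inj: "inj_on e (carrier K)"
  shows "cover_map R e K \<in> module_homs R (free_cover R e K) K"
proof -
  interpret Module.module R K by fact
  interpret F: Module.module R "free_cover R e K"
    unfolding free_cover_def by (intro module_free_module is_cring)
  let ?F = "free_cover R e K" and ?c = "cover_map R e K"
  let ?S = "\<lambda>f. {x \<in> carrier K. f (e x) \<noteq> \<zero>}"
  have c: "f i \<in> carrier R" if "f \<in> carrier ?F" for f i
    using that by (auto simp: free_cover_def free_module_simps)
  have closed: "?c f \<in> carrier K" if "f \<in> carrier ?F" for f
    using that c[OF that] by (auto simp: cover_map_def intro!: M.finsum_closed)
  have add: "?c (f \<oplus>\<^bsub>?F\<^esub> g) = ?c f \<oplus>\<^bsub>K\<^esub> ?c g" if f: "f \<in> carrier ?F" and g: "g \<in> carrier ?F" for f g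
  proof -
    let ?A = "?S f \<union> ?S g"
    have fin: "finite ?A" using finite_cover_support[OF inj] f g by blast
    have fg: "(f \<oplus>\<^bsub>?F\<^esub> g) i = f i \<oplus> g i" for i by (simp add: free_cover_def free_module_simps)
    have "?c (f \<oplus>\<^bsub>?F\<^esub> g) = (\<Oplus>\<^bsub>K\<^esub>x\<in>?A. (f \<oplus>\<^bsub>?F\<^esub> g) (e x) \<odot>\<^bsub>K\<^esub> x)"
      using fin by (intro cover_map_eq assms F.M.a_closed f g) (auto simp: fg)
    also have "\<dots> = (\<Oplus>\<^bsub>K\<^esub>x\<in>?A. f (e x) \<odot>\<^bsub>K\<^esub> x \<oplus>\<^bsub>K\<^esub> g (e x) \<odot>\<^bsub>K\<^esub> x)"
      using c[OF f] c[OF g] by (intro M.finsum_cong') (auto simp: fg smult_l_distr)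
    also have "\<dots> = (\<Oplus>\<^bsub>K\<^esub>x\<in>?A. f (e x) \<odot>\<^bsub>K\<^esub> x) \<oplus>\<^bsub>K\<^esub> (\<Oplus>\<^bsub>K\<^esub>x\<in>?A. g (e x) \<odot>\<^bsub>K\<^esub> x)"
      using c[OF f] c[OF g] by (intro M.finsum_addf) auto
    also have "\<dots> = ?c f \<oplus>\<^bsub>K\<^esub> ?c g"
      using fin by (subst (1 2) cover_map_eq[OF assms, where A="?A"]) (use f g in auto)
    finally show ?thesis .
  qed
  have smult: "?c (a \<odot>\<^bsub>?F\<^esub> f) = a \<odot>\<^bsub>K\<^esub> ?c f" if a: "a \<in> carrier R" and f: "f \<in> carrier ?F" for a f
  proof -
    have fin: "finite (?S f)" using finite_cover_support[OF inj] f by blast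
    have af: "(a \<odot>\<^bsub>?F\<^esub> f) i = a \<otimes> f i" for i by (simp add: free_cover_def free_module_simps)
    have "?c (a \<odot>\<^bsub>?F\<^esub> f) = (\<Oplus>\<^bsub>K\<^esub>x\<in>?S f. (a \<odot>\<^bsub>?F\<^esub> f) (e x) \<odot>\<^bsub>K\<^esub> x)"
      using fin a by (intro cover_map_eq assms F.smult_closed f) (auto simp: af)
    also have "\<dots> = (\<Oplus>\<^bsub>K\<^esub>x\<in>?S f. a \<odot>\<^bsub>K\<^esub> (f (e x) \<odot>\<^bsub>K\<^esub> x))"
      using a c[OF f] by (intro M.finsum_cong') (auto simp: af smult_assoc1)
    also have "\<dots> = a \<odot>\<^bsub>K\<^esub> (\<Oplus>\<^bsub>K\<^esub>x\<in>?S f. f (e x) \<odot>\<^bsub>K\<^esub> x)"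
      using a fin c[OF f] by (intro finsum_smult_ldistr[symmetric]) auto
    also have "\<dots> = a \<odot>\<^bsub>K\<^esub> ?c f"
      using fin f by (subst cover_map_eq[OF assms, where A="?S f"]) auto
    finally show ?thesis .
  qed
  have "?c \<in> extensional (carrier ?F)" by (simp add: cover_map_def)
  then show ?thesis using closed add smult by (auto simp: module_homs_def PiE_def)
qed

lemma cover_map_surj:
  fixes R (structure)
  assumes "Module.module R K" and inj: "inj_on e (carrier K)"
  shows "cover_map R e K ` carrier (free_cover R e K) = carrier K"
proof
  interpret Module.module R K by fact
  show "cover_map R e K ` carrier (free_cover R e K) \<subseteq> carrier K"
    using cover_map_hom[OF assms] by (auto simp: module_homs_def)
  show "carrier K \<subseteq> cover_map R e K ` carrier (free_cover R e K)"
  proof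
    fix x assume x: "x \<in> carrier K"
    define f where "f = (\<lambda>i. if i = e x then \<one> else \<zero>)"
    have "{i. f i \<noteq> \<zero>} \<subseteq> {e x}" by (auto simp: f_def)
    then have fc: "f \<in> carrier (free_cover R e K)"
      using x by (auto simp: free_cover_def free_module_simps f_def)
    have "cover_map R e K f = (\<Oplus>\<^bsub>K\<^esub>y\<in>{x}. f (e y) \<odot>\<^bsub>K\<^esub> y)"
      using x inj by (intro cover_map_eq assms fc) (auto simp: f_def inj_on_def split: if_splits)
    also have "\<dots> = x" using x by (simp add: f_def)
    finally show "x \<in> cover_map R e K ` carrier (free_cover R e K)" using fc by (metis imageI)
  qed
qed

lemma module_cover_kernel:
  fixes R (structure)
  assumes "Module.module R K" and inj: "inj_on e (carrier K)"
  shows "Module.module R (cover_kernel R e K)"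
proof -
  interpret Module.module R K by fact
  interpret F: Module.module R "free_cover R e K"
    unfolding free_cover_def by (intro module_free_module is_cring)
  let ?F = "free_cover R e K" and ?c = "cover_map R e K"
  have add: "?c (f \<oplus>\<^bsub>?F\<^esub> g) = ?c f \<oplus>\<^bsub>K\<^esub> ?c g" if "f \<in> carrier ?F" "g \<in> carrier ?F" for f g
    using cover_map_hom[OF assms] that by (auto simp: module_homs_def)
  have smult: "?c (a \<odot>\<^bsub>?F\<^esub> f) = a \<odot>\<^bsub>K\<^esub> ?c f" if "a \<in> carrier R" "f \<in> carrier ?F" for a f
    using cover_map_hom[OF assms] that by (auto simp: module_homs_def)
  have zero: "?c \<zero>\<^bsub>?F\<^esub> = \<zero>\<^bsub>K\<^esub>"
  proof -
    have "?c \<zero>\<^bsub>?F\<^esub> \<in> carrier K"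
      using cover_map_hom[OF assms] F.M.zero_closed by (auto simp: module_homs_def)
    then show ?thesis using smult[of \<zero> "\<zero>\<^bsub>?F\<^esub>"] by simp
  qed
  have minus: "\<ominus>\<^bsub>?F\<^esub> f = (\<ominus> \<one>) \<odot>\<^bsub>?F\<^esub> f" if "f \<in> carrier ?F" for f
    using that by (simp add: F.smult_l_minus)
  have "submodule (a_kernel ?F K ?c) R ?F"
    by (rule F.submoduleI) (auto simp: a_kernel_def' add smult zero minus)
  then show ?thesis
    unfolding cover_kernel_def by (rule submodule.submodule_is_module) (rule F.module_axioms)
qed

lemma inj_on_rel_name:
  assumes "\<And>f. f \<in> A \<Longrightarrow> finite {i. f i \<noteq> \<zero>\<^bsub>R\<^esub>}"
  shows "inj_on (rel_name R) A"
proof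
  fix f g assume fg: "f \<in> A" "g \<in> A" "rel_name R f = rel_name R g"
  have "finite {(i, h i) |i. h i \<noteq> \<zero>\<^bsub>R\<^esub>}" if "h \<in> A" for h
    using finite_imageI[OF assms[OF that], of "\<lambda>i. (i, h i)"] by (simp add: setcompr_eq_image)
  then have eq: "{(i, f i) |i. f i \<noteq> \<zero>\<^bsub>R\<^esub>} = {(i, g i) |i. g i \<noteq> \<zero>\<^bsub>R\<^esub>}"
    using fg by (simp add: rel_name_def Abs_fset_inject)
  show "f = g"
  proof
    fix i
    have "(i, f i) \<in> {(i, f i) |i. f i \<noteq> \<zero>\<^bsub>R\<^esub>} \<longleftrightarrow> f i \<noteq> \<zero>\<^bsub>R\<^esub>"
      "(i, g i) \<in> {(i, g i) |i. g i \<noteq> \<zero>\<^bsub>R\<^esub>} \<longleftrightarrow> g i \<noteq> \<zero>\<^bsub>R\<^esub>" by auto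
    then show "f i = g i" using eq by auto
  qed
qed

lemma syzygy_carrier_finite:
  "f \<in> carrier (syzygy R N n) \<Longrightarrow> finite {i. f i \<noteq> \<zero>\<^bsub>R\<^esub>}"
  by (cases n) (auto simp: cover_kernel_def a_kernel_def' free_cover_def free_module_simps)

lemma inj_on_rel_name_syzygy: "inj_on (rel_name R) (carrier (syzygy R N n))"
  by (intro inj_on_rel_name syzygy_carrier_finite)

lemma module_syzygy:
  assumes "Module.module R N"
  shows "Module.module R (syzygy R N n)"
  by (induction n) (auto intro!: module_cover_kernel assms inj_on_rel_name_syzygy simp: inj_on_def)

lemma std_diff_hom:
  assumes "Module.module R N"
  shows "std_diff R N n \<in> module_homs R (std_res R N (Suc n)) (std_res R N n)"
proof -
  have "std_diff R N n \<in> module_homs R (std_res R N (Suc n)) (syzygy R N n)"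
    using cover_map_hom[OF module_syzygy[OF assms] inj_on_rel_name_syzygy, of n]
    by (simp add: std_diff_def)
  then show ?thesis
    by (cases n) (auto simp: module_homs_def cover_kernel_def a_kernel_def')
qed

theorem std_res_exact:
  assumes "Module.module R N"
  shows "std_aug R N ` carrier (std_res R N 0) = carrier N"
    and "std_diff R N 0 ` carrier (std_res R N 1) = a_kernel (std_res R N 0) N (std_aug R N)"
    and "std_diff R N (Suc n) ` carrier (std_res R N (Suc (Suc n))) =
      a_kernel (std_res R N (Suc n)) (std_res R N n) (std_diff R N n)"
proof -
  have surj: "std_diff R N n ` carrier (std_res R N (Suc n)) = carrier (syzygy R N n)" for n
    using cover_map_surj[OF module_syzygy[OF assms] inj_on_rel_name_syzygy, of n]
    by (simp add: std_diff_def)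
  have z: "\<zero>\<^bsub>syzygy R N n\<^esub> = \<zero>\<^bsub>std_res R N n\<^esub>" for n
    by (cases n) (simp_all add: cover_kernel_def)
  show "std_aug R N ` carrier (std_res R N 0) = carrier N"
    using cover_map_surj[OF assms, of Gen] by (simp add: std_aug_def inj_on_def)
  show "std_diff R N 0 ` carrier (std_res R N 1) = a_kernel (std_res R N 0) N (std_aug R N)"
    using surj[of 0] by (simp add: cover_kernel_def std_aug_def)
  show "std_diff R N (Suc n) ` carrier (std_res R N (Suc (Suc n))) =
      a_kernel (std_res R N (Suc n)) (std_res R N n) (std_diff R N n)"
    unfolding surj by (simp add: cover_kernel_def std_diff_def a_kernel_def' z)
qed


section \<open>Ext and depth\<close>

text \<open>
  Cohomology of \<open>Hom(F, M)\<close> for a chain complex \<open>F\<close> with differentials \<open>d n : F (n + 1) \<rightarrow> F n\<close>.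
\<close>

definition cocycles ::
    "('a, 'r) ring_scheme \<Rightarrow> (nat \<Rightarrow> ('a, 'b, 'x) module_scheme) \<Rightarrow> (nat \<Rightarrow> 'b \<Rightarrow> 'b)
      \<Rightarrow> ('a, 'c, 'y) module_scheme \<Rightarrow> nat \<Rightarrow> ('b \<Rightarrow> 'c) set"
  where "cocycles R F d M n =
    {\<phi> \<in> module_homs R (F n) M. compose (carrier (F (Suc n))) \<phi> (d n) = \<zero>\<^bsub>Hom_module R (F (Suc n)) M\<^esub>}"

primrec coboundaries ::
    "('a, 'r) ring_scheme \<Rightarrow> (nat \<Rightarrow> ('a, 'b, 'x) module_scheme) \<Rightarrow> (nat \<Rightarrow> 'b \<Rightarrow> 'b)
      \<Rightarrow> ('a, 'c, 'y) module_scheme \<Rightarrow> nat \<Rightarrow> ('b \<Rightarrow> 'c) set"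
  where
    "coboundaries R F d M 0 = {\<zero>\<^bsub>Hom_module R (F 0) M\<^esub>}"
  | "coboundaries R F d M (Suc n) =
      (\<lambda>\<psi>. compose (carrier (F (Suc n))) \<psi> (d n)) ` module_homs R (F n) M"

definition Hom_cohomology ::
    "('a, 'r) ring_scheme \<Rightarrow> (nat \<Rightarrow> ('a, 'b, 'x) module_scheme) \<Rightarrow> (nat \<Rightarrow> 'b \<Rightarrow> 'b)
      \<Rightarrow> ('a, 'c, 'y) module_scheme \<Rightarrow> nat \<Rightarrow> ('a, ('b \<Rightarrow> 'c) set) module"
  where "Hom_cohomology R F d M n =
    quot_module ((Hom_module R (F n) M)\<lparr>carrier := cocycles R F d M n\<rparr>) (coboundaries R F d M n)"

definition Ext ::
    "('a, 'r) ring_scheme \<Rightarrow> nat \<Rightarrow> ('a, 'b, 'x) module_scheme \<Rightarrow> ('a, 'c, 'y) module_scheme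
      \<Rightarrow> ('a, ((('a, 'b) syz_name \<Rightarrow> 'a) \<Rightarrow> 'c) set) module"
  where "Ext R i N M = Hom_cohomology R (std_res R N) (std_diff R N) M i"

definition depth ::
    "('a, 'r) ring_scheme \<Rightarrow> ('a, 'b, 'x) module_scheme \<Rightarrow> ('a, 'c, 'y) module_scheme \<Rightarrow> enat"
  where "depth R N M =
    (if \<exists>i. nonzero_module (Ext R i N M) then enat (LEAST i. nonzero_module (Ext R i N M)) else \<infinity>)"

definition local_cring :: "('a, 'r) ring_scheme \<Rightarrow> bool"
  where "local_cring R \<longleftrightarrow> cring R \<and> (\<exists>!\<mm>. maximalideal \<mm> R)"

definition max_ideal :: "('a, 'r) ring_scheme \<Rightarrow> 'a set"
  where "max_ideal R = (THE \<mm>. maximalideal \<mm> R)"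

definition local_depth :: "('a, 'r) ring_scheme \<Rightarrow> ('a, 'b, 'x) module_scheme \<Rightarrow> enat"
  where "local_depth R M = depth R (quot_module (ring_as_module R) (max_ideal R)) M"


section \<open>Support and dimension\<close>

text \<open>
  The localization \<open>N\<^sub>p\<close> at a prime ideal \<open>p\<close>, as a set of fractions: \<open>x/s = y/t\<close> iff
  \<open>u (t x) = u (s y)\<close> for some \<open>u\<close> outside \<open>p\<close>. The module structure is not needed to express
  that \<open>N\<^sub>p\<close> is nonzero, i.e. contains a fraction other than \<open>0/1\<close>.
\<close>

definition frac_rel ::
    "('a, 'r) ring_scheme \<Rightarrow> ('a, 'b, 'x) module_scheme \<Rightarrow> 'a set \<Rightarrow> (('b \<times> 'a) \<times> ('b \<times> 'a)) set"
  where "frac_rel R N p =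
    {((x, s), (y, t)). x \<in> carrier N \<and> y \<in> carrier N \<and> s \<in> carrier R - p \<and> t \<in> carrier R - p \<and>
       (\<exists>u\<in>carrier R - p. u \<odot>\<^bsub>N\<^esub> (t \<odot>\<^bsub>N\<^esub> x) = u \<odot>\<^bsub>N\<^esub> (s \<odot>\<^bsub>N\<^esub> y))}"

definition localization ::
    "('a, 'r) ring_scheme \<Rightarrow> ('a, 'b, 'x) module_scheme \<Rightarrow> 'a set \<Rightarrow> ('b \<times> 'a) set set"
  where "localization R N p = (carrier N \<times> (carrier R - p)) // frac_rel R N p"

definition support :: "('a, 'r) ring_scheme \<Rightarrow> ('a, 'b, 'x) module_scheme \<Rightarrow> 'a set set"
  where "support R N =
    {p. primeideal p R \<and> localization R N p \<noteq> {frac_rel R N p `` {(\<zero>\<^bsub>N\<^esub>, \<one>\<^bsub>R\<^esub>)}}}"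

text \<open>
  Supremum of the lengths \<open>n\<close> of chains \<open>p\<^sub>0 \<subset> \<dots> \<subset> p\<^sub>n\<close> of primes in the support; the zero module
  has dimension \<open>-\<infinity>\<close>.
\<close>

definition module_dim :: "('a, 'r) ring_scheme \<Rightarrow> ('a, 'b, 'x) module_scheme \<Rightarrow> ereal"
  where "module_dim R N =
    (SUP n \<in> {n. \<exists>p :: nat \<Rightarrow> 'a set. (\<forall>i\<le>n. p i \<in> support R N) \<and> (\<forall>i<n. p i \<subset> p (Suc i))}. ereal (real n))"

end

theory Submission
  imports Defs
begin

text \<open>
  Let \<open>k\<close> be the residue field. If \<open>Ext\<^sup>j(k, M) = 0\<close> for all \<open>j < n\<close>, where \<open>n > 0\<close>, then \<open>\<mm>\<close>
  contains an \<open>M\<close>-regular element \<open>x\<close>, and \<open>Ext\<^sup>j(k, M/xM) = 0\<close> for \<open>j < n - 1\<close>. For an associated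
  prime \<open>p\<close> of \<open>M\<close>, Nakayama's lemma gives an associated prime of \<open>M/xM\<close> that contains \<open>p\<close> and
  \<open>x \<notin> p\<close>, so by induction there is a chain of \<open>n\<close> strict inclusions of primes starting at \<open>p\<close>.
  Now let \<open>i + dim N < n\<close>. If \<open>ann N\<close> contained no \<open>M\<close>-regular element, it would lie in an associated
  prime of \<open>M\<close>, and the chain would show \<open>n \<le> dim N\<close>. Hence there is an \<open>M\<close>-regular \<open>x \<in> ann N\<close>,
  and since \<open>x\<close> acts as zero on \<open>Ext\<^sup>i(N, M)\<close>, this module embeds into \<open>Ext\<close> of degree \<open>i - 1\<close> of
  \<open>N\<close> and \<open>M/xM\<close>, which is zero by induction.
\<close>

section \<open>Submodules and chain conditions\<close>

text \<open>The free modules of the standard resolution have infinite rank in general, so no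
  finiteness of the Ext modules is at hand and Nakayama's lemma cannot be applied to them. It is
  applied only inside \<open>M\<close>; along the exact sequence of multiplication by
  \<open>x\<close> only vanishing is transported, on explicit cochains. Quotients of
  \<open>M\<close> are replaced by submodules \<open>S\<close> of the one fixed \<open>M\<close>:
  going from M/S to its quotient by \<open>x\<close> replaces \<open>S\<close> by S + xM, and the
  associated primes of M/S are the prime ideals of the form \<open>colon R M S z\<close>. All
  inductions therefore quantify over \<open>S\<close>. The depth of a nonzero \<open>M\<close> must
  also be shown to be finite. Otherwise there would be a maximal \<open>S \<noteq> M\<close> for
  which all Ext^j(k, M/S) vanish, and S + xM would be a larger one. The dimension of
  \<open>N\<close> enters through chains of primes containing ann N, one chain at a time, so it may
  a priori be infinite.\<close>

definition colon :: "('a, 'r) ring_scheme \<Rightarrow> ('a, 'b, 'x) module_scheme \<Rightarrow> 'b set \<Rightarrow> 'b \<Rightarrow> 'a set"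
  where "colon R M S z = {r \<in> carrier R. r \<odot>\<^bsub>M\<^esub> z \<in> S}"

definition add_scaled :: "('a, 'b, 'x) module_scheme \<Rightarrow> 'b set \<Rightarrow> 'a \<Rightarrow> 'b set"
  where "add_scaled M S x = {s \<oplus>\<^bsub>M\<^esub> x \<odot>\<^bsub>M\<^esub> y |s y. s \<in> S \<and> y \<in> carrier M}"

definition add_cyclic :: "('a, 'r) ring_scheme \<Rightarrow> ('a, 'b, 'x) module_scheme \<Rightarrow> 'b set \<Rightarrow> 'b \<Rightarrow> 'b set"
  where "add_cyclic R M S y = {s \<oplus>\<^bsub>M\<^esub> r \<odot>\<^bsub>M\<^esub> y |s r. s \<in> S \<and> r \<in> carrier R}"

text \<open>In contrast to the usual notion of a regular element on M/S, S + xM may be all of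
  \<open>M\<close>; that it is proper for \<open>x\<close> in the maximal ideal is left to
  Nakayama's lemma.\<close>

definition regular_mod :: "('a, 'b, 'x) module_scheme \<Rightarrow> 'b set \<Rightarrow> 'a \<Rightarrow> bool"
  where "regular_mod M S x \<longleftrightarrow> (\<forall>y\<in>carrier M. x \<odot>\<^bsub>M\<^esub> y \<in> S \<longrightarrow> y \<in> S)"

lemma (in Module.module) submoduleD:
  assumes "submodule S R M"
  shows "\<And>a. a \<in> S \<Longrightarrow> a \<in> carrier M"
    and "\<zero>\<^bsub>M\<^esub> \<in> S"
    and "\<And>a. a \<in> S \<Longrightarrow> \<ominus>\<^bsub>M\<^esub> a \<in> S"
    and "\<And>a b. a \<in> S \<Longrightarrow> b \<in> S \<Longrightarrow> a \<oplus>\<^bsub>M\<^esub> b \<in> S"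
    and "\<And>a b. a \<in> S \<Longrightarrow> b \<in> S \<Longrightarrow> a \<ominus>\<^bsub>M\<^esub> b \<in> S"
    and "\<And>r a. r \<in> carrier R \<Longrightarrow> a \<in> S \<Longrightarrow> r \<odot>\<^bsub>M\<^esub> a \<in> S"
  using submoduleE[OF assms] subgroup.one_closed[OF submodule.axioms(1)[OF assms]]
  by (auto simp: a_minus_def)

lemma (in Module.module) submodule_add_mem_iff:
  assumes S: "submodule S R M" and "a \<in> S" "b \<in> carrier M"
  shows "a \<oplus>\<^bsub>M\<^esub> b \<in> S \<longleftrightarrow> b \<in> S"
proof
  assume "a \<oplus>\<^bsub>M\<^esub> b \<in> S"
  then have "\<ominus>\<^bsub>M\<^esub> a \<oplus>\<^bsub>M\<^esub> (a \<oplus>\<^bsub>M\<^esub> b) \<in> S"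
    using submoduleD[OF S] assms(2) by blast
  then show "b \<in> S" using submoduleD(1)[OF S assms(2)] assms(3) by (simp add: M.r_neg1)
qed (use submoduleD(4)[OF S] assms in auto)

lemma (in Module.module) ideal_colon:
  assumes S: "submodule S R M" and z: "z \<in> carrier M"
  shows "ideal (colon R M S z) R"
proof (rule idealI)
  show "ring R" by (rule R.ring_axioms)
  show "subgroup (colon R M S z) (add_monoid R)"
  proof (rule R.add.subgroupI)
    show "colon R M S z \<noteq> {}"
      using z submoduleD(2)[OF S] by (auto simp: colon_def intro!: exI[of _ \<zero>])
  qed (use z submoduleD[OF S] in \<open>auto simp: colon_def smult_l_distr smult_l_minus simp flip: a_inv_def\<close>)
  fix a x assume "a \<in> colon R M S z" "x \<in> carrier R"
  then show "x \<otimes> a \<in> colon R M S z" "a \<otimes> x \<in> colon R M S z"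
    using z submoduleD[OF S] by (auto simp: colon_def smult_assoc1 R.m_comm[of a x])
qed

lemma (in Module.module) one_mem_colon_iff:
  assumes S: "submodule S R M" and z: "z \<in> carrier M"
  shows "\<one> \<in> colon R M S z \<longleftrightarrow> z \<in> S"
  using z by (auto simp: colon_def)

lemma (in Module.module) submodule_add_scaled:
  assumes S: "submodule S R M" and x: "x \<in> carrier R"
  shows "submodule (add_scaled M S x) R M"
proof (rule submoduleI)
  note SD = submoduleD[OF S]
  show "add_scaled M S x \<subseteq> carrier M" using SD x by (auto simp: add_scaled_def)
  show "\<zero>\<^bsub>M\<^esub> \<in> add_scaled M S x"
    unfolding add_scaled_def using SD(2) x by (force intro!: exI[of _ "\<zero>\<^bsub>M\<^esub>"])
  show "\<ominus>\<^bsub>M\<^esub> a \<in> add_scaled M S x" if "a \<in> add_scaled M S x" for a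
  proof -
    obtain s y where "a = s \<oplus>\<^bsub>M\<^esub> x \<odot>\<^bsub>M\<^esub> y" "s \<in> S" "y \<in> carrier M"
      using \<open>a \<in> add_scaled M S x\<close> by (auto simp: add_scaled_def)
    then have "\<ominus>\<^bsub>M\<^esub> a = \<ominus>\<^bsub>M\<^esub> s \<oplus>\<^bsub>M\<^esub> x \<odot>\<^bsub>M\<^esub> \<ominus>\<^bsub>M\<^esub> y" "\<ominus>\<^bsub>M\<^esub> s \<in> S" "\<ominus>\<^bsub>M\<^esub> y \<in> carrier M"
      using SD x by (auto simp: M.minus_add smult_r_minus)
    then show ?thesis unfolding add_scaled_def by blast
  qed
  show "a \<oplus>\<^bsub>M\<^esub> b \<in> add_scaled M S x" if "a \<in> add_scaled M S x" "b \<in> add_scaled M S x" for a b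
  proof -
    obtain s y where a: "a = s \<oplus>\<^bsub>M\<^esub> x \<odot>\<^bsub>M\<^esub> y" "s \<in> S" "y \<in> carrier M"
      using \<open>a \<in> add_scaled M S x\<close> by (auto simp: add_scaled_def)
    obtain s' y' where b: "b = s' \<oplus>\<^bsub>M\<^esub> x \<odot>\<^bsub>M\<^esub> y'" "s' \<in> S" "y' \<in> carrier M"
      using \<open>b \<in> add_scaled M S x\<close> by (auto simp: add_scaled_def)
    have "a \<oplus>\<^bsub>M\<^esub> b = (s \<oplus>\<^bsub>M\<^esub> s') \<oplus>\<^bsub>M\<^esub> x \<odot>\<^bsub>M\<^esub> (y \<oplus>\<^bsub>M\<^esub> y')"
      using a b x SD(1) by (simp add: smult_r_distr M.a_ac)
    then show ?thesis unfolding add_scaled_def using a b SD(4) by blast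
  qed
  show "r \<odot>\<^bsub>M\<^esub> a \<in> add_scaled M S x" if r: "r \<in> carrier R" and "a \<in> add_scaled M S x" for r a
  proof -
    obtain s y where a: "a = s \<oplus>\<^bsub>M\<^esub> x \<odot>\<^bsub>M\<^esub> y" "s \<in> S" "y \<in> carrier M"
      using \<open>a \<in> add_scaled M S x\<close> by (auto simp: add_scaled_def)
    have "r \<odot>\<^bsub>M\<^esub> (x \<odot>\<^bsub>M\<^esub> y) = x \<odot>\<^bsub>M\<^esub> (r \<odot>\<^bsub>M\<^esub> y)"
      using r x a by (metis R.m_comm smult_assoc1)
    then have "r \<odot>\<^bsub>M\<^esub> a = r \<odot>\<^bsub>M\<^esub> s \<oplus>\<^bsub>M\<^esub> x \<odot>\<^bsub>M\<^esub> (r \<odot>\<^bsub>M\<^esub> y)"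
      using a r x SD(1) by (simp add: smult_r_distr)
    then show ?thesis unfolding add_scaled_def using a r SD(6) by blast
  qed
qed

lemma (in Module.module) subset_add_scaled:
  assumes S: "submodule S R M" and x: "x \<in> carrier R"
  shows "S \<subseteq> add_scaled M S x"
proof
  fix s assume "s \<in> S"
  then have "s = s \<oplus>\<^bsub>M\<^esub> x \<odot>\<^bsub>M\<^esub> \<zero>\<^bsub>M\<^esub>" using submoduleD(1)[OF S] x by simp
  then show "s \<in> add_scaled M S x" unfolding add_scaled_def using \<open>s \<in> S\<close> by blast
qed

lemma (in Module.module) smult_mem_add_scaled:
  assumes S: "submodule S R M" and x: "x \<in> carrier R" and y: "y \<in> carrier M"
  shows "x \<odot>\<^bsub>M\<^esub> y \<in> add_scaled M S x"
proof -
  have "x \<odot>\<^bsub>M\<^esub> y = \<zero>\<^bsub>M\<^esub> \<oplus>\<^bsub>M\<^esub> x \<odot>\<^bsub>M\<^esub> y" using x y by simp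
  then show ?thesis unfolding add_scaled_def using y submoduleD(2)[OF S] by blast
qed

lemma (in Module.module) submodule_add_cyclic:
  assumes S: "submodule S R M" and y: "y \<in> carrier M"
  shows "submodule (add_cyclic R M S y) R M"
proof (rule submoduleI)
  note SD = submoduleD[OF S]
  show "add_cyclic R M S y \<subseteq> carrier M" using SD y by (auto simp: add_cyclic_def)
  show "\<zero>\<^bsub>M\<^esub> \<in> add_cyclic R M S y"
    unfolding add_cyclic_def using SD(2) y by (force intro!: exI[of _ "\<zero>\<^bsub>M\<^esub>"] exI[of _ \<zero>])
  show "\<ominus>\<^bsub>M\<^esub> a \<in> add_cyclic R M S y" if "a \<in> add_cyclic R M S y" for a
  proof -
    obtain s r where "a = s \<oplus>\<^bsub>M\<^esub> r \<odot>\<^bsub>M\<^esub> y" "s \<in> S" "r \<in> carrier R"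
      using \<open>a \<in> add_cyclic R M S y\<close> by (auto simp: add_cyclic_def)
    then have "\<ominus>\<^bsub>M\<^esub> a = \<ominus>\<^bsub>M\<^esub> s \<oplus>\<^bsub>M\<^esub> (\<ominus> r) \<odot>\<^bsub>M\<^esub> y" "\<ominus>\<^bsub>M\<^esub> s \<in> S" "\<ominus> r \<in> carrier R"
      using SD y by (auto simp: M.minus_add smult_l_minus)
    then show ?thesis unfolding add_cyclic_def by blast
  qed
  show "a \<oplus>\<^bsub>M\<^esub> b \<in> add_cyclic R M S y" if "a \<in> add_cyclic R M S y" "b \<in> add_cyclic R M S y" for a b
  proof -
    obtain s r where a: "a = s \<oplus>\<^bsub>M\<^esub> r \<odot>\<^bsub>M\<^esub> y" "s \<in> S" "r \<in> carrier R"
      using \<open>a \<in> add_cyclic R M S y\<close> by (auto simp: add_cyclic_def)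
    obtain s' r' where b: "b = s' \<oplus>\<^bsub>M\<^esub> r' \<odot>\<^bsub>M\<^esub> y" "s' \<in> S" "r' \<in> carrier R"
      using \<open>b \<in> add_cyclic R M S y\<close> by (auto simp: add_cyclic_def)
    have "a \<oplus>\<^bsub>M\<^esub> b = (s \<oplus>\<^bsub>M\<^esub> s') \<oplus>\<^bsub>M\<^esub> (r \<oplus> r') \<odot>\<^bsub>M\<^esub> y"
      using a b y SD(1) by (simp add: smult_l_distr M.a_ac)
    then show ?thesis unfolding add_cyclic_def using a b SD(4) by blast
  qed
  show "t \<odot>\<^bsub>M\<^esub> a \<in> add_cyclic R M S y" if t: "t \<in> carrier R" and "a \<in> add_cyclic R M S y" for t a
  proof -
    obtain s r where a: "a = s \<oplus>\<^bsub>M\<^esub> r \<odot>\<^bsub>M\<^esub> y" "s \<in> S" "r \<in> carrier R"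
      using \<open>a \<in> add_cyclic R M S y\<close> by (auto simp: add_cyclic_def)
    then have "t \<odot>\<^bsub>M\<^esub> a = t \<odot>\<^bsub>M\<^esub> s \<oplus>\<^bsub>M\<^esub> (t \<otimes> r) \<odot>\<^bsub>M\<^esub> y"
      using t y SD(1) by (simp add: smult_r_distr smult_assoc1)
    then show ?thesis unfolding add_cyclic_def using a t SD(6) R.m_closed by blast
  qed
qed

lemma (in Module.module) add_cyclic_supset:
  assumes S: "submodule S R M" and y: "y \<in> carrier M"
  shows "insert y S \<subseteq> add_cyclic R M S y"
proof -
  have "y = \<zero>\<^bsub>M\<^esub> \<oplus>\<^bsub>M\<^esub> \<one> \<odot>\<^bsub>M\<^esub> y" using y by simp
  then have "y \<in> add_cyclic R M S y"
    unfolding add_cyclic_def using submoduleD(2)[OF S] by blast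
  moreover have "s \<in> add_cyclic R M S y" if "s \<in> S" for s
  proof -
    have "s = s \<oplus>\<^bsub>M\<^esub> \<zero> \<odot>\<^bsub>M\<^esub> y" using y submoduleD(1)[OF S that] by simp
    then show ?thesis unfolding add_cyclic_def using that by blast
  qed
  ultimately show ?thesis by blast
qed

lemma (in Module.module) add_cyclic_least:
  assumes "submodule T R M" "S \<subseteq> T" "y \<in> T"
  shows "add_cyclic R M S y \<subseteq> T"
  using submoduleD[OF assms(1)] assms(2,3) by (auto simp: add_cyclic_def)

section \<open>Ascending chain conditions\<close>

definition acc_submodules :: "('a, 'r) ring_scheme \<Rightarrow> ('a, 'b, 'x) module_scheme \<Rightarrow> 'b set \<Rightarrow> bool"
  where "acc_submodules R M W \<longleftrightarrow>
    wf {(T', T). submodule T R M \<and> submodule T' R M \<and> T' \<subseteq> W \<and> T \<subset> T'}"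

text \<open>By the chain form of the noetherian property, the union of an infinite ascending chain
  would be one of its members, and the next member would exceed it.\<close>

lemma (in noetherian_ring) wf_ideals: "wf {(J, I). ideal I R \<and> ideal J R \<and> I \<subset> J}"
proof (rule ccontr)
  assume "\<not> ?thesis"
  then obtain f where f: "\<And>n. (f (Suc n), f n) \<in> {(J, I). ideal I R \<and> ideal J R \<and> I \<subset> J}"
    unfolding wf_iff_no_infinite_down_chain by blast
  then have sub: "f n \<subset> f (Suc n)" and id: "ideal (f n) R" for n by auto
  have mono: "f m \<subseteq> f n" if "m \<le> n" for m n
    by (rule lift_Suc_mono_le[OF _ that]) (rule psubset_imp_subset[OF sub])
  have "subset.chain {I. ideal I R} (range f)"
    unfolding subset_chain_def
  proof (intro conjI ballI)
    show "range f \<subseteq> {I. ideal I R}" using id by blast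
    fix I J assume "I \<in> range f" "J \<in> range f"
    then obtain m n where "I = f m" "J = f n" by blast
    then show "I \<subseteq> J \<or> J \<subseteq> I" using mono[of m n] mono[of n m] by (cases "m \<le> n") simp_all
  qed
  then have "\<Union>(range f) \<in> range f" by (intro ideal_chain_is_trivial) auto
  then obtain n where "\<Union>(range f) = f n" by auto
  then show False using sub[of n] by blast
qed

lemma (in noetherian_ring) exists_maximal_ideal:
  assumes "I \<in> A" and "\<And>J. J \<in> A \<Longrightarrow> ideal J R"
  obtains J where "J \<in> A" "I \<subseteq> J" "\<And>K. K \<in> A \<Longrightarrow> J \<subseteq> K \<Longrightarrow> K = J"
proof -
  have "I \<in> {J \<in> A. I \<subseteq> J}" using assms by auto
  then obtain J where J: "J \<in> {J \<in> A. I \<subseteq> J}"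
    and max: "\<And>K. (K, J) \<in> {(J, I). ideal I R \<and> ideal J R \<and> I \<subset> J} \<Longrightarrow> K \<notin> {J \<in> A. I \<subseteq> J}"
    using wfE_min[OF wf_ideals, of I "{J \<in> A. I \<subseteq> J}"] by blast
  show thesis
  proof (rule that)
    fix K assume "K \<in> A" "J \<subseteq> K"
    then show "K = J" using max[of K] assms(2) J by blast
  qed (use J in auto)
qed

text \<open>Within W + Ra a submodule \<open>T\<close> is controlled by \<open>W \<inter> T\<close>
  and by the ideal \<open>J T\<close> of the coefficients r for which \<open>T\<close> meets W + ra.
  Enlarging \<open>T\<close> enlarges the first, or fixes it and enlarges the second, so a
  lexicographic order applies. Bounding submodules by \<open>W\<close> lets generators be adjoined
  one at a time.\<close>

lemma (in Module.module) acc_submodules_add_cyclic: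
  assumes noeth: "noetherian_ring R" and W: "submodule W R M" and acc: "acc_submodules R M W"
    and a: "a \<in> carrier M"
  shows "acc_submodules R M (add_cyclic R M W a)"
proof -
  define J where "J T = {r \<in> carrier R. \<exists>w\<in>W. w \<oplus>\<^bsub>M\<^esub> r \<odot>\<^bsub>M\<^esub> a \<in> T}" for T
  note WD = submoduleD[OF W]
  have idealJ: "ideal (J T) R" if T: "submodule T R M" for T
  proof -
    note TD = submoduleD[OF T]
    have J0: "\<zero> \<in> J T" using WD(2) TD(2) a by (auto simp: J_def intro!: bexI[of _ "\<zero>\<^bsub>M\<^esub>"])
    have Jadd: "r \<oplus> s \<in> J T" if "r \<in> J T" "s \<in> J T" for r s
    proof -
      obtain w v where *: "w \<in> W" "v \<in> W" "w \<oplus>\<^bsub>M\<^esub> r \<odot>\<^bsub>M\<^esub> a \<in> T" "v \<oplus>\<^bsub>M\<^esub> s \<odot>\<^bsub>M\<^esub> a \<in> T"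
        "r \<in> carrier R" "s \<in> carrier R"
        using \<open>r \<in> J T\<close> \<open>s \<in> J T\<close> by (auto simp: J_def)
      have "(w \<oplus>\<^bsub>M\<^esub> v) \<oplus>\<^bsub>M\<^esub> (r \<oplus> s) \<odot>\<^bsub>M\<^esub> a = (w \<oplus>\<^bsub>M\<^esub> r \<odot>\<^bsub>M\<^esub> a) \<oplus>\<^bsub>M\<^esub> (v \<oplus>\<^bsub>M\<^esub> s \<odot>\<^bsub>M\<^esub> a)"
        using * WD(1) a by (simp add: smult_l_distr M.a_ac)
      also have "\<dots> \<in> T" using * TD(4) by blast
      finally show ?thesis using * WD(4) by (auto simp: J_def)
    qed
    have Jmul: "x \<otimes> r \<in> J T" if "r \<in> J T" "x \<in> carrier R" for r x
    proof -
      obtain w where *: "w \<in> W" "w \<oplus>\<^bsub>M\<^esub> r \<odot>\<^bsub>M\<^esub> a \<in> T" "r \<in> carrier R"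
        using \<open>r \<in> J T\<close> by (auto simp: J_def)
      have "x \<odot>\<^bsub>M\<^esub> w \<oplus>\<^bsub>M\<^esub> (x \<otimes> r) \<odot>\<^bsub>M\<^esub> a = x \<odot>\<^bsub>M\<^esub> (w \<oplus>\<^bsub>M\<^esub> r \<odot>\<^bsub>M\<^esub> a)"
        using * WD(1) a that by (simp add: smult_r_distr smult_assoc1)
      also have "\<dots> \<in> T" using * TD(6) that by blast
      finally show ?thesis using * WD(6) that by (auto simp: J_def)
    qed
    show ?thesis
    proof (rule idealI)
      show "ring R" by (rule R.ring_axioms)
      show "subgroup (J T) (add_monoid R)"
      proof (rule R.add.subgroupI)
        fix r assume r: "r \<in> J T"
        then have "(\<ominus> \<one>) \<otimes> r \<in> J T" by (intro Jmul) auto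
        moreover have "r \<in> carrier R" using r by (auto simp: J_def)
        ultimately show "\<ominus> r \<in> J T" by (simp add: R.l_minus)
      qed (use J0 Jadd in \<open>auto simp: J_def\<close>)
      fix r x assume *: "r \<in> J T" "x \<in> carrier R"
      then show "x \<otimes> r \<in> J T" by (rule Jmul)
      moreover have "r \<in> carrier R" using * by (auto simp: J_def)
      ultimately show "r \<otimes> x \<in> J T" using * by (simp add: R.m_comm)
    qed
  qed
  let ?rW = "{(T', T). submodule T R M \<and> submodule T' R M \<and> T' \<subseteq> W \<and> T \<subset> T'}"
  let ?rI = "{(J, I). ideal I R \<and> ideal J R \<and> I \<subset> J}"
  have wf: "wf (inv_image (?rW <*lex*> ?rI) (\<lambda>T. (W \<inter> T, J T)))"
    using acc noetherian_ring.wf_ideals[OF noeth] unfolding acc_submodules_def by blast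
  show ?thesis
    unfolding acc_submodules_def
  proof (rule wf_subset[OF wf], rule subrelI)
    fix T' T
    assume "(T', T) \<in> {(T', T). submodule T R M \<and> submodule T' R M \<and>
      T' \<subseteq> add_cyclic R M W a \<and> T \<subset> T'}"
    then have T: "submodule T R M" and T': "submodule T' R M"
      and sub: "T' \<subseteq> add_cyclic R M W a" and "T \<subset> T'" by auto
    have int: "submodule (W \<inter> U) R M" if "submodule U R M" for U
      using WD submoduleD[OF that] by (intro submoduleI) auto
    have JJ: "J T \<subseteq> J T'" using \<open>T \<subset> T'\<close> by (auto simp: J_def)
    have "T' \<subseteq> T" if WT: "W \<inter> T = W \<inter> T'" and J: "J T = J T'"
    proof
      fix t assume t: "t \<in> T'"
      then obtain w r where wr: "w \<in> W" "r \<in> carrier R" "t = w \<oplus>\<^bsub>M\<^esub> r \<odot>\<^bsub>M\<^esub> a"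
        using sub by (auto simp: add_cyclic_def)
      then have "r \<in> J T'" using t by (auto simp: J_def)
      \<comment> \<open>v + ra is an element of \<open>T\<close> with the same coefficient at
        \<open>a\<close> as \<open>t\<close>; the difference w - v lies in \<open>W\<close>, where
        \<open>T\<close> and \<open>T'\<close> agree.\<close>
      then obtain v where v: "v \<in> W" "v \<oplus>\<^bsub>M\<^esub> r \<odot>\<^bsub>M\<^esub> a \<in> T" using J by (auto simp: J_def)
      have "t \<ominus>\<^bsub>M\<^esub> (v \<oplus>\<^bsub>M\<^esub> r \<odot>\<^bsub>M\<^esub> a) = w \<ominus>\<^bsub>M\<^esub> v"
        using wr v a WD(1) by (simp add: M.minus_add M.minus_eq M.a_ac M.r_neg M.r_neg1 M.r_neg2)
      moreover have "t \<ominus>\<^bsub>M\<^esub> (v \<oplus>\<^bsub>M\<^esub> r \<odot>\<^bsub>M\<^esub> a) \<in> T'"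
        using submoduleD(5)[OF T' t] v \<open>T \<subset> T'\<close> by blast
      moreover have "w \<ominus>\<^bsub>M\<^esub> v \<in> W" using WD(5) wr v by blast
      ultimately have "w \<ominus>\<^bsub>M\<^esub> v \<in> W \<inter> T'" by simp
      then have "w \<ominus>\<^bsub>M\<^esub> v \<in> T" unfolding WT[symmetric] by simp
      then have "(w \<ominus>\<^bsub>M\<^esub> v) \<oplus>\<^bsub>M\<^esub> (v \<oplus>\<^bsub>M\<^esub> r \<odot>\<^bsub>M\<^esub> a) \<in> T" using v submoduleD(4)[OF T] by blast
      moreover have "(w \<ominus>\<^bsub>M\<^esub> v) \<oplus>\<^bsub>M\<^esub> (v \<oplus>\<^bsub>M\<^esub> r \<odot>\<^bsub>M\<^esub> a) = t"
        using wr v a WD(1) by (simp add: M.minus_eq M.a_assoc M.r_neg1)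
      ultimately show "t \<in> T" by simp
    qed
    then have lt: "W \<inter> T \<subset> W \<inter> T' \<or> W \<inter> T' = W \<inter> T \<and> J T \<subset> J T'"
      using JJ \<open>T \<subset> T'\<close> by blast
    from lt have "(W \<inter> T', W \<inter> T) \<in> ?rW \<or> W \<inter> T' = W \<inter> T \<and> (J T', J T) \<in> ?rI"
      using int[OF T] int[OF T'] idealJ[OF T] idealJ[OF T'] by simp
    then show "(T', T) \<in> inv_image (?rW <*lex*> ?rI) (\<lambda>T. (W \<inter> T, J T))"
      by (simp only: in_inv_image in_lex_prod)
  qed
qed

lemma (in Module.module) acc_submodules_fin_gen:
  assumes noeth: "noetherian_ring R" and "fin_gen_module R M"
  shows "acc_submodules R M (carrier M)"
proof -
  have "\<exists>W. submodule W R M \<and> A \<subseteq> W \<and> acc_submodules R M W" if "finite A" "A \<subseteq> carrier M" for A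
    using that
  proof (induction A rule: finite_induct)
    case empty
    have "{(T', T). submodule T R M \<and> submodule T' R M \<and> T' \<subseteq> {\<zero>\<^bsub>M\<^esub>} \<and> T \<subset> T'} = {}"
      using submoduleD(2) by blast
    then have "acc_submodules R M {\<zero>\<^bsub>M\<^esub>}" unfolding acc_submodules_def by (simp only:) simp
    moreover have "submodule {\<zero>\<^bsub>M\<^esub>} R M" by (rule submoduleI) auto
    ultimately show ?case by blast
  next
    case (insert a A)
    then obtain W where W: "submodule W R M" "A \<subseteq> W" "acc_submodules R M W" by auto
    have a: "a \<in> carrier M" using insert by auto
    show ?case
      using submodule_add_cyclic[OF W(1) a] add_cyclic_supset[OF W(1) a]
        acc_submodules_add_cyclic[OF noeth W(1,3) a] W(2) by blast
  qed
  moreover obtain A where A: "finite A" "A \<subseteq> carrier M" "module_span R M A = carrier M"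
    using assms(2) by (auto simp: fin_gen_module_def)
  ultimately obtain W where W: "submodule W R M" "A \<subseteq> W" "acc_submodules R M W" by blast
  have "carrier M \<subseteq> W" using W(1,2) A(3) by (auto simp: module_span_def)
  then have "W = carrier M" using submoduleD(1)[OF W(1)] by blast
  then show ?thesis using W by simp
qed

lemma (in Module.module) exists_maximal_submodule:
  assumes "acc_submodules R M (carrier M)" and "S \<in> A" and "\<And>T. T \<in> A \<Longrightarrow> submodule T R M"
  obtains T where "T \<in> A" "\<And>U. U \<in> A \<Longrightarrow> T \<subseteq> U \<Longrightarrow> U = T"
proof -
  obtain T where T: "T \<in> A"
    and max: "\<And>U. (U, T) \<in> {(T', T). submodule T R M \<and> submodule T' R M \<and> T' \<subseteq> carrier M \<and> T \<subset> T'}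
      \<Longrightarrow> U \<notin> A"
    using wfE_min[OF assms(1)[unfolded acc_submodules_def] assms(2)] by blast
  show thesis
  proof (rule that[OF T])
    fix U assume "U \<in> A" "T \<subseteq> U"
    then show "U = T" using max[of U] assms(3) submoduleD(1) T by blast
  qed
qed

section \<open>Zero divisors and regular elements modulo a submodule\<close>

text \<open>If ab sends \<open>z\<close> into \<open>S\<close> and b does not, then bz is outside
  \<open>S\<close>, and its colon contains a as well as the colon of \<open>z\<close>; maximality
  puts a into the latter.\<close>

lemma (in Module.module) primeideal_maximal_colon:
  assumes S: "submodule S R M" and z: "z \<in> carrier M" "z \<notin> S"
    and max: "\<And>w. w \<in> carrier M \<Longrightarrow> w \<notin> S \<Longrightarrow> colon R M S z \<subseteq> colon R M S w \<Longrightarrow>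
      colon R M S w = colon R M S z"
  shows "primeideal (colon R M S z) R"
proof (rule primeidealI)
  show "ideal (colon R M S z) R" by (rule ideal_colon[OF S z(1)])
  show "cring R" by (rule R.is_cring)
  show "carrier R \<noteq> colon R M S z" using one_mem_colon_iff[OF S z(1)] z(2) by blast
  fix a b assume ab: "a \<in> carrier R" "b \<in> carrier R" "a \<otimes> b \<in> colon R M S z"
  show "a \<in> colon R M S z \<or> b \<in> colon R M S z"
  proof (rule ccontr)
    assume no: "\<not> ?thesis"
    let ?w = "b \<odot>\<^bsub>M\<^esub> z"
    have w: "?w \<in> carrier M" "?w \<notin> S" using no ab z by (auto simp: colon_def)
    have "r \<in> colon R M S ?w" if "r \<in> colon R M S z" for r
    proof -
      have r: "r \<in> carrier R" "r \<odot>\<^bsub>M\<^esub> z \<in> S" using that by (auto simp: colon_def)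
      have "r \<odot>\<^bsub>M\<^esub> ?w = b \<odot>\<^bsub>M\<^esub> (r \<odot>\<^bsub>M\<^esub> z)" using r ab z by (metis R.m_comm smult_assoc1)
      then show ?thesis using submoduleD(6)[OF S ab(2) r(2)] r by (simp add: colon_def)
    qed
    then have "colon R M S ?w = colon R M S z" using max[OF w] by blast
    moreover have "a \<in> colon R M S ?w"
      using ab z by (auto simp: colon_def smult_assoc1)
    ultimately show False using no by blast
  qed
qed

text \<open>A maximal colon above the given one exists by noetherianity. Its maximality is handed on
  together with primality, because it makes the primes used in prime avoidance pairwise
  incomparable.\<close>

lemma (in Module.module) colon_subset_prime_colon:
  assumes noeth: "noetherian_ring R" and S: "submodule S R M" and z: "z \<in> carrier M" "z \<notin> S"
  obtains w where "w \<in> carrier M" "w \<notin> S" "colon R M S z \<subseteq> colon R M S w"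
    "primeideal (colon R M S w) R"
    "\<And>v. v \<in> carrier M \<Longrightarrow> v \<notin> S \<Longrightarrow> colon R M S w \<subseteq> colon R M S v \<Longrightarrow>
      colon R M S v = colon R M S w"
proof -
  let ?A = "colon R M S ` (carrier M - S)"
  have mem: "colon R M S z \<in> ?A" using z by blast
  have ideals: "ideal J R" if "J \<in> ?A" for J using that ideal_colon[OF S] by blast
  obtain J where J: "J \<in> ?A" "colon R M S z \<subseteq> J" "\<And>K. K \<in> ?A \<Longrightarrow> J \<subseteq> K \<Longrightarrow> K = J"
    using noetherian_ring.exists_maximal_ideal[OF noeth mem ideals] by blast
  obtain w where w: "w \<in> carrier M" "w \<notin> S" "J = colon R M S w" using J(1) by blast
  have max: "colon R M S v = colon R M S w"
    if "v \<in> carrier M" "v \<notin> S" "colon R M S w \<subseteq> colon R M S v" for v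
    using J(3)[of "colon R M S v"] that w(3) by blast
  show thesis
    using w J(2) by (intro that[of w] primeideal_maximal_colon S max) auto
qed

text \<open>Multiply an element of \<open>I\<close> outside \<open>P\<close> by one element outside
  \<open>P\<close> from each member of \<open>A\<close>. Contraposed: a prime containing a finite
  intersection of ideals contains one of them.\<close>

lemma (in cring) ideal_mult_avoid_prime:
  assumes P: "primeideal P R" and "finite A" and A: "\<And>Q. Q \<in> A \<Longrightarrow> ideal Q R \<and> \<not> Q \<subseteq> P"
    and I: "ideal I R" "\<not> I \<subseteq> P"
  shows "\<exists>w\<in>I. w \<notin> P \<and> (\<forall>Q\<in>A. w \<in> Q)"
  using assms(2) A
proof (induction A rule: finite_induct)
  case empty
  then show ?case using I by blast
next
  case (insert Q A)
  then obtain w where w: "w \<in> I" "w \<notin> P" "\<forall>Q\<in>A. w \<in> Q" by auto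
  obtain q where q: "q \<in> Q" "q \<notin> P" using insert by blast
  have carr: "w \<in> carrier R" "q \<in> carrier R"
    using ideal.Icarr[OF I(1) w(1)] ideal.Icarr[of Q R q] insert q by auto
  have "q \<otimes> w \<in> I" using ideal.I_l_closed[OF I(1)] w carr by blast
  moreover have "q \<otimes> w \<notin> P" using primeideal.I_prime[OF P] w q carr by blast
  moreover have "q \<otimes> w \<in> Q" using ideal.I_r_closed[of Q R] insert q carr by blast
  moreover have "q \<otimes> w \<in> Q'" if "Q' \<in> A" for Q'
    using ideal.I_l_closed[of Q' R] insert w carr that by blast
  ultimately show ?case by blast
qed

text \<open>Incomparability reduces the induction step to a single correction: if the
  \<open>x\<close> found for \<open>A\<close> falls into the new prime \<open>P\<close>, some w in
  \<open>I\<close> and in every member of \<open>A\<close> avoids \<open>P\<close>, and w + x avoids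
  them all.\<close>

lemma (in cring) prime_avoidance:
  assumes "finite A" and "\<And>P. P \<in> A \<Longrightarrow> primeideal P R"
    and "\<And>P Q. P \<in> A \<Longrightarrow> Q \<in> A \<Longrightarrow> Q \<subseteq> P \<Longrightarrow> Q = P"
    and I: "ideal I R" and "\<And>P. P \<in> A \<Longrightarrow> \<not> I \<subseteq> P"
  shows "\<exists>x\<in>I. \<forall>P\<in>A. x \<notin> P"
  using assms(1-3,5)
proof (induction A rule: finite_induct)
  case empty
  then show ?case using additive_subgroup.zero_closed[OF ideal.axioms(1)[OF I]] by blast
next
  case (insert P A)
  have "\<exists>x\<in>I. \<forall>P\<in>A. x \<notin> P" using insert.prems by (intro insert.IH) auto
  then obtain x where x: "x \<in> I" "\<forall>P\<in>A. x \<notin> P" by blast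
  show ?case
  proof (cases "x \<in> P")
    case False
    then show ?thesis using x by blast
  next
    case True
    have P: "primeideal P R" using insert.prems by blast
    have "\<not> Q \<subseteq> P" if "Q \<in> A" for Q
      using insert.prems(2)[of P Q] insert.hyps that by auto
    moreover have "ideal Q R" if "Q \<in> A" for Q
      using insert.prems(1) that by (auto intro: primeideal.axioms)
    ultimately obtain w where w: "w \<in> I" "w \<notin> P" "\<forall>Q\<in>A. w \<in> Q"
      using ideal_mult_avoid_prime[OF P insert.hyps(1), of I] I insert.prems(3)[of P] by blast
    have carr: "w \<in> carrier R" "x \<in> carrier R" using ideal.Icarr[OF I] w(1) x(1) by auto
    have wx: "w \<oplus> x \<in> I"
      using additive_subgroup.a_closed[OF ideal.axioms(1)[OF I]] w(1) x(1) by blast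
    have cancel: "b \<in> Q" if "primeideal Q R" "a \<in> Q" "a \<oplus> b \<in> Q" "b \<in> carrier R" for a b Q
    proof -
      interpret Q: primeideal Q R by fact
      have "\<ominus> a \<oplus> (a \<oplus> b) \<in> Q" by (rule Q.a_closed[OF Q.a_inv_closed[OF that(2)] that(3)])
      then show ?thesis using that(4) Q.Icarr[OF that(2)] r_neg1 by simp
    qed
    have "w \<oplus> x \<notin> P" using cancel[OF P True, of w] w carr a_comm[of w x] by auto
    moreover have "w \<oplus> x \<notin> Q" if "Q \<in> A" for Q
      using cancel[of Q w x] insert.prems(1)[of Q] w(3) x(2) carr that by blast
    ultimately show ?thesis using wx by blast
  qed
qed

lemma (in Module.module) finite_maximal_colons:
  assumes acc: "acc_submodules R M (carrier M)" and S: "submodule S R M"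
    and Z: "Z \<subseteq> carrier M - S"
    and prime: "\<And>z. z \<in> Z \<Longrightarrow> primeideal (colon R M S z) R"
    and max: "\<And>z v. z \<in> Z \<Longrightarrow> v \<in> Z \<Longrightarrow> colon R M S z \<subseteq> colon R M S v \<Longrightarrow>
      colon R M S v = colon R M S z"
  shows "finite (colon R M S ` Z)"
proof -
  \<comment> \<open>A maximal \<open>U \<in> \<U>\<close> contains \<open>Z\<close>. Hence all colons contain the intersection of the same
    finitely many ones, and being prime they contain one of these.\<close>
  define \<U> where "\<U> = {U. submodule U R M \<and> S \<subseteq> U \<and>
    (\<exists>F. finite F \<and> F \<subseteq> Z \<and> (\<forall>u\<in>U. (\<Inter>z\<in>F. colon R M S z) \<inter> carrier R \<subseteq> colon R M S u))}"
  \<comment> \<open>The witness is the empty \<open>F\<close>, whose intersection is the universal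
    set; cutting with \<open>carrier R\<close> makes the inclusion hold.\<close>
  have mem: "S \<in> \<U>"
    using S submoduleD[OF S] by (auto simp: \<U>_def colon_def intro!: exI[of _ "{}"])
  have sub: "submodule U R M" if "U \<in> \<U>" for U using that by (simp add: \<U>_def)
  obtain U where U: "U \<in> \<U>" and Umax: "\<And>V. V \<in> \<U> \<Longrightarrow> U \<subseteq> V \<Longrightarrow> V = U"
    using exists_maximal_submodule[OF acc mem sub] by blast
  then have US: "submodule U R M" "S \<subseteq> U" by (simp_all add: \<U>_def)
  from U obtain F where F: "finite F" "F \<subseteq> Z"
    and FU: "\<forall>u\<in>U. (\<Inter>z\<in>F. colon R M S z) \<inter> carrier R \<subseteq> colon R M S u"
    unfolding \<U>_def mem_Collect_eq by (elim conjE exE)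
  have ZU: "z \<in> U" if z: "z \<in> Z" for z
  proof -
    have zM: "z \<in> carrier M" using z Z by blast
    let ?V = "add_cyclic R M U z"
    have "(\<Inter>z\<in>insert z F. colon R M S z) \<inter> carrier R \<subseteq> colon R M S v" if v: "v \<in> ?V" for v
    proof
      fix x assume x: "x \<in> (\<Inter>z\<in>insert z F. colon R M S z) \<inter> carrier R"
      obtain u r where ur: "u \<in> U" "r \<in> carrier R" "v = u \<oplus>\<^bsub>M\<^esub> r \<odot>\<^bsub>M\<^esub> z"
        using v by (auto simp: add_cyclic_def)
      have "x \<odot>\<^bsub>M\<^esub> u \<in> S" using bspec[OF FU ur(1)] x by (auto simp: colon_def)
      moreover have "x \<odot>\<^bsub>M\<^esub> z \<in> S" using x by (auto simp: colon_def)
      moreover have "x \<odot>\<^bsub>M\<^esub> v = x \<odot>\<^bsub>M\<^esub> u \<oplus>\<^bsub>M\<^esub> r \<odot>\<^bsub>M\<^esub> (x \<odot>\<^bsub>M\<^esub> z)"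
        using x ur zM submoduleD(1)[OF US(1)]
        by (simp add: smult_r_distr flip: smult_assoc1) (simp add: R.m_comm)
      ultimately show "x \<in> colon R M S v"
        using x ur submoduleD(4,6)[OF S] by (simp add: colon_def)
    qed
    moreover have "submodule ?V R M" by (rule submodule_add_cyclic[OF US(1) zM])
    moreover have "insert z U \<subseteq> ?V" by (rule add_cyclic_supset[OF US(1) zM])
    moreover have "finite (insert z F)" "insert z F \<subseteq> Z" using F z by auto
    ultimately have "?V \<in> \<U>" unfolding \<U>_def using US(2) by blast
    then have "?V = U" using Umax \<open>insert z U \<subseteq> ?V\<close> by blast
    then show ?thesis using \<open>insert z U \<subseteq> ?V\<close> by blast
  qed
  have "colon R M S z \<in> colon R M S ` F" if z: "z \<in> Z" for z
  proof (rule ccontr)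
    assume no: "colon R M S z \<notin> colon R M S ` F"
    have "\<not> Q \<subseteq> colon R M S z" if "Q \<in> colon R M S ` F" for Q
      using no max[OF _ z] F(2) that by blast
    moreover have "ideal Q R" if "Q \<in> colon R M S ` F" for Q
      using that F(2) Z ideal_colon[OF S] by blast
    moreover have "\<not> carrier R \<subseteq> colon R M S z"
      using primeideal.I_notcarr[OF prime[OF z]] ideal.Icarr[OF primeideal.axioms(1)[OF prime[OF z]]] by blast
    ultimately obtain w where "w \<in> carrier R" "w \<notin> colon R M S z" "\<forall>Q\<in>colon R M S ` F. w \<in> Q"
      using R.ideal_mult_avoid_prime[OF prime[OF z] finite_imageI[OF F(1)] _ R.oneideal] by meson
    then show False using bspec[OF FU ZU[OF z]] by blast
  qed
  then show ?thesis using F(1) by (meson finite_imageI finite_subset image_subsetI)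
qed

text \<open>Every zero divisor modulo \<open>S\<close> lies in a maximal colon. These are finitely
  many incomparable primes, so prime avoidance puts a whole ideal of zero divisors into one of
  them.\<close>

lemma (in Module.module) zero_divisors_annihilate:
  assumes noeth: "noetherian_ring R" and acc: "acc_submodules R M (carrier M)"
    and S: "submodule S R M" and I: "ideal I R"
    and zd: "\<And>x. x \<in> I \<Longrightarrow> \<not> regular_mod M S x"
  obtains z where "z \<in> carrier M" "z \<notin> S" "I \<subseteq> colon R M S z" "primeideal (colon R M S z) R"
proof -
  define Z where "Z = {z \<in> carrier M - S. primeideal (colon R M S z) R \<and>
    (\<forall>v\<in>carrier M - S. colon R M S z \<subseteq> colon R M S v \<longrightarrow> colon R M S v = colon R M S z)}"
  have fin: "finite (colon R M S ` Z)"
    by (rule finite_maximal_colons[OF acc S]) (auto simp: Z_def)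
  have cover: "\<exists>z\<in>Z. x \<in> colon R M S z" if x: "x \<in> I" for x
  proof -
    obtain y where y: "y \<in> carrier M" "y \<notin> S" "x \<odot>\<^bsub>M\<^esub> y \<in> S"
      using zd[OF x] by (auto simp: regular_mod_def)
    then have "x \<in> colon R M S y" using ideal.Icarr[OF I x] by (simp add: colon_def)
    moreover obtain w where "w \<in> carrier M" "w \<notin> S" "colon R M S y \<subseteq> colon R M S w"
      "primeideal (colon R M S w) R"
      "\<And>v. v \<in> carrier M \<Longrightarrow> v \<notin> S \<Longrightarrow> colon R M S w \<subseteq> colon R M S v \<Longrightarrow>
        colon R M S v = colon R M S w"
      using colon_subset_prime_colon[OF noeth S y(1,2)] by blast
    ultimately show ?thesis by (intro bexI[of _ w]) (auto simp: Z_def)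
  qed
  have "\<exists>P\<in>colon R M S ` Z. I \<subseteq> P"
  proof (rule ccontr)
    assume no: "\<not> ?thesis"
    have "\<exists>x\<in>I. \<forall>P\<in>colon R M S ` Z. x \<notin> P"
      by (rule R.prime_avoidance[OF fin _ _ I]) (use no in \<open>auto simp: Z_def\<close>)
    then show False using cover by blast
  qed
  then show thesis using that by (auto simp: Z_def)
qed

section \<open>Units of a local ring and Nakayama's lemma\<close>

lemma max_ideal_unique:
  assumes "local_cring R"
  shows "maximalideal (max_ideal R) R" and "maximalideal I R \<Longrightarrow> I = max_ideal R"
  using assms theI'[of "\<lambda>m. maximalideal m R"] unfolding local_cring_def max_ideal_def by auto

text \<open>A nonunit would generate a proper ideal, contained in a maximal one by noetherianity and
  hence in \<open>max_ideal R\<close>; adding rx would then put 1 there.\<close>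

lemma (in cring) one_minus_unit_local:
  assumes loc: "local_cring R" and x: "x \<in> max_ideal R" and r: "r \<in> carrier R"
    and noeth: "noetherian_ring R"
  shows "\<one> \<ominus> r \<otimes> x \<in> Units R"
proof -
  interpret m: maximalideal "max_ideal R" R by (rule max_ideal_unique(1)[OF loc])
  have xc: "x \<in> carrier R" using x m.Icarr by blast
  let ?u = "\<one> \<ominus> r \<otimes> x"
  have uc: "?u \<in> carrier R" using xc r by simp
  show ?thesis
  proof (rule ccontr)
    assume nu: "?u \<notin> Units R"
    have "\<one> \<notin> PIdl ?u"
    proof
      assume "\<one> \<in> PIdl ?u"
      then obtain s where "s \<in> carrier R" "\<one> = s \<otimes> ?u" by (auto simp: cgenideal_def)
      then show False using nu uc m_comm[of s ?u] by (auto simp: Units_def)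
    qed
    then have mem: "PIdl ?u \<in> {I. ideal I R \<and> \<one> \<notin> I}" using cgenideal_ideal[OF uc] by simp
    have ideals: "ideal J R" if "J \<in> {I. ideal I R \<and> \<one> \<notin> I}" for J using that by simp
    obtain J where J: "J \<in> {I. ideal I R \<and> \<one> \<notin> I}" "PIdl ?u \<subseteq> J"
      "\<And>K. K \<in> {I. ideal I R \<and> \<one> \<notin> I} \<Longrightarrow> J \<subseteq> K \<Longrightarrow> K = J"
      using noetherian_ring.exists_maximal_ideal[OF noeth mem ideals] by blast
    have "maximalideal J R"
    proof (rule maximalidealI)
      show "ideal J R" using J by simp
      show "carrier R \<noteq> J" using J(1) by auto
      fix K assume K: "ideal K R" "J \<subseteq> K" "K \<subseteq> carrier R"
      then show "K = J \<or> K = carrier R"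
        using J(3)[of K] ideal.one_imp_carrier[OF K(1)] by blast
    qed
    then have "?u \<in> max_ideal R" using max_ideal_unique(2)[OF loc] J(2) cgenideal_self[OF uc] by blast
    moreover have "r \<otimes> x \<in> max_ideal R" using m.I_l_closed x r by blast
    ultimately have "?u \<oplus> r \<otimes> x \<in> max_ideal R" by (rule m.a_closed)
    moreover have "?u \<oplus> r \<otimes> x = \<one>" using r xc by (simp add: minus_eq a_assoc l_neg)
    ultimately have "max_ideal R = carrier R" using m.one_imp_carrier by simp
    then show False using m.I_notcarr by simp
  qed
qed

text \<open>
  The elements \<open>t\<close> with \<open>I t \<subseteq> S\<close> form a submodule \<open>T\<close>. If \<open>T \<subseteq> S + xM\<close>, then \<open>T = S + xT\<close> by
  regularity, which is impossible by Nakayama. The proof takes \<open>S + R y\<close> maximal with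
  \<open>y \<in> T - S\<close>.
\<close>

lemma (in Module.module) annihilated_mod_add_scaled:
  assumes noeth: "noetherian_ring R" and acc: "acc_submodules R M (carrier M)"
    and loc: "local_cring R" and S: "submodule S R M"
    and x: "x \<in> max_ideal R" "x \<in> carrier R" and reg: "regular_mod M S x"
    and z: "z \<in> carrier M" "z \<notin> S" and I: "I \<subseteq> colon R M S z"
  shows "\<exists>w\<in>carrier M - add_scaled M S x. I \<subseteq> colon R M S w"
proof (rule ccontr)
  assume no: "\<not> ?thesis"
  \<comment> \<open>Only elements outside \<open>S\<close> are kept, so this \<open>T\<close> is not
    itself a submodule; the maximal submodule below is sought among the S + Rt with t in
    \<open>T\<close>.\<close>
  define T where "T = {t \<in> carrier M - S. I \<subseteq> colon R M S t}"
  have step: "\<exists>s\<in>S. \<exists>y\<in>T. t = s \<oplus>\<^bsub>M\<^esub> x \<odot>\<^bsub>M\<^esub> y" if t: "t \<in> T" for t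
  proof -
    have "t \<in> add_scaled M S x" using no t by (auto simp: T_def)
    then obtain s y where sy: "s \<in> S" "y \<in> carrier M" "t = s \<oplus>\<^bsub>M\<^esub> x \<odot>\<^bsub>M\<^esub> y"
      by (auto simp: add_scaled_def)
    have "y \<notin> S" using t sy submoduleD(4,6)[OF S] x by (auto simp: T_def)
    moreover have "r \<in> colon R M S y" if "r \<in> I" for r
    proof -
      have r: "r \<in> carrier R" "r \<odot>\<^bsub>M\<^esub> t \<in> S" using t that by (auto simp: T_def colon_def)
      have "r \<odot>\<^bsub>M\<^esub> t = r \<odot>\<^bsub>M\<^esub> s \<oplus>\<^bsub>M\<^esub> x \<odot>\<^bsub>M\<^esub> (r \<odot>\<^bsub>M\<^esub> y)"
        using sy r x submoduleD(1)[OF S]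
        by (simp add: smult_r_distr flip: smult_assoc1) (simp add: R.m_comm)
      then have "x \<odot>\<^bsub>M\<^esub> (r \<odot>\<^bsub>M\<^esub> y) \<in> S"
        using r sy x submodule_add_mem_iff[OF S submoduleD(6)[OF S r(1) sy(1)], of "x \<odot>\<^bsub>M\<^esub> (r \<odot>\<^bsub>M\<^esub> y)"] by simp
      then show ?thesis using reg r sy by (auto simp: regular_mod_def colon_def)
    qed
    ultimately have "y \<in> T" using sy by (auto simp: T_def)
    then show ?thesis using sy by blast
  qed
  have TM: "t \<in> carrier M" if "t \<in> T" for t using that by (simp add: T_def)
  have "z \<in> T" using z I by (simp add: T_def)
  then have mem: "add_cyclic R M S z \<in> add_cyclic R M S ` T" by blast
  have sub: "submodule U R M" if "U \<in> add_cyclic R M S ` T" for U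
    using that submodule_add_cyclic[OF S] TM by blast
  obtain U where U: "U \<in> add_cyclic R M S ` T"
    and max: "\<And>V. V \<in> add_cyclic R M S ` T \<Longrightarrow> U \<subseteq> V \<Longrightarrow> V = U"
    using exists_maximal_submodule[OF acc mem sub] by blast
  obtain y where y: "y \<in> T" "U = add_cyclic R M S y" using U by blast
  obtain s y' where sy: "s \<in> S" "y' \<in> T" "y = s \<oplus>\<^bsub>M\<^esub> x \<odot>\<^bsub>M\<^esub> y'" using step[OF y(1)] by blast
  let ?V = "add_cyclic R M S y'"
  have V: "submodule ?V R M" "insert y' S \<subseteq> ?V"
    using submodule_add_cyclic[OF S] add_cyclic_supset[OF S] TM[OF sy(2)] by auto
  have "y \<in> ?V" unfolding sy(3) using V sy x submoduleD(4,6)[OF V(1)] by blast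
  then have "U \<subseteq> ?V" unfolding y(2) using V by (intro add_cyclic_least) auto
  then have "?V = U" using max sy(2) by blast
  then have "y' \<in> add_cyclic R M S y" using V(2) y(2) by blast
  then obtain s' r where sr: "s' \<in> S" "r \<in> carrier R" "y' = s' \<oplus>\<^bsub>M\<^esub> r \<odot>\<^bsub>M\<^esub> y"
    by (auto simp: add_cyclic_def)
  let ?u = "\<one> \<ominus> r \<otimes> x"
  have carr: "s \<in> carrier M" "s' \<in> carrier M" "y' \<in> carrier M"
    using submoduleD(1)[OF S] sr sy TM by auto
  \<comment> \<open>Substituting y = s + xy' into y' = s' + ry leaves (1 - rx)y' in
    \<open>S\<close>. The factor is a unit, so \<open>y'\<close> lies in \<open>S\<close>, contrary
    to \<open>y' \<in> T\<close>.\<close>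
  have u: "?u \<in> Units R" by (rule R.one_minus_unit_local[OF loc x(1) sr(2) noeth])
  have "y' = s' \<oplus>\<^bsub>M\<^esub> r \<odot>\<^bsub>M\<^esub> (s \<oplus>\<^bsub>M\<^esub> x \<odot>\<^bsub>M\<^esub> y')" using sr(3) unfolding sy(3) .
  also have "\<dots> = (s' \<oplus>\<^bsub>M\<^esub> r \<odot>\<^bsub>M\<^esub> s) \<oplus>\<^bsub>M\<^esub> (r \<otimes> x) \<odot>\<^bsub>M\<^esub> y'"
    using carr sr(2) x(2) by (simp add: smult_r_distr smult_assoc1 M.a_assoc)
  finally have y'_eq: "y' = (s' \<oplus>\<^bsub>M\<^esub> r \<odot>\<^bsub>M\<^esub> s) \<oplus>\<^bsub>M\<^esub> (r \<otimes> x) \<odot>\<^bsub>M\<^esub> y'" .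
  have "?u \<odot>\<^bsub>M\<^esub> y' = y' \<ominus>\<^bsub>M\<^esub> (r \<otimes> x) \<odot>\<^bsub>M\<^esub> y'"
    using carr sr(2) x(2) by (simp add: R.minus_eq smult_l_distr smult_l_minus M.minus_eq)
  also have "\<dots> = ((s' \<oplus>\<^bsub>M\<^esub> r \<odot>\<^bsub>M\<^esub> s) \<oplus>\<^bsub>M\<^esub> (r \<otimes> x) \<odot>\<^bsub>M\<^esub> y') \<ominus>\<^bsub>M\<^esub> (r \<otimes> x) \<odot>\<^bsub>M\<^esub> y'"
    by (rule arg_cong[OF y'_eq, of "\<lambda>v. v \<ominus>\<^bsub>M\<^esub> (r \<otimes> x) \<odot>\<^bsub>M\<^esub> y'"])
  also have "((s' \<oplus>\<^bsub>M\<^esub> r \<odot>\<^bsub>M\<^esub> s) \<oplus>\<^bsub>M\<^esub> (r \<otimes> x) \<odot>\<^bsub>M\<^esub> y') \<ominus>\<^bsub>M\<^esub> (r \<otimes> x) \<odot>\<^bsub>M\<^esub> y' = s' \<oplus>\<^bsub>M\<^esub> r \<odot>\<^bsub>M\<^esub> s"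
    using carr sr(2) x(2) by (simp add: M.minus_eq M.a_assoc M.r_neg)
  finally have "?u \<odot>\<^bsub>M\<^esub> y' \<in> S" using submoduleD(4,6)[OF S] sr sy(1) by simp
  then have "inv ?u \<odot>\<^bsub>M\<^esub> (?u \<odot>\<^bsub>M\<^esub> y') \<in> S" using submoduleD(6)[OF S] u by blast
  moreover have "inv ?u \<odot>\<^bsub>M\<^esub> (?u \<odot>\<^bsub>M\<^esub> y') = y'"
    using u carr(3) by (simp flip: smult_assoc1 add: R.Units_closed)
  ultimately show False using sy(2) by (simp add: T_def)
qed

section \<open>Linear maps out of free modules\<close>

lemma module_homsD:
  assumes "h \<in> module_homs R A B"
  shows "\<And>f. f \<in> carrier A \<Longrightarrow> h f \<in> carrier B"
    and "\<And>f g. f \<in> carrier A \<Longrightarrow> g \<in> carrier A \<Longrightarrow> h (f \<oplus>\<^bsub>A\<^esub> g) = h f \<oplus>\<^bsub>B\<^esub> h g"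
    and "\<And>r f. r \<in> carrier R \<Longrightarrow> f \<in> carrier A \<Longrightarrow> h (r \<odot>\<^bsub>A\<^esub> f) = r \<odot>\<^bsub>B\<^esub> h f"
  using assms by (auto simp: module_homs_def)

lemma module_homs_zero:
  assumes "Module.module R A" "Module.module R B" and h: "h \<in> module_homs R A B"
  shows "h \<zero>\<^bsub>A\<^esub> = \<zero>\<^bsub>B\<^esub>"
proof -
  interpret A: Module.module R A by fact
  interpret B: Module.module R B by fact
  have "h (\<zero>\<^bsub>R\<^esub> \<odot>\<^bsub>A\<^esub> \<zero>\<^bsub>A\<^esub>) = \<zero>\<^bsub>R\<^esub> \<odot>\<^bsub>B\<^esub> h \<zero>\<^bsub>A\<^esub>"
    by (rule module_homsD(3)[OF h]) auto
  then show ?thesis using module_homsD(1)[OF h] by simp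
qed

lemma module_homs_minus:
  assumes "Module.module R A" "Module.module R B" and h: "h \<in> module_homs R A B"
    and f: "f \<in> carrier A" "g \<in> carrier A"
  shows "h (f \<ominus>\<^bsub>A\<^esub> g) = h f \<ominus>\<^bsub>B\<^esub> h g"
proof -
  interpret A: Module.module R A by fact
  interpret B: Module.module R B by fact
  have "f \<ominus>\<^bsub>A\<^esub> g = f \<oplus>\<^bsub>A\<^esub> (\<ominus>\<^bsub>R\<^esub> \<one>\<^bsub>R\<^esub>) \<odot>\<^bsub>A\<^esub> g"
    using f by (simp add: A.M.minus_eq A.smult_l_minus)
  then show ?thesis
    using f module_homsD[OF h] by (simp add: B.M.minus_eq B.smult_l_minus)
qed

lemma module_homs_compose:
  assumes "Module.module R A" and f: "f \<in> module_homs R A B" and g: "g \<in> module_homs R B C"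
  shows "compose (carrier A) g f \<in> module_homs R A C"
proof -
  interpret A: Module.module R A by fact
  show ?thesis
    using module_homsD[OF f] module_homsD[OF g]
    by (auto simp: module_homs_def compose_def)
qed

text \<open>One combination serves for differences (x = 1), for sums (x = -1) and for correcting a
  cochain by a multiple of \<open>x\<close>.\<close>

lemma (in Module.module) module_homs_diff_smult:
  assumes "Module.module R A" and f: "f \<in> module_homs R A M" and g: "g \<in> module_homs R A M"
    and x: "x \<in> carrier R"
  shows "(\<lambda>a\<in>carrier A. f a \<ominus>\<^bsub>M\<^esub> x \<odot>\<^bsub>M\<^esub> g a) \<in> module_homs R A M"
proof -
  interpret A: Module.module R A by fact
  note fD = module_homsD[OF f] and gD = module_homsD[OF g]
  have "x \<odot>\<^bsub>M\<^esub> (r \<odot>\<^bsub>M\<^esub> g a) = r \<odot>\<^bsub>M\<^esub> (x \<odot>\<^bsub>M\<^esub> g a)" if "r \<in> carrier R" "a \<in> carrier A" for r a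
    using that x gD(1) by (metis R.m_comm smult_assoc1)
  then show ?thesis
    using fD gD x
    by (auto simp: module_homs_def smult_r_distr smult_r_minus M.minus_eq M.minus_add M.a_ac)
qed

lemma (in abelian_group) diff_zero: "a \<in> carrier G \<Longrightarrow> a \<ominus> \<zero> = a"
  by (metis a_inv_closed l_neg minus_eq r_zero zero_closed)

lemma (in Module.module) module_homs_const_zero:
  assumes "Module.module R A"
  shows "(\<lambda>a\<in>carrier A. \<zero>\<^bsub>M\<^esub>) \<in> module_homs R A M"
proof -
  interpret A: Module.module R A by fact
  show ?thesis by (auto simp: module_homs_def)
qed

text \<open>
  \<open>P\<close> is a total linear relation. This covers the lifting along surjections as well as the
  lifting of maps modulo submodules.
\<close>

lemma (in Module.module) free_module_lift:
  fixes I :: "'i set"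
  assumes total: "\<And>f. f \<in> carrier (free_module R I) \<Longrightarrow> \<exists>a\<in>carrier M. P f a"
    and add: "\<And>f g a b. f \<in> carrier (free_module R I) \<Longrightarrow> g \<in> carrier (free_module R I) \<Longrightarrow>
      a \<in> carrier M \<Longrightarrow> b \<in> carrier M \<Longrightarrow> P f a \<Longrightarrow> P g b \<Longrightarrow>
      P (f \<oplus>\<^bsub>free_module R I\<^esub> g) (a \<oplus>\<^bsub>M\<^esub> b)"
    and smult: "\<And>r f a. r \<in> carrier R \<Longrightarrow> f \<in> carrier (free_module R I) \<Longrightarrow> a \<in> carrier M \<Longrightarrow>
      P f a \<Longrightarrow> P (r \<odot>\<^bsub>free_module R I\<^esub> f) (r \<odot>\<^bsub>M\<^esub> a)"
  shows "\<exists>h\<in>module_homs R (free_module R I) M. \<forall>f\<in>carrier (free_module R I). P f (h f)"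
proof -
  let ?F = "free_module R I"
  interpret F: Module.module R ?F by (intro module_free_module R.is_cring)
  define e where "e i = (\<lambda>j. if j = i then \<one> else \<zero>)" for i :: 'i
  have eF: "e i \<in> carrier ?F" if "i \<in> I" for i
  proof -
    have "{j. e i j \<noteq> \<zero>} \<subseteq> {i}" by (auto simp: e_def)
    then show ?thesis using that by (auto simp: free_module_simps e_def dest: finite_subset)
  qed
  have "\<exists>\<theta>. \<forall>i\<in>I. \<theta> i \<in> carrier M \<and> P (e i) (\<theta> i)"
    using total[OF eF] by (intro bchoice) blast
  then obtain \<theta> where \<theta>: "\<And>i. i \<in> I \<Longrightarrow> \<theta> i \<in> carrier M" "\<And>i. i \<in> I \<Longrightarrow> P (e i) (\<theta> i)"
    by blast
  define h where "h = (\<lambda>f\<in>carrier ?F. \<Oplus>\<^bsub>M\<^esub>i\<in>{i. f i \<noteq> \<zero>}. f i \<odot>\<^bsub>M\<^esub> \<theta> i)"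
  have cF: "f i \<in> carrier R" if "f \<in> carrier ?F" for f i
    using that by (auto simp: free_module_simps)
  have supp: "finite {i. f i \<noteq> \<zero>}" "{i. f i \<noteq> \<zero>} \<subseteq> I" if "f \<in> carrier ?F" for f
    using that by (auto simp: free_module_simps)
  have h_eq: "h f = (\<Oplus>\<^bsub>M\<^esub>i\<in>B. f i \<odot>\<^bsub>M\<^esub> \<theta> i)"
    if f: "f \<in> carrier ?F" and B: "finite B" "{i. f i \<noteq> \<zero>} \<subseteq> B" "B \<subseteq> I" for f B
  proof -
    have "\<theta> i \<in> carrier M" if "i \<in> B" for i using that B(3) \<theta>(1) by blast
    then show ?thesis
      unfolding h_def using f B cF[OF f]
      by (auto intro!: M.add.finprod_mono_neutral_cong_left)
  qed
  have "h \<in> module_homs R ?F M"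
    unfolding module_homs_def
  proof (intro CollectI conjI ballI)
    show "h \<in> carrier ?F \<rightarrow>\<^sub>E carrier M"
      using cF \<theta>(1) supp(2) unfolding h_def by (force intro!: M.finsum_closed smult_closed)
    fix f assume f: "f \<in> carrier ?F"
    {
      fix g assume g: "g \<in> carrier ?F"
      let ?B = "{i. f i \<noteq> \<zero>} \<union> {i. g i \<noteq> \<zero>}"
      have B: "finite ?B" "?B \<subseteq> I" using supp f g by auto
      have fg: "(f \<oplus>\<^bsub>?F\<^esub> g) i = f i \<oplus> g i" for i by (simp add: free_module_simps)
      have "h (f \<oplus>\<^bsub>?F\<^esub> g) = (\<Oplus>\<^bsub>M\<^esub>i\<in>?B. (f \<oplus>\<^bsub>?F\<^esub> g) i \<odot>\<^bsub>M\<^esub> \<theta> i)"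
        using B f g by (intro h_eq F.M.a_closed) (auto simp: fg)
      also have "\<dots> = (\<Oplus>\<^bsub>M\<^esub>i\<in>?B. f i \<odot>\<^bsub>M\<^esub> \<theta> i \<oplus>\<^bsub>M\<^esub> g i \<odot>\<^bsub>M\<^esub> \<theta> i)"
        using cF[OF f] cF[OF g] \<theta>(1) B(2)
        by (intro M.finsum_cong') (auto simp: fg smult_l_distr subset_iff)
      also have "\<dots> = (\<Oplus>\<^bsub>M\<^esub>i\<in>?B. f i \<odot>\<^bsub>M\<^esub> \<theta> i) \<oplus>\<^bsub>M\<^esub> (\<Oplus>\<^bsub>M\<^esub>i\<in>?B. g i \<odot>\<^bsub>M\<^esub> \<theta> i)"
        using cF[OF f] cF[OF g] \<theta>(1) B(2) by (intro M.finsum_addf) (auto simp: subset_iff)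
      also have "\<dots> = h f \<oplus>\<^bsub>M\<^esub> h g"
        using B by (simp only: h_eq[OF f B(1) Un_upper1 B(2)] h_eq[OF g B(1) Un_upper2 B(2)])
      finally show "h (f \<oplus>\<^bsub>?F\<^esub> g) = h f \<oplus>\<^bsub>M\<^esub> h g" .
    next
      fix r assume r: "r \<in> carrier R"
      let ?B = "{i. f i \<noteq> \<zero>}"
      have \<theta>B: "\<theta> i \<in> carrier M" if "i \<in> ?B" for i using that supp(2)[OF f] \<theta>(1) by blast
      have rf: "(r \<odot>\<^bsub>?F\<^esub> f) i = r \<otimes> f i" for i by (simp add: free_module_simps)
      have "h (r \<odot>\<^bsub>?F\<^esub> f) = (\<Oplus>\<^bsub>M\<^esub>i\<in>?B. (r \<odot>\<^bsub>?F\<^esub> f) i \<odot>\<^bsub>M\<^esub> \<theta> i)"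
        using supp[OF f] r f by (intro h_eq F.smult_closed) (auto simp: rf)
      also have "\<dots> = (\<Oplus>\<^bsub>M\<^esub>i\<in>?B. r \<odot>\<^bsub>M\<^esub> (f i \<odot>\<^bsub>M\<^esub> \<theta> i))"
        using r cF[OF f] \<theta>B by (intro M.finsum_cong') (auto simp: rf smult_assoc1)
      also have "\<dots> = r \<odot>\<^bsub>M\<^esub> h f"
        using r f cF[OF f] \<theta>B supp[OF f]
        by (subst h_eq[OF f supp(1)[OF f] subset_refl supp(2)[OF f]])
          (auto intro!: finsum_smult_ldistr[symmetric])
      finally show "h (r \<odot>\<^bsub>?F\<^esub> f) = r \<odot>\<^bsub>M\<^esub> h f" .
    }
  qed
  moreover have "P f (\<Oplus>\<^bsub>M\<^esub>i\<in>B. f i \<odot>\<^bsub>M\<^esub> \<theta> i)"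
    if "finite B" "B \<subseteq> I" "f \<in> carrier ?F" "{i. f i \<noteq> \<zero>} \<subseteq> B" for B f
    using that
  proof (induction B arbitrary: f rule: finite_induct)
    case empty
    \<comment> \<open>That zero is related to zero comes from scaling any related pair by zero;
      \<open>f\<close> has empty support and is itself zero.\<close>
    obtain a where a: "a \<in> carrier M" "P f a" using total[OF empty.prems(2)] by blast
    have "P (\<zero> \<odot>\<^bsub>?F\<^esub> f) (\<zero> \<odot>\<^bsub>M\<^esub> a)" using smult a empty.prems by blast
    moreover have "\<zero> \<odot>\<^bsub>?F\<^esub> f = f"
      using empty.prems by (auto simp: free_module_simps)
    ultimately show ?case using a by simp
  next
    case (insert i B)
    define g where "g = f(i := \<zero>)"
    have f: "f \<in> carrier ?F" and i: "i \<in> I" using insert.prems by auto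
    have "{j. g j \<noteq> \<zero>} \<subseteq> {j. f j \<noteq> \<zero>}" by (auto simp: g_def)
    then have "finite {j. g j \<noteq> \<zero>}" "{j. g j \<noteq> \<zero>} \<subseteq> I"
      using finite_subset[OF _ supp(1)[OF f]] supp(2)[OF f] by blast+
    moreover have "g j \<in> carrier R" for j using cF[OF f] by (simp add: g_def)
    ultimately have g: "g \<in> carrier ?F" by (simp add: free_module_simps)
    have "{j. g j \<noteq> \<zero>} \<subseteq> B" using insert.prems(3) by (auto simp: g_def)
    then have Pg: "P g (\<Oplus>\<^bsub>M\<^esub>i\<in>B. g i \<odot>\<^bsub>M\<^esub> \<theta> i)" using insert g by auto
    have \<theta>B: "\<theta> j \<in> carrier M" if "j \<in> insert i B" for j using that insert.prems(1) \<theta>(1) by blast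
    have gB: "(\<Oplus>\<^bsub>M\<^esub>i\<in>B. g i \<odot>\<^bsub>M\<^esub> \<theta> i) = (\<Oplus>\<^bsub>M\<^esub>i\<in>B. f i \<odot>\<^bsub>M\<^esub> \<theta> i)"
      using insert.hyps \<theta>B cF[OF f] by (intro M.finsum_cong') (auto simp: g_def)
    have sum: "(\<Oplus>\<^bsub>M\<^esub>i\<in>insert i B. f i \<odot>\<^bsub>M\<^esub> \<theta> i) = (\<Oplus>\<^bsub>M\<^esub>i\<in>B. g i \<odot>\<^bsub>M\<^esub> \<theta> i) \<oplus>\<^bsub>M\<^esub> f i \<odot>\<^bsub>M\<^esub> \<theta> i"
      unfolding gB using insert.hyps \<theta>B cF[OF f]
      by (subst M.finsum_insert) (auto intro!: M.a_comm M.finsum_closed)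
    have feq: "f = g \<oplus>\<^bsub>?F\<^esub> f i \<odot>\<^bsub>?F\<^esub> e i"
      using cF[OF f] by (auto simp: free_module_simps g_def e_def)
    have "P (g \<oplus>\<^bsub>?F\<^esub> f i \<odot>\<^bsub>?F\<^esub> e i) ((\<Oplus>\<^bsub>M\<^esub>i\<in>B. g i \<odot>\<^bsub>M\<^esub> \<theta> i) \<oplus>\<^bsub>M\<^esub> f i \<odot>\<^bsub>M\<^esub> \<theta> i)"
    proof (rule add[OF g _ _ _ Pg])
      show "(\<Oplus>\<^bsub>M\<^esub>i\<in>B. g i \<odot>\<^bsub>M\<^esub> \<theta> i) \<in> carrier M"
        using \<theta>B cF[OF g] by (intro M.finsum_closed) auto
    qed (use smult[OF cF[OF f] eF[OF i] \<theta>(1)[OF i] \<theta>(2)[OF i]] eF[OF i] \<theta>(1)[OF i] cF[OF f] in auto)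
    then show ?case unfolding sum feq[symmetric] .
  qed
  then have "P f (h f)" if "f \<in> carrier ?F" for f
    using that supp[OF that] by (simp add: h_def)
  ultimately show ?thesis by blast
qed

section \<open>Cohomology modulo a submodule\<close>

text \<open>
  For a free resolution \<open>F\<close> of \<open>N\<close> and a submodule \<open>S\<close> of \<open>M\<close>, \<open>ext_vanishes_mod R F d M S n\<close>
  means that \<open>Ext\<^sup>n(N, M/S) = 0\<close>: as the modules \<open>F n\<close> are free, maps into \<open>M/S\<close> are represented
  by maps into \<open>M\<close>. In this way no iterated quotients \<open>M/(x\<^sub>1,\<dots>,x\<^sub>r)M\<close>, each of a different type,
  are needed.
\<close>

primrec coboundary_mod ::
    "('a, 'r) ring_scheme \<Rightarrow> (nat \<Rightarrow> ('a, 'b, 'x) module_scheme) \<Rightarrow> (nat \<Rightarrow> 'b \<Rightarrow> 'b)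
      \<Rightarrow> ('a, 'c, 'y) module_scheme \<Rightarrow> 'c set \<Rightarrow> nat \<Rightarrow> ('b \<Rightarrow> 'c) \<Rightarrow> bool"
  where
    "coboundary_mod R F d M S 0 \<phi> \<longleftrightarrow> (\<forall>f\<in>carrier (F 0). \<phi> f \<in> S)"
  | "coboundary_mod R F d M S (Suc n) \<phi> \<longleftrightarrow>
      (\<exists>\<psi>\<in>module_homs R (F n) M. \<forall>f\<in>carrier (F (Suc n)). \<phi> f \<ominus>\<^bsub>M\<^esub> \<psi> (d n f) \<in> S)"

definition ext_vanishes_mod ::
    "('a, 'r) ring_scheme \<Rightarrow> (nat \<Rightarrow> ('a, 'b, 'x) module_scheme) \<Rightarrow> (nat \<Rightarrow> 'b \<Rightarrow> 'b)
      \<Rightarrow> ('a, 'c, 'y) module_scheme \<Rightarrow> 'c set \<Rightarrow> nat \<Rightarrow> bool"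
  where "ext_vanishes_mod R F d M S n \<longleftrightarrow>
    (\<forall>\<phi>\<in>module_homs R (F n) M. (\<forall>f\<in>carrier (F (Suc n)). \<phi> (d n f) \<in> S) \<longrightarrow>
      coboundary_mod R F d M S n \<phi>)"

text \<open>No augmentation is recorded and exactness is required in positive degrees only, so the
  complex resolves the cokernel of \<open>d 0\<close> without naming it. Properties of the resolved
  module are stated through \<open>F 0\<close> and \<open>d 0\<close> in the lemmas that use
  them.\<close>

locale acyclic_free_complex = Module.module R M for R (structure) and M (structure) +
  fixes F :: "nat \<Rightarrow> ('a, 'i \<Rightarrow> 'a) module" and I :: "nat \<Rightarrow> 'i set" and d :: "nat \<Rightarrow> ('i \<Rightarrow> 'a) \<Rightarrow> 'i \<Rightarrow> 'a"
  assumes F_free: "F n = free_module R (I n)"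
    and d_hom: "d n \<in> module_homs R (F (Suc n)) (F n)"
    and d_d: "f \<in> carrier (F (Suc (Suc n))) \<Longrightarrow> d n (d (Suc n) f) = \<zero>\<^bsub>F n\<^esub>"
    and exact: "f \<in> carrier (F (Suc n)) \<Longrightarrow> d n f = \<zero>\<^bsub>F n\<^esub> \<Longrightarrow>
      \<exists>g\<in>carrier (F (Suc (Suc n))). d (Suc n) g = f"
begin

lemma module_F: "Module.module R (F n)"
  unfolding F_free by (intro module_free_module R.is_cring)

lemmas d_closed = module_homsD(1)[OF d_hom]

text \<open>The relation \<open>\<phi> f - x a \<in> S\<close> between \<open>f\<close> and
  \<open>a\<close> is linear, and total by hypothesis; freeness turns this pointwise division by
  \<open>x\<close> into a linear map.\<close>

lemma lift_add_scaled:
  assumes S: "submodule S R M" and x: "x \<in> carrier R" and \<phi>: "\<phi> \<in> module_homs R (F n) M"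
    and mem: "\<And>f. f \<in> carrier (F n) \<Longrightarrow> \<phi> f \<in> add_scaled M S x"
  shows "\<exists>\<theta>\<in>module_homs R (F n) M. \<forall>f\<in>carrier (F n). \<phi> f \<ominus>\<^bsub>M\<^esub> x \<odot>\<^bsub>M\<^esub> \<theta> f \<in> S"
  unfolding F_free
proof (rule free_module_lift, unfold F_free[symmetric])
  note \<phi>D = module_homsD[OF \<phi>] and SD = submoduleD[OF S]
  fix f assume f: "f \<in> carrier (F n)"
  obtain s y where sy: "s \<in> S" "y \<in> carrier M" "\<phi> f = s \<oplus>\<^bsub>M\<^esub> x \<odot>\<^bsub>M\<^esub> y"
    using mem[OF f] by (auto simp: add_scaled_def)
  then have "\<phi> f \<ominus>\<^bsub>M\<^esub> x \<odot>\<^bsub>M\<^esub> y = s" using SD(1) x by (simp add: M.minus_eq M.a_assoc M.r_neg)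
  then show "\<exists>y\<in>carrier M. \<phi> f \<ominus>\<^bsub>M\<^esub> x \<odot>\<^bsub>M\<^esub> y \<in> S" using sy(1,2) by (intro bexI[of _ y]) simp_all
next
  note \<phi>D = module_homsD[OF \<phi>] and SD = submoduleD[OF S]
  fix f g a b
  assume fg: "f \<in> carrier (F n)" "g \<in> carrier (F n)" and ab: "a \<in> carrier M" "b \<in> carrier M"
    and in_S: "\<phi> f \<ominus>\<^bsub>M\<^esub> x \<odot>\<^bsub>M\<^esub> a \<in> S" "\<phi> g \<ominus>\<^bsub>M\<^esub> x \<odot>\<^bsub>M\<^esub> b \<in> S"
  have "\<phi> (f \<oplus>\<^bsub>F n\<^esub> g) \<ominus>\<^bsub>M\<^esub> x \<odot>\<^bsub>M\<^esub> (a \<oplus>\<^bsub>M\<^esub> b) =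
      (\<phi> f \<ominus>\<^bsub>M\<^esub> x \<odot>\<^bsub>M\<^esub> a) \<oplus>\<^bsub>M\<^esub> (\<phi> g \<ominus>\<^bsub>M\<^esub> x \<odot>\<^bsub>M\<^esub> b)"
    using fg ab x \<phi>D by (simp add: smult_r_distr M.minus_eq M.minus_add M.a_ac)
  then show "\<phi> (f \<oplus>\<^bsub>F n\<^esub> g) \<ominus>\<^bsub>M\<^esub> x \<odot>\<^bsub>M\<^esub> (a \<oplus>\<^bsub>M\<^esub> b) \<in> S" using in_S SD(4) by simp
next
  note \<phi>D = module_homsD[OF \<phi>] and SD = submoduleD[OF S]
  fix r f a assume r: "r \<in> carrier R" and f: "f \<in> carrier (F n)" and a: "a \<in> carrier M"
    and in_S: "\<phi> f \<ominus>\<^bsub>M\<^esub> x \<odot>\<^bsub>M\<^esub> a \<in> S"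
  have "x \<odot>\<^bsub>M\<^esub> (r \<odot>\<^bsub>M\<^esub> a) = r \<odot>\<^bsub>M\<^esub> (x \<odot>\<^bsub>M\<^esub> a)" using r x a by (metis R.m_comm smult_assoc1)
  then have "\<phi> (r \<odot>\<^bsub>F n\<^esub> f) \<ominus>\<^bsub>M\<^esub> x \<odot>\<^bsub>M\<^esub> (r \<odot>\<^bsub>M\<^esub> a) = r \<odot>\<^bsub>M\<^esub> (\<phi> f \<ominus>\<^bsub>M\<^esub> x \<odot>\<^bsub>M\<^esub> a)"
    using f a x r \<phi>D by (simp add: smult_r_distr smult_r_minus M.minus_eq)
  then show "\<phi> (r \<odot>\<^bsub>F n\<^esub> f) \<ominus>\<^bsub>M\<^esub> x \<odot>\<^bsub>M\<^esub> (r \<odot>\<^bsub>M\<^esub> a) \<in> S" using in_S r SD(6) by simp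
qed

lemma minus_trans_mem:
  assumes S: "submodule S R M" and "a \<in> carrier M" "b \<in> carrier M" "c \<in> carrier M"
    and "a \<ominus>\<^bsub>M\<^esub> b \<in> S" "b \<ominus>\<^bsub>M\<^esub> c \<in> S"
  shows "a \<ominus>\<^bsub>M\<^esub> c \<in> S"
proof -
  have "a \<ominus>\<^bsub>M\<^esub> c = (a \<ominus>\<^bsub>M\<^esub> b) \<oplus>\<^bsub>M\<^esub> (b \<ominus>\<^bsub>M\<^esub> c)"
    using assms(2-4) by (simp add: M.minus_eq M.a_assoc M.r_neg1)
  then show ?thesis using submoduleD(4)[OF S] assms(5,6) by simp
qed

text \<open>Exactness of Ext^n(M/S) -> Ext^n(M/(S + xM)) -> Ext^(n+1)(M/S), part of the long exact
  sequence for multiplication by \<open>x\<close> on M/S, carried out on cochains.\<close>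

lemma ext_vanishes_mod_add_scaled:
  assumes S: "submodule S R M" and x: "x \<in> carrier R" and reg: "regular_mod M S x"
    and van: "ext_vanishes_mod R F d M S n" "ext_vanishes_mod R F d M S (Suc n)"
  shows "ext_vanishes_mod R F d M (add_scaled M S x) n"
  unfolding ext_vanishes_mod_def
proof (intro ballI impI)
  note SD = submoduleD[OF S] and Sx = submodule_add_scaled[OF S x]
  fix \<phi> assume \<phi>: "\<phi> \<in> module_homs R (F n) M"
    and cocycle: "\<forall>f\<in>carrier (F (Suc n)). \<phi> (d n f) \<in> add_scaled M S x"
  note \<phi>D = module_homsD[OF \<phi>]
  have \<phi>d: "compose (carrier (F (Suc n))) \<phi> (d n) \<in> module_homs R (F (Suc n)) M"
    by (rule module_homs_compose[OF module_F d_hom \<phi>])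
  \<comment> \<open>\<open>\<theta>\<close> represents the image of \<open>\<phi>\<close> under the
    connecting map: \<open>\<phi> d\<close> equals \<open>x \<theta>\<close> modulo
    \<open>S\<close>.\<close>
  obtain \<theta> where \<theta>: "\<theta> \<in> module_homs R (F (Suc n)) M"
    and \<theta>S: "\<forall>f\<in>carrier (F (Suc n)). compose (carrier (F (Suc n))) \<phi> (d n) f \<ominus>\<^bsub>M\<^esub> x \<odot>\<^bsub>M\<^esub> \<theta> f \<in> S"
    using lift_add_scaled[OF S x \<phi>d] cocycle by (auto simp: compose_def)
  note \<theta>D = module_homsD[OF \<theta>]
  have "\<theta> (d (Suc n) f) \<in> S" if f: "f \<in> carrier (F (Suc (Suc n)))" for f
  proof -
    have df: "d (Suc n) f \<in> carrier (F (Suc n))" using d_closed f by blast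
    have "\<phi> (d n (d (Suc n) f)) = \<zero>\<^bsub>M\<^esub>"
      unfolding d_d[OF f] by (rule module_homs_zero[OF module_F module_axioms \<phi>])
    then have "\<zero>\<^bsub>M\<^esub> \<ominus>\<^bsub>M\<^esub> x \<odot>\<^bsub>M\<^esub> \<theta> (d (Suc n) f) \<in> S"
      using bspec[OF \<theta>S df] df by (simp add: compose_def)
    then have "\<ominus>\<^bsub>M\<^esub> (\<zero>\<^bsub>M\<^esub> \<ominus>\<^bsub>M\<^esub> x \<odot>\<^bsub>M\<^esub> \<theta> (d (Suc n) f)) \<in> S" by (rule SD(3))
    then have "x \<odot>\<^bsub>M\<^esub> \<theta> (d (Suc n) f) \<in> S" using \<theta>D(1)[OF df] x by (simp add: M.minus_eq)
    then show ?thesis using reg \<theta>D(1)[OF df] by (simp add: regular_mod_def)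
  qed
  then obtain \<psi> where \<psi>: "\<psi> \<in> module_homs R (F n) M"
    and \<psi>S: "\<forall>f\<in>carrier (F (Suc n)). \<theta> f \<ominus>\<^bsub>M\<^esub> \<psi> (d n f) \<in> S"
    using van(2) \<theta> by (auto simp: ext_vanishes_mod_def)
  note \<psi>D = module_homsD[OF \<psi>]
  \<comment> \<open>As \<open>\<theta>\<close> agrees with \<open>\<psi> d\<close> modulo
    \<open>S\<close>, subtracting \<open>x \<psi>\<close> turns \<open>\<phi>\<close> into a cocycle
    modulo \<open>S\<close> without changing it modulo S + xM.\<close>
  define \<phi>' where "\<phi>' = (\<lambda>f\<in>carrier (F n). \<phi> f \<ominus>\<^bsub>M\<^esub> x \<odot>\<^bsub>M\<^esub> \<psi> f)"
  have \<phi>': "\<phi>' \<in> module_homs R (F n) M"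
    unfolding \<phi>'_def by (rule module_homs_diff_smult[OF module_F \<phi> \<psi> x])
  have "\<phi>' (d n f) \<in> S" if f: "f \<in> carrier (F (Suc n))" for f
  proof -
    have df: "d n f \<in> carrier (F n)" using d_closed f by blast
    have "x \<odot>\<^bsub>M\<^esub> (\<theta> f \<ominus>\<^bsub>M\<^esub> \<psi> (d n f)) \<in> S" using \<psi>S f x SD(6) by blast
    then have mem2: "x \<odot>\<^bsub>M\<^esub> \<theta> f \<ominus>\<^bsub>M\<^esub> x \<odot>\<^bsub>M\<^esub> \<psi> (d n f) \<in> S"
      using \<theta>D(1)[OF f] \<psi>D(1)[OF df] x by (simp add: M.minus_eq smult_r_distr smult_r_minus)
    have mem1: "\<phi> (d n f) \<ominus>\<^bsub>M\<^esub> x \<odot>\<^bsub>M\<^esub> \<theta> f \<in> S" using bspec[OF \<theta>S f] f by (simp add: compose_def)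
    have "\<phi> (d n f) \<ominus>\<^bsub>M\<^esub> x \<odot>\<^bsub>M\<^esub> \<psi> (d n f) \<in> S"
      by (rule minus_trans_mem[OF S _ _ _ mem1 mem2])
        (use \<phi>D(1)[OF df] \<theta>D(1)[OF f] \<psi>D(1)[OF df] x in auto)
    then show ?thesis using df by (simp add: \<phi>'_def)
  qed
  then have cob: "coboundary_mod R F d M S n \<phi>'" using van(1) \<phi>' by (auto simp: ext_vanishes_mod_def)
  have absorb: "\<phi> f \<ominus>\<^bsub>M\<^esub> c \<in> add_scaled M S x"
    if "\<phi>' f \<ominus>\<^bsub>M\<^esub> c \<in> S" "f \<in> carrier (F n)" "c \<in> carrier M" for f c
  proof -
    have "\<phi> f \<ominus>\<^bsub>M\<^esub> c = (\<phi>' f \<ominus>\<^bsub>M\<^esub> c) \<oplus>\<^bsub>M\<^esub> x \<odot>\<^bsub>M\<^esub> \<psi> f"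
      using that \<phi>D(1) \<psi>D(1) x by (simp add: \<phi>'_def M.minus_eq M.a_ac M.r_neg)
    then show ?thesis unfolding add_scaled_def using that \<psi>D(1) by blast
  qed
  show "coboundary_mod R F d M (add_scaled M S x) n \<phi>"
  proof (cases n)
    case 0
    have "\<phi> f \<in> add_scaled M S x" if "f \<in> carrier (F 0)" for f
      using absorb[of f "\<zero>\<^bsub>M\<^esub>"] cob that \<phi>D(1) module_homsD(1)[OF \<phi>'] unfolding 0
      by (simp add: M.diff_zero)
    then show ?thesis unfolding 0 by simp
  next
    case (Suc m)
    then obtain \<chi> where \<chi>: "\<chi> \<in> module_homs R (F m) M"
      and \<chi>S: "\<forall>f\<in>carrier (F (Suc m)). \<phi>' f \<ominus>\<^bsub>M\<^esub> \<chi> (d m f) \<in> S"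
      using cob by auto
    have "\<phi> f \<ominus>\<^bsub>M\<^esub> \<chi> (d m f) \<in> add_scaled M S x" if "f \<in> carrier (F (Suc m))" for f
      using absorb[of f "\<chi> (d m f)"] \<chi>S that module_homsD(1)[OF \<chi>] d_closed Suc by simp
    then show ?thesis using \<chi> by (auto simp: Suc)
  qed
qed

text \<open>Treats degree 0 and positive degrees alike. That \<open>b\<close> vanishes on boundaries
  exactly, not just modulo \<open>S\<close>, matters in the application: the coboundary there is
  taken modulo S + xM, but congruences modulo \<open>S\<close> are to be kept.\<close>

lemma coboundary_modE:
  assumes cob: "coboundary_mod R F d M S n \<phi>" and \<phi>: "\<phi> \<in> module_homs R (F n) M"
  obtains b where "b \<in> module_homs R (F n) M" "\<And>f. f \<in> carrier (F (Suc n)) \<Longrightarrow> b (d n f) = \<zero>\<^bsub>M\<^esub>"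
    "\<And>f. f \<in> carrier (F n) \<Longrightarrow> \<phi> f \<ominus>\<^bsub>M\<^esub> b f \<in> S"
proof (cases n)
  case 0
  show thesis
  proof (rule that)
    show "(\<lambda>f\<in>carrier (F n). \<zero>\<^bsub>M\<^esub>) \<in> module_homs R (F n) M"
      by (rule module_homs_const_zero[OF module_F])
  qed (use cob module_homsD(1)[OF \<phi>] d_closed 0 in \<open>auto simp: M.diff_zero\<close>)
next
  case (Suc m)
  then obtain \<chi> where \<chi>: "\<chi> \<in> module_homs R (F m) M"
    and \<chi>S: "\<forall>f\<in>carrier (F (Suc m)). \<phi> f \<ominus>\<^bsub>M\<^esub> \<chi> (d m f) \<in> S"
    using cob by auto
  show thesis
  proof (rule that)
    show "compose (carrier (F n)) \<chi> (d m) \<in> module_homs R (F n) M"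
      unfolding Suc by (rule module_homs_compose[OF module_F d_hom \<chi>])
    show "compose (carrier (F n)) \<chi> (d m) (d n f) = \<zero>\<^bsub>M\<^esub>" if "f \<in> carrier (F (Suc n))" for f
      using that d_closed[of f n] d_d[of f m] module_homs_zero[OF module_F module_axioms \<chi>]
      by (simp add: compose_def Suc)
  qed (use \<chi>S in \<open>auto simp: compose_def Suc\<close>)
qed

text \<open>The maps \<open>h\<close> form a null-homotopy of the multiplication by \<open>x\<close>.\<close>

lemma smult_homotopy:
  assumes x: "x \<in> carrier R"
    and x0: "\<And>f. f \<in> carrier (F 0) \<Longrightarrow> \<exists>g\<in>carrier (F (Suc 0)). d 0 g = x \<odot>\<^bsub>F 0\<^esub> f"
  shows "\<exists>h\<in>module_homs R (F n) (F (Suc n)). \<forall>f\<in>carrier (F (Suc n)).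
    \<exists>g\<in>carrier (F (Suc (Suc n))). x \<odot>\<^bsub>F (Suc n)\<^esub> f \<ominus>\<^bsub>F (Suc n)\<^esub> h (d n f) = d (Suc n) g"
proof (induction n)
  case 0
  interpret F0: Module.module R "F 0" by (rule module_F)
  interpret F1: Module.module R "F (Suc 0)" by (rule module_F)
  note dD = module_homsD[OF d_hom[of 0]]
  \<comment> \<open>By hypothesis multiplication by \<open>x\<close> on \<open>F 0\<close> has
    values in the image of \<open>d 0\<close>; freeness gives a linear lift.\<close>
  have "\<exists>h\<in>module_homs R (F 0) (F (Suc 0)). \<forall>f\<in>carrier (F 0). d 0 (h f) = x \<odot>\<^bsub>F 0\<^esub> f"
    unfolding F_free[of 0]
  proof (rule F1.free_module_lift, unfold F_free[of 0, symmetric])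
    fix r f a assume *: "r \<in> carrier R" "f \<in> carrier (F 0)" "a \<in> carrier (F (Suc 0))" "d 0 a = x \<odot>\<^bsub>F 0\<^esub> f"
    then show "d 0 (r \<odot>\<^bsub>F (Suc 0)\<^esub> a) = x \<odot>\<^bsub>F 0\<^esub> (r \<odot>\<^bsub>F 0\<^esub> f)"
      using x dD by (simp flip: F0.smult_assoc1 add: R.m_comm)
  qed (use x x0 dD in \<open>auto simp: F0.smult_r_distr\<close>)
  then obtain h where h: "h \<in> module_homs R (F 0) (F (Suc 0))" "\<And>f. f \<in> carrier (F 0) \<Longrightarrow> d 0 (h f) = x \<odot>\<^bsub>F 0\<^esub> f"
    by blast
  have "\<exists>g\<in>carrier (F (Suc (Suc 0))). x \<odot>\<^bsub>F (Suc 0)\<^esub> f \<ominus>\<^bsub>F (Suc 0)\<^esub> h (d 0 f) = d (Suc 0) g" if f: "f \<in> carrier (F (Suc 0))" for f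
  proof -
    have df: "d 0 f \<in> carrier (F 0)" and hdf: "h (d 0 f) \<in> carrier (F (Suc 0))"
      using dD(1) f module_homsD(1)[OF h(1)] by auto
    have "d 0 (x \<odot>\<^bsub>F (Suc 0)\<^esub> f \<ominus>\<^bsub>F (Suc 0)\<^esub> h (d 0 f)) = d 0 (x \<odot>\<^bsub>F (Suc 0)\<^esub> f) \<ominus>\<^bsub>F 0\<^esub> d 0 (h (d 0 f))"
      using x f hdf by (intro module_homs_minus[OF module_F module_F d_hom[of 0]]) auto
    also have "\<dots> = \<zero>\<^bsub>F 0\<^esub>" using dD(3)[OF x f] h(2)[OF df] df x by (simp add: F0.M.minus_eq F0.M.r_neg)
    finally show ?thesis using exact[of _ 0] x f hdf by (metis F1.M.minus_closed F1.smult_closed)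
  qed
  then show ?case using h(1) by auto
next
  case (Suc n)
  interpret F1: Module.module R "F (Suc n)" by (rule module_F)
  interpret F2: Module.module R "F (Suc (Suc n))" by (rule module_F)
  note dD = module_homsD[OF d_hom]
  obtain h where h: "h \<in> module_homs R (F n) (F (Suc n))"
    and hx: "\<And>f. f \<in> carrier (F (Suc n)) \<Longrightarrow>
      \<exists>g\<in>carrier (F (Suc (Suc n))). x \<odot>\<^bsub>F (Suc n)\<^esub> f \<ominus>\<^bsub>F (Suc n)\<^esub> h (d n f) = d (Suc n) g"
    using Suc by blast
  note hD = module_homsD[OF h]
  \<comment> \<open>The induction hypothesis says that x - hd takes values in boundaries, so
    freeness yields \<open>k\<close> with dk = x - hd. In the next degree d(xf - kdf) = xdf - (xdf -
    hddf) = 0, and exactness applies.\<close>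
  have "\<exists>k\<in>module_homs R (F (Suc n)) (F (Suc (Suc n))). \<forall>f\<in>carrier (F (Suc n)).
    x \<odot>\<^bsub>F (Suc n)\<^esub> f \<ominus>\<^bsub>F (Suc n)\<^esub> h (d n f) = d (Suc n) (k f)"
    unfolding F_free[of "Suc n"]
  proof (rule F2.free_module_lift, unfold F_free[of "Suc n", symmetric])
    show "\<exists>g\<in>carrier (F (Suc (Suc n))). x \<odot>\<^bsub>F (Suc n)\<^esub> f \<ominus>\<^bsub>F (Suc n)\<^esub> h (d n f) = d (Suc n) g"
      if "f \<in> carrier (F (Suc n))" for f using hx that .
  next
    fix f g a b
    assume "f \<in> carrier (F (Suc n))" "g \<in> carrier (F (Suc n))"
      "a \<in> carrier (F (Suc (Suc n)))" "b \<in> carrier (F (Suc (Suc n)))"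
      "x \<odot>\<^bsub>F (Suc n)\<^esub> f \<ominus>\<^bsub>F (Suc n)\<^esub> h (d n f) = d (Suc n) a"
      "x \<odot>\<^bsub>F (Suc n)\<^esub> g \<ominus>\<^bsub>F (Suc n)\<^esub> h (d n g) = d (Suc n) b"
    then show "x \<odot>\<^bsub>F (Suc n)\<^esub> (f \<oplus>\<^bsub>F (Suc n)\<^esub> g) \<ominus>\<^bsub>F (Suc n)\<^esub> h (d n (f \<oplus>\<^bsub>F (Suc n)\<^esub> g)) =
        d (Suc n) (a \<oplus>\<^bsub>F (Suc (Suc n))\<^esub> b)"
      using x dD hD
      by (simp add: F1.smult_r_distr F1.M.minus_eq F1.M.minus_add F1.M.a_ac flip: \<open>_ = d (Suc n) a\<close> \<open>_ = d (Suc n) b\<close>)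
  next
    fix r f a
    assume *: "r \<in> carrier R" "f \<in> carrier (F (Suc n))" "a \<in> carrier (F (Suc (Suc n)))"
      "x \<odot>\<^bsub>F (Suc n)\<^esub> f \<ominus>\<^bsub>F (Suc n)\<^esub> h (d n f) = d (Suc n) a"
    have "x \<odot>\<^bsub>F (Suc n)\<^esub> (r \<odot>\<^bsub>F (Suc n)\<^esub> f) = r \<odot>\<^bsub>F (Suc n)\<^esub> (x \<odot>\<^bsub>F (Suc n)\<^esub> f)"
      using * x by (metis R.m_comm F1.smult_assoc1)
    then show "x \<odot>\<^bsub>F (Suc n)\<^esub> (r \<odot>\<^bsub>F (Suc n)\<^esub> f) \<ominus>\<^bsub>F (Suc n)\<^esub> h (d n (r \<odot>\<^bsub>F (Suc n)\<^esub> f)) =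
        d (Suc n) (r \<odot>\<^bsub>F (Suc (Suc n))\<^esub> a)"
      using x dD hD *(1-3)
      by (simp add: F1.smult_r_distr F1.smult_r_minus F1.M.minus_eq flip: *(4))
  qed
  then obtain k where k: "k \<in> module_homs R (F (Suc n)) (F (Suc (Suc n)))"
    and kx: "\<And>f. f \<in> carrier (F (Suc n)) \<Longrightarrow>
      x \<odot>\<^bsub>F (Suc n)\<^esub> f \<ominus>\<^bsub>F (Suc n)\<^esub> h (d n f) = d (Suc n) (k f)"
    by blast
  have "\<exists>g\<in>carrier (F (Suc (Suc (Suc n)))).
      x \<odot>\<^bsub>F (Suc (Suc n))\<^esub> f \<ominus>\<^bsub>F (Suc (Suc n))\<^esub> k (d (Suc n) f) = d (Suc (Suc n)) g"
    if f: "f \<in> carrier (F (Suc (Suc n)))" for f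
  proof -
    let ?df = "d (Suc n) f"
    have df: "?df \<in> carrier (F (Suc n))" and kdf: "k ?df \<in> carrier (F (Suc (Suc n)))"
      using dD(1) f module_homsD(1)[OF k] by auto
    have "d (Suc n) (k ?df) = x \<odot>\<^bsub>F (Suc n)\<^esub> ?df"
      using kx[OF df] d_d[OF f] module_homs_zero[OF module_F module_F h] df x
      by (simp add: F1.M.diff_zero)
    moreover have "d (Suc n) (x \<odot>\<^bsub>F (Suc (Suc n))\<^esub> f \<ominus>\<^bsub>F (Suc (Suc n))\<^esub> k ?df) =
        d (Suc n) (x \<odot>\<^bsub>F (Suc (Suc n))\<^esub> f) \<ominus>\<^bsub>F (Suc n)\<^esub> d (Suc n) (k ?df)"
      using module_homs_minus[OF module_F module_F d_hom] x f kdf by simp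
    ultimately have "d (Suc n) (x \<odot>\<^bsub>F (Suc (Suc n))\<^esub> f \<ominus>\<^bsub>F (Suc (Suc n))\<^esub> k ?df) = \<zero>\<^bsub>F (Suc n)\<^esub>"
      using dD(3)[OF x f] df x by (simp add: F1.M.minus_eq F1.M.r_neg)
    then show ?thesis
      using exact[of _ "Suc n"] x f kdf by (metis F2.M.minus_closed F2.smult_closed)
  qed
  then show ?case using k by blast
qed

text \<open>\<open>x0\<close> says that \<open>x\<close> kills the cokernel of \<open>d 0\<close>,
  so multiplication by \<open>x\<close> is null-homotopic and zero on cohomology. Hence the
  connecting map from degree n - 1 for M/(S + xM) is onto degree n for M/S. In degree 0,
  \<open>x \<phi>\<close> has values in \<open>S\<close> and \<open>x\<close> cancels.\<close>

lemma ext_vanishes_mod_lift: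
  assumes S: "submodule S R M" and x: "x \<in> carrier R" and reg: "regular_mod M S x"
    and x0: "\<And>f. f \<in> carrier (F 0) \<Longrightarrow> \<exists>g\<in>carrier (F (Suc 0)). d 0 g = x \<odot>\<^bsub>F 0\<^esub> f"
    and van: "\<And>m. n = Suc m \<Longrightarrow> ext_vanishes_mod R F d M (add_scaled M S x) m"
  shows "ext_vanishes_mod R F d M S n"
  unfolding ext_vanishes_mod_def
proof (intro ballI impI)
  note SD = submoduleD[OF S]
  fix \<phi> assume \<phi>: "\<phi> \<in> module_homs R (F n) M"
    and cocycle: "\<forall>f\<in>carrier (F (Suc n)). \<phi> (d n f) \<in> S"
  note \<phi>D = module_homsD[OF \<phi>]
  show "coboundary_mod R F d M S n \<phi>"
  proof (cases n)
    case 0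
    have "\<phi> f \<in> S" if f: "f \<in> carrier (F 0)" for f
    proof -
      obtain g where "g \<in> carrier (F (Suc 0))" "d 0 g = x \<odot>\<^bsub>F 0\<^esub> f" using x0 f by blast
      then have "\<phi> (x \<odot>\<^bsub>F 0\<^esub> f) \<in> S" using cocycle 0 by force
      then show ?thesis using reg \<phi>D f x by (auto simp: regular_mod_def 0)
    qed
    then show ?thesis unfolding 0 by simp
  next
    case (Suc m)
    interpret Fn: Module.module R "F n" by (rule module_F)
    obtain h where h: "h \<in> module_homs R (F m) (F n)"
      and hx: "\<And>f. f \<in> carrier (F n) \<Longrightarrow> \<exists>g\<in>carrier (F (Suc n)). x \<odot>\<^bsub>F n\<^esub> f \<ominus>\<^bsub>F n\<^esub> h (d m f) = d n g"
      using smult_homotopy[OF x x0, of m] Suc by blast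
    \<comment> \<open>A preimage of \<open>\<phi>\<close> under the connecting map:
      \<open>\<psi> d\<close> agrees with \<open>x \<phi>\<close> modulo \<open>S\<close>, since x -
      hd takes values in boundaries and \<open>\<phi>\<close> sends these into
      \<open>S\<close>.\<close>
    define \<psi> where "\<psi> = compose (carrier (F m)) \<phi> h"
    have \<psi>: "\<psi> \<in> module_homs R (F m) M"
      unfolding \<psi>_def by (rule module_homs_compose[OF module_F h \<phi>])
    have dm: "d m f \<in> carrier (F m)" if "f \<in> carrier (F n)" for f
      using d_closed[of f m] that Suc by simp
    have \<psi>d: "x \<odot>\<^bsub>M\<^esub> \<phi> f \<ominus>\<^bsub>M\<^esub> \<psi> (d m f) \<in> S" if f: "f \<in> carrier (F n)" for f
    proof -
      obtain g where g: "g \<in> carrier (F (Suc n))" "x \<odot>\<^bsub>F n\<^esub> f \<ominus>\<^bsub>F n\<^esub> h (d m f) = d n g"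
        using hx[OF f] by blast
      have "\<phi> (x \<odot>\<^bsub>F n\<^esub> f \<ominus>\<^bsub>F n\<^esub> h (d m f)) = \<phi> (x \<odot>\<^bsub>F n\<^esub> f) \<ominus>\<^bsub>M\<^esub> \<phi> (h (d m f))"
        using f x module_homsD(1)[OF h dm[OF f]]
        by (intro module_homs_minus[OF module_F module_axioms \<phi>]) auto
      moreover have "\<phi> (x \<odot>\<^bsub>F n\<^esub> f \<ominus>\<^bsub>F n\<^esub> h (d m f)) \<in> S" using cocycle g by simp
      ultimately show ?thesis using \<phi>D(3)[OF x f] dm[OF f] by (simp add: \<psi>_def compose_def)
    qed
    have "\<psi> (d m f) \<in> add_scaled M S x" if f: "f \<in> carrier (F n)" for f
    proof -
      let ?s = "x \<odot>\<^bsub>M\<^esub> \<phi> f \<ominus>\<^bsub>M\<^esub> \<psi> (d m f)"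
      have "\<psi> (d m f) = \<ominus>\<^bsub>M\<^esub> ?s \<oplus>\<^bsub>M\<^esub> x \<odot>\<^bsub>M\<^esub> \<phi> f"
        using \<phi>D(1)[OF f] module_homsD(1)[OF \<psi> dm[OF f]] x
        by (simp add: M.minus_eq M.minus_add M.a_ac M.r_neg1 M.r_neg2 M.r_neg)
      then show ?thesis unfolding add_scaled_def using SD(3)[OF \<psi>d[OF f]] \<phi>D(1)[OF f] by blast
    qed
    then have "coboundary_mod R F d M (add_scaled M S x) m \<psi>"
      using van[OF Suc] \<psi> Suc by (simp add: ext_vanishes_mod_def)
    then obtain b where b: "b \<in> module_homs R (F m) M"
      and bd: "\<And>f. f \<in> carrier (F (Suc m)) \<Longrightarrow> b (d m f) = \<zero>\<^bsub>M\<^esub>"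
      and bS: "\<And>f. f \<in> carrier (F m) \<Longrightarrow> \<psi> f \<ominus>\<^bsub>M\<^esub> b f \<in> add_scaled M S x"
      using \<psi> by (rule coboundary_modE) blast
    \<comment> \<open>\<open>b\<close> vanishes on boundaries, so
      \<open>\<omega> d = \<psi> d\<close>, while \<open>\<omega>\<close> has values in S + xM and
      can be divided by \<open>x\<close>. Then \<open>x \<phi>\<close> agrees with
      \<open>x \<theta> d\<close> modulo \<open>S\<close>, and \<open>x\<close> cancels.\<close>
    define \<omega> where "\<omega> = (\<lambda>f\<in>carrier (F m). \<psi> f \<ominus>\<^bsub>M\<^esub> \<one> \<odot>\<^bsub>M\<^esub> b f)"
    have "\<omega> \<in> module_homs R (F m) M"
      unfolding \<omega>_def by (rule module_homs_diff_smult[OF module_F \<psi> b R.one_closed])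
    moreover have "\<omega> f \<in> add_scaled M S x" if "f \<in> carrier (F m)" for f
      using bS that module_homsD(1)[OF b that] by (simp add: \<omega>_def)
    ultimately obtain \<theta> where \<theta>: "\<theta> \<in> module_homs R (F m) M"
      and \<theta>S: "\<forall>f\<in>carrier (F m). \<omega> f \<ominus>\<^bsub>M\<^esub> x \<odot>\<^bsub>M\<^esub> \<theta> f \<in> S"
      using lift_add_scaled[OF S x] by blast
    have "\<phi> f \<ominus>\<^bsub>M\<^esub> \<theta> (d m f) \<in> S" if f: "f \<in> carrier (F (Suc m))" for f
    proof -
      have fn: "f \<in> carrier (F n)" using f Suc by simp
      note carr = \<phi>D(1)[OF fn] module_homsD(1)[OF \<psi> dm[OF fn]] module_homsD(1)[OF \<theta> dm[OF fn]]
      have "\<psi> (d m f) \<ominus>\<^bsub>M\<^esub> x \<odot>\<^bsub>M\<^esub> \<theta> (d m f) \<in> S"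
        using bspec[OF \<theta>S dm[OF fn]] bd[OF f] carr dm[OF fn] by (simp add: \<omega>_def M.diff_zero)
      then have "x \<odot>\<^bsub>M\<^esub> \<phi> f \<ominus>\<^bsub>M\<^esub> x \<odot>\<^bsub>M\<^esub> \<theta> (d m f) \<in> S"
        using minus_trans_mem[OF S _ _ _ \<psi>d[OF fn]] carr x by blast
      moreover have "x \<odot>\<^bsub>M\<^esub> \<phi> f \<ominus>\<^bsub>M\<^esub> x \<odot>\<^bsub>M\<^esub> \<theta> (d m f) = x \<odot>\<^bsub>M\<^esub> (\<phi> f \<ominus>\<^bsub>M\<^esub> \<theta> (d m f))"
        using carr x by (simp add: M.minus_eq smult_r_distr smult_r_minus)
      ultimately show ?thesis using reg carr by (simp add: regular_mod_def)
    qed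
    then show ?thesis using \<theta> unfolding Suc by auto
  qed
qed

end

section \<open>Comparison with the cosets that define Ext\<close>

lemma (in acyclic_free_complex) coboundary_mod_diff_smult:
  assumes S: "submodule S R M" and x: "x \<in> carrier R"
    and \<phi>: "\<phi> \<in> module_homs R (F n) M" "coboundary_mod R F d M S n \<phi>"
    and \<phi>': "\<phi>' \<in> module_homs R (F n) M" "coboundary_mod R F d M S n \<phi>'"
  shows "coboundary_mod R F d M S n (\<lambda>f\<in>carrier (F n). \<phi> f \<ominus>\<^bsub>M\<^esub> x \<odot>\<^bsub>M\<^esub> \<phi>' f)"
proof (cases n)
  case 0
  then show ?thesis using \<phi>(2) \<phi>'(2) submoduleD(5,6)[OF S] x by simp
next
  case (Suc m)
  obtain \<psi> where \<psi>: "\<psi> \<in> module_homs R (F m) M" "\<forall>f\<in>carrier (F n). \<phi> f \<ominus>\<^bsub>M\<^esub> \<psi> (d m f) \<in> S"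
    using \<phi>(2) Suc by auto
  obtain \<psi>' where \<psi>': "\<psi>' \<in> module_homs R (F m) M" "\<forall>f\<in>carrier (F n). \<phi>' f \<ominus>\<^bsub>M\<^esub> \<psi>' (d m f) \<in> S"
    using \<phi>'(2) Suc by auto
  have "(\<phi> f \<ominus>\<^bsub>M\<^esub> x \<odot>\<^bsub>M\<^esub> \<phi>' f) \<ominus>\<^bsub>M\<^esub> (\<psi> (d m f) \<ominus>\<^bsub>M\<^esub> x \<odot>\<^bsub>M\<^esub> \<psi>' (d m f)) \<in> S" if f: "f \<in> carrier (F n)" for f
  proof -
    have df: "d m f \<in> carrier (F m)" using d_closed[of f m] f Suc by simp
    have "(\<phi> f \<ominus>\<^bsub>M\<^esub> \<psi> (d m f)) \<ominus>\<^bsub>M\<^esub> x \<odot>\<^bsub>M\<^esub> (\<phi>' f \<ominus>\<^bsub>M\<^esub> \<psi>' (d m f)) \<in> S"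
      using \<psi>(2) \<psi>'(2) f submoduleD(5,6)[OF S] x by blast
    also have "(\<phi> f \<ominus>\<^bsub>M\<^esub> \<psi> (d m f)) \<ominus>\<^bsub>M\<^esub> x \<odot>\<^bsub>M\<^esub> (\<phi>' f \<ominus>\<^bsub>M\<^esub> \<psi>' (d m f)) =
        (\<phi> f \<ominus>\<^bsub>M\<^esub> x \<odot>\<^bsub>M\<^esub> \<phi>' f) \<ominus>\<^bsub>M\<^esub> (\<psi> (d m f) \<ominus>\<^bsub>M\<^esub> x \<odot>\<^bsub>M\<^esub> \<psi>' (d m f))"
      using module_homsD(1)[OF \<phi>(1) f] module_homsD(1)[OF \<phi>'(1) f]
        module_homsD(1)[OF \<psi>(1) df] module_homsD(1)[OF \<psi>'(1) df] x
      by (simp add: M.minus_eq M.minus_add smult_r_distr smult_r_minus M.a_ac)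
    finally show ?thesis .
  qed
  moreover have "(\<lambda>f\<in>carrier (F m). \<psi> f \<ominus>\<^bsub>M\<^esub> x \<odot>\<^bsub>M\<^esub> \<psi>' f) \<in> module_homs R (F m) M"
    by (rule module_homs_diff_smult[OF module_F \<psi>(1) \<psi>'(1) x])
  ultimately show ?thesis using d_closed[of _ m] unfolding Suc coboundary_mod.simps
    by (intro bexI[of _ "\<lambda>f\<in>carrier (F m). \<psi> f \<ominus>\<^bsub>M\<^esub> x \<odot>\<^bsub>M\<^esub> \<psi>' f"]) simp_all
qed

lemma (in Module.module) minus_eq_zero_iff:
  "a \<in> carrier M \<Longrightarrow> b \<in> carrier M \<Longrightarrow> a \<ominus>\<^bsub>M\<^esub> b = \<zero>\<^bsub>M\<^esub> \<longleftrightarrow> a = b"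
proof -
  assume ab: "a \<in> carrier M" "b \<in> carrier M"
  have "a = (a \<ominus>\<^bsub>M\<^esub> b) \<oplus>\<^bsub>M\<^esub> b" using ab by (simp add: M.minus_eq M.a_assoc M.l_neg)
  then show ?thesis using ab by (auto simp: M.minus_eq M.r_neg)
qed

lemma (in Module.module) submodule_zero: "submodule {\<zero>\<^bsub>M\<^esub>} R M"
  by (rule submoduleI) auto

text \<open>Homomorphisms are extensional, so congruence modulo zero at every point of the carrier
  is equality of functions.\<close>

lemma (in acyclic_free_complex) coboundaries_eq:
  "coboundaries R F d M n = {\<phi> \<in> module_homs R (F n) M. coboundary_mod R F d M {\<zero>\<^bsub>M\<^esub>} n \<phi>}"
proof (cases n)
  case 0
  have zero: "\<phi> = (\<lambda>f\<in>carrier (F 0). \<zero>\<^bsub>M\<^esub>)"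
    if "\<phi> \<in> module_homs R (F 0) M" "\<forall>f\<in>carrier (F 0). \<phi> f = \<zero>\<^bsub>M\<^esub>" for \<phi>
    using that by (auto simp: module_homs_def PiE_def extensional_def)
  have "{\<phi> \<in> module_homs R (F 0) M. \<forall>f\<in>carrier (F 0). \<phi> f = \<zero>\<^bsub>M\<^esub>} = {\<lambda>f\<in>carrier (F 0). \<zero>\<^bsub>M\<^esub>}"
  proof (rule equalityI)
    show "{\<lambda>f\<in>carrier (F 0). \<zero>\<^bsub>M\<^esub>} \<subseteq> {\<phi> \<in> module_homs R (F 0) M. \<forall>f\<in>carrier (F 0). \<phi> f = \<zero>\<^bsub>M\<^esub>}"
      using module_homs_const_zero[OF module_F, of 0] by simp
  qed (use zero in blast)
  then show ?thesis unfolding 0 by (simp add: Hom_module_def)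
next
  case (Suc m)
  have eq: "(\<forall>f\<in>carrier (F n). \<phi> f \<ominus>\<^bsub>M\<^esub> \<psi> (d m f) = \<zero>\<^bsub>M\<^esub>) \<longleftrightarrow> \<phi> = compose (carrier (F n)) \<psi> (d m)"
    if \<phi>: "\<phi> \<in> module_homs R (F n) M" and \<psi>: "\<psi> \<in> module_homs R (F m) M" for \<phi> \<psi>
  proof -
    have "(\<forall>f\<in>carrier (F n). \<phi> f \<ominus>\<^bsub>M\<^esub> \<psi> (d m f) = \<zero>\<^bsub>M\<^esub>) \<longleftrightarrow> (\<forall>f\<in>carrier (F n). \<phi> f = \<psi> (d m f))"
      using module_homsD(1)[OF \<phi>] module_homsD(1)[OF \<psi>] d_closed[of _ m] Suc
      by (simp add: minus_eq_zero_iff)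
    also have "\<dots> \<longleftrightarrow> \<phi> = compose (carrier (F n)) \<psi> (d m)"
      using \<phi> by (auto simp: module_homs_def PiE_def extensional_def compose_def fun_eq_iff)
    finally show ?thesis .
  qed
  have "compose (carrier (F n)) \<psi> (d m) \<in> module_homs R (F n) M" if "\<psi> \<in> module_homs R (F m) M" for \<psi>
    unfolding Suc by (rule module_homs_compose[OF module_F d_hom that])
  then show ?thesis
    using eq unfolding Suc coboundaries.simps coboundary_mod.simps singleton_iff by blast
qed

lemma (in acyclic_free_complex) cocycles_eq:
  "cocycles R F d M n =
    {\<phi> \<in> module_homs R (F n) M. \<forall>f\<in>carrier (F (Suc n)). \<phi> (d n f) \<in> {\<zero>\<^bsub>M\<^esub>}}"
  by (auto simp: cocycles_def Hom_module_def compose_def fun_eq_iff)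

text \<open>The cohomology is handled as a bare set of cosets. It consists of the coboundaries alone
  exactly when every cocycle is a coboundary, because coboundaries contain zero and are closed under
  sums and differences.\<close>

lemma (in acyclic_free_complex) nonzero_Hom_cohomology_iff:
  "nonzero_module (Hom_cohomology R F d M n) \<longleftrightarrow> \<not> ext_vanishes_mod R F d M {\<zero>\<^bsub>M\<^esub>} n"
proof -
  let ?Z = "cocycles R F d M n" and ?B = "coboundaries R F d M n"
  let ?C = "(Hom_module R (F n) M)\<lparr>carrier := ?Z\<rparr>"
  define shift where "shift \<phi> = (\<lambda>b. \<lambda>f\<in>carrier (F n). b f \<oplus>\<^bsub>M\<^esub> \<phi> f) ` ?B" for \<phi>
  have carrier: "carrier (Hom_cohomology R F d M n) = shift ` ?Z"
    and zero: "\<zero>\<^bsub>Hom_cohomology R F d M n\<^esub> = ?B"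
    by (auto simp: Hom_cohomology_def quot_module_def A_RCOSETS_def' a_r_coset_def' shift_def Hom_module_def)
  define \<zeta> where "\<zeta> = (\<lambda>f\<in>carrier (F n). \<zero>\<^bsub>M\<^esub>)"
  have \<zeta>: "\<zeta> \<in> module_homs R (F n) M" unfolding \<zeta>_def by (rule module_homs_const_zero[OF module_F])
  have diff: "(\<lambda>f\<in>carrier (F n). \<phi> f \<ominus>\<^bsub>M\<^esub> x \<odot>\<^bsub>M\<^esub> \<phi>' f) \<in> ?B"
    if "\<phi> \<in> ?B" "\<phi>' \<in> ?B" "x \<in> carrier R" for \<phi> \<phi>' x
    using that coboundary_mod_diff_smult[OF submodule_zero] module_homs_diff_smult[OF module_F]
    unfolding coboundaries_eq by blast
  have \<zeta>B: "\<zeta> \<in> ?B"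
  proof -
    have "coboundary_mod R F d M {\<zero>\<^bsub>M\<^esub>} n \<zeta>"
    proof (cases n)
      case (Suc m)
      show ?thesis
        unfolding Suc coboundary_mod.simps
        by (intro bexI[OF _ module_homs_const_zero[OF module_F]])
          (use d_closed[of _ m] Suc in \<open>simp add: \<zeta>_def M.diff_zero\<close>)
    qed (simp add: \<zeta>_def)
    then show ?thesis using \<zeta> by (simp add: coboundaries_eq)
  qed
  have \<zeta>Z: "\<zeta> \<in> ?Z" using \<zeta> d_closed by (simp add: cocycles_eq \<zeta>_def)
  have van: "ext_vanishes_mod R F d M {\<zero>\<^bsub>M\<^esub>} n \<longleftrightarrow> ?Z \<subseteq> ?B"
    by (auto simp: ext_vanishes_mod_def coboundaries_eq cocycles_eq)
  have shift_eq: "shift \<phi> = ?B" if \<phi>: "\<phi> \<in> ?B" for \<phi>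
  proof -
    have carr: "b f \<in> carrier M" if "b \<in> ?B" "f \<in> carrier (F n)" for b f
      using that by (auto simp: coboundaries_eq dest: module_homsD(1))
    have "(\<lambda>f\<in>carrier (F n). b f \<oplus>\<^bsub>M\<^esub> \<phi> f) \<in> ?B" if b: "b \<in> ?B" for b
    proof -
      have "(\<lambda>f\<in>carrier (F n). b f \<ominus>\<^bsub>M\<^esub> (\<ominus> \<one>) \<odot>\<^bsub>M\<^esub> \<phi> f) \<in> ?B"
        using diff[OF b \<phi>] by simp
      also have "(\<lambda>f\<in>carrier (F n). b f \<ominus>\<^bsub>M\<^esub> (\<ominus> \<one>) \<odot>\<^bsub>M\<^esub> \<phi> f) = (\<lambda>f\<in>carrier (F n). b f \<oplus>\<^bsub>M\<^esub> \<phi> f)"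
        using carr[OF \<phi>] by (intro restrict_ext) (simp add: smult_l_minus M.minus_eq)
      finally show ?thesis .
    qed
    moreover have "b \<in> shift \<phi>" if b: "b \<in> ?B" for b
    proof -
      let ?b = "\<lambda>f\<in>carrier (F n). b f \<ominus>\<^bsub>M\<^esub> \<one> \<odot>\<^bsub>M\<^esub> \<phi> f"
      have "?b \<in> ?B" using diff[OF b \<phi>] by simp
      moreover have "b = (\<lambda>f\<in>carrier (F n). ?b f \<oplus>\<^bsub>M\<^esub> \<phi> f)"
      proof
        fix f
        show "b f = (\<lambda>f\<in>carrier (F n). ?b f \<oplus>\<^bsub>M\<^esub> \<phi> f) f"
          using b carr[OF b, of f] carr[OF \<phi>, of f]
          by (cases "f \<in> carrier (F n)")
            (auto simp: M.minus_eq M.a_assoc M.l_neg coboundaries_eq module_homs_def PiE_def extensional_def)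
      qed
      ultimately show ?thesis unfolding shift_def by blast
    qed
    ultimately show ?thesis by (auto simp: shift_def)
  qed
  have "?Z \<subseteq> ?B \<longleftrightarrow> shift ` ?Z = {?B}"
  proof
    assume "?Z \<subseteq> ?B"
    then show "shift ` ?Z = {?B}" using shift_eq \<zeta>Z by blast
  next
    assume eq: "shift ` ?Z = {?B}"
    show "?Z \<subseteq> ?B"
    proof
      fix \<phi> assume \<phi>: "\<phi> \<in> ?Z"
      have "\<phi> = (\<lambda>f\<in>carrier (F n). \<zeta> f \<oplus>\<^bsub>M\<^esub> \<phi> f)"
      proof
        fix f
        show "\<phi> f = (\<lambda>f\<in>carrier (F n). \<zeta> f \<oplus>\<^bsub>M\<^esub> \<phi> f) f"
          using \<phi> by (cases "f \<in> carrier (F n)")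
            (auto simp: \<zeta>_def cocycles_eq module_homs_def PiE_def Pi_iff extensional_def)
      qed
      then have "\<phi> \<in> shift \<phi>" unfolding shift_def using \<zeta>B by blast
      then show "\<phi> \<in> ?B" using eq \<phi> by blast
    qed
  qed
  then show ?thesis unfolding nonzero_module_def carrier zero van by blast
qed

section \<open>The residue field\<close>

lemma (in cring) quot_ring_as_module_simps:
  "carrier (quot_module (ring_as_module R) J) = (\<lambda>r. J +> r) ` carrier R"
  "\<zero>\<^bsub>quot_module (ring_as_module R) J\<^esub> = J"
  "C \<oplus>\<^bsub>quot_module (ring_as_module R) J\<^esub> D = C <+> D"
  "a \<odot>\<^bsub>quot_module (ring_as_module R) J\<^esub> C = (\<Union>x\<in>C. J +> (a \<otimes> x))"
proof -
  have coset: "a_r_coset (ring_as_module R) = a_r_coset R"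
    "set_add (ring_as_module R) = set_add R" "a_rcosets\<^bsub>ring_as_module R\<^esub> J = a_rcosets J"
    by (simp_all add: a_r_coset_def set_add_def A_RCOSETS_def r_coset_def set_mult_def RCOSETS_def ring_as_module_def fun_eq_iff)
  show "carrier (quot_module (ring_as_module R) J) = (\<lambda>r. J +> r) ` carrier R"
    by (simp add: quot_module_def coset(3)) (auto simp: A_RCOSETS_def')
  show "a \<odot>\<^bsub>quot_module (ring_as_module R) J\<^esub> C = (\<Union>x\<in>C. J +> (a \<otimes> x))"
    by (simp add: quot_module_def coset) (simp add: ring_as_module_def)
  show "\<zero>\<^bsub>quot_module (ring_as_module R) J\<^esub> = J" by (simp add: quot_module_def)
  show "C \<oplus>\<^bsub>quot_module (ring_as_module R) J\<^esub> D = C <+> D"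
    by (simp add: quot_module_def coset)
qed

lemma (in cring) quot_ring_as_module_ops:
  assumes J: "ideal J R" and a: "a \<in> carrier R" "b \<in> carrier R"
  shows "(J +> a) \<oplus>\<^bsub>quot_module (ring_as_module R) J\<^esub> (J +> b) = J +> (a \<oplus> b)"
    and "a \<odot>\<^bsub>quot_module (ring_as_module R) J\<^esub> (J +> b) = J +> (a \<otimes> b)"
proof -
  interpret J: ideal J R by fact
  show "(J +> a) \<oplus>\<^bsub>quot_module (ring_as_module R) J\<^esub> (J +> b) = J +> (a \<oplus> b)"
    using J.a_rcos_sum a by (simp add: quot_ring_as_module_simps(3))
  \<comment> \<open>The scalar multiple of a coset is a union over its representatives, which
    collapses once they all give the same coset.\<close>
  have "J +> (a \<otimes> x) = J +> (a \<otimes> b)" if x: "x \<in> J +> b" for x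
  proof -
    obtain j where j: "j \<in> J" "x = j \<oplus> b" using x by (auto simp: a_r_coset_def')
    have jc: "j \<in> carrier R" using J.Icarr j by blast
    have "a \<otimes> x \<ominus> a \<otimes> b = a \<otimes> j"
      using j jc a by (simp add: r_distr minus_eq a_assoc r_neg)
    then have "a \<otimes> x \<ominus> a \<otimes> b \<in> J" using J.I_l_closed j a by simp
    then show ?thesis using quotient_eq_iff_same_a_r_cos[OF J] j jc a by simp
  qed
  moreover have "b \<in> J +> b" using J.a_rcos_self a by blast
  ultimately show "a \<odot>\<^bsub>quot_module (ring_as_module R) J\<^esub> (J +> b) = J +> (a \<otimes> b)"
    unfolding quot_ring_as_module_simps by blast
qed

lemma (in cring) module_quot_ring_as_module:
  assumes J: "ideal J R"
  shows "Module.module R (quot_module (ring_as_module R) J)"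
proof (rule moduleI)
  interpret J: ideal J R by fact
  let ?Q = "quot_module (ring_as_module R) J"
  note simps = quot_ring_as_module_simps(1,2) quot_ring_as_module_ops[OF J]
  have zero: "J = J +> \<zero>" using J.a_subset by simp
  show "abelian_group ?Q"
  proof (rule abelian_groupI)
    show "\<zero>\<^bsub>?Q\<^esub> \<in> carrier ?Q" using zero unfolding simps by blast
    show "\<zero>\<^bsub>?Q\<^esub> \<oplus>\<^bsub>?Q\<^esub> C = C" if "C \<in> carrier ?Q" for C
      using that by (subst (1) simps(2), subst (1) zero) (auto simp: simps)
    show "\<exists>D\<in>carrier ?Q. D \<oplus>\<^bsub>?Q\<^esub> C = \<zero>\<^bsub>?Q\<^esub>" if C: "C \<in> carrier ?Q" for C
    proof -
      obtain r where r: "r \<in> carrier R" "C = J +> r" using C by (auto simp: simps)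
      then have "(J +> \<ominus> r) \<oplus>\<^bsub>?Q\<^esub> C = \<zero>\<^bsub>?Q\<^esub>" using zero by (simp add: simps l_neg)
      then show ?thesis using r(1) unfolding simps(1) by blast
    qed
  qed (auto simp: simps a_ac)
qed (auto simp: is_cring quot_ring_as_module_simps(1) quot_ring_as_module_ops[OF J] l_distr r_distr m_assoc)

text \<open>As \<open>J\<close> kills \<open>z\<close> modulo \<open>S\<close>, sending 1 to
  \<open>z\<close> defines a map R/J -> M/S. Composed with \<open>\<epsilon>\<close> and lifted to
  \<open>M\<close> it is a cocycle modulo \<open>S\<close> in degree 0; vanishing forces its values,
  and by surjectivity of \<open>\<epsilon>\<close> also \<open>z\<close>, into
  \<open>S\<close>.\<close>

lemma (in acyclic_free_complex) socle_subset_of_ext_vanishes: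
  assumes J: "ideal J R" and \<epsilon>: "\<epsilon> \<in> module_homs R (F 0) (quot_module (ring_as_module R) J)"
    and surj: "\<epsilon> ` carrier (F 0) = carrier (quot_module (ring_as_module R) J)"
    and \<epsilon>d: "\<And>f. f \<in> carrier (F 1) \<Longrightarrow> \<epsilon> (d 0 f) = \<zero>\<^bsub>quot_module (ring_as_module R) J\<^esub>"
    and S: "submodule S R M" and van: "ext_vanishes_mod R F d M S 0"
    and z: "z \<in> carrier M" and Jz: "J \<subseteq> colon R M S z"
  shows "z \<in> S"
proof -
  interpret J: ideal J R by fact
  note \<epsilon>D = module_homsD[OF \<epsilon>] and SD = submoduleD[OF S]
  note ops = R.quot_ring_as_module_ops[OF J]
  \<comment> \<open>\<open>y\<close> represents the image of \<open>\<epsilon> f\<close> under the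
    map R/J -> M/S with 1 going to \<open>z\<close>.\<close>
  define P where "P f y \<longleftrightarrow> (\<exists>r\<in>carrier R. \<epsilon> f = J +> r \<and> y \<ominus>\<^bsub>M\<^esub> r \<odot>\<^bsub>M\<^esub> z \<in> S)" for f y
  have "\<exists>\<phi>\<in>module_homs R (F 0) M. \<forall>f\<in>carrier (F 0). P f (\<phi> f)"
    unfolding F_free
  proof (rule free_module_lift, unfold F_free[symmetric])
    fix f assume "f \<in> carrier (F 0)"
    then obtain r where r: "r \<in> carrier R" "\<epsilon> f = J +> r"
      using \<epsilon>D(1) by (auto simp: R.quot_ring_as_module_simps(1))
    then have "P f (r \<odot>\<^bsub>M\<^esub> z)"
      using z SD(2) by (auto simp: P_def M.minus_eq M.r_neg)
    then show "\<exists>y\<in>carrier M. P f y" using r z by blast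
  next
    fix f g y w
    assume fg: "f \<in> carrier (F 0)" "g \<in> carrier (F 0)" "y \<in> carrier M" "w \<in> carrier M" and "P f y" "P g w"
    then obtain r s where r: "r \<in> carrier R" "\<epsilon> f = J +> r" "y \<ominus>\<^bsub>M\<^esub> r \<odot>\<^bsub>M\<^esub> z \<in> S"
      and s: "s \<in> carrier R" "\<epsilon> g = J +> s" "w \<ominus>\<^bsub>M\<^esub> s \<odot>\<^bsub>M\<^esub> z \<in> S" unfolding P_def by blast
    have "\<epsilon> (f \<oplus>\<^bsub>F 0\<^esub> g) = J +> (r \<oplus> s)" using \<epsilon>D(2)[OF fg(1,2)] r s ops(1) by simp
    moreover have "(y \<oplus>\<^bsub>M\<^esub> w) \<ominus>\<^bsub>M\<^esub> (r \<oplus> s) \<odot>\<^bsub>M\<^esub> z = (y \<ominus>\<^bsub>M\<^esub> r \<odot>\<^bsub>M\<^esub> z) \<oplus>\<^bsub>M\<^esub> (w \<ominus>\<^bsub>M\<^esub> s \<odot>\<^bsub>M\<^esub> z)"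
      using fg r(1) s(1) z by (simp add: smult_l_distr M.minus_eq M.minus_add M.a_ac)
    ultimately show "P (f \<oplus>\<^bsub>F 0\<^esub> g) (y \<oplus>\<^bsub>M\<^esub> w)"
      unfolding P_def using r s SD(4)[OF r(3) s(3)] by (intro bexI[of _ "r \<oplus> s"]) simp_all
  next
    fix a f y assume a: "a \<in> carrier R" and f: "f \<in> carrier (F 0)" and y: "y \<in> carrier M" and "P f y"
    then obtain r where r: "r \<in> carrier R" "\<epsilon> f = J +> r" "y \<ominus>\<^bsub>M\<^esub> r \<odot>\<^bsub>M\<^esub> z \<in> S"
      unfolding P_def by blast
    have "\<epsilon> (a \<odot>\<^bsub>F 0\<^esub> f) = J +> (a \<otimes> r)" using \<epsilon>D(3)[OF a f] r ops(2)[OF a] by simp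
    moreover have "a \<odot>\<^bsub>M\<^esub> y \<ominus>\<^bsub>M\<^esub> (a \<otimes> r) \<odot>\<^bsub>M\<^esub> z = a \<odot>\<^bsub>M\<^esub> (y \<ominus>\<^bsub>M\<^esub> r \<odot>\<^bsub>M\<^esub> z)"
      using a y r(1) z by (simp add: smult_assoc1 M.minus_eq smult_r_distr smult_r_minus)
    ultimately show "P (a \<odot>\<^bsub>F 0\<^esub> f) (a \<odot>\<^bsub>M\<^esub> y)"
      unfolding P_def using a r SD(6)[OF a r(3)] by (intro bexI[of _ "a \<otimes> r"]) simp_all
  qed
  then obtain \<phi> where \<phi>: "\<phi> \<in> module_homs R (F 0) M" and P: "\<And>f. f \<in> carrier (F 0) \<Longrightarrow> P f (\<phi> f)"
    by blast
  note \<phi>D = module_homsD(1)[OF \<phi>]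
  have P_mem: "\<phi> f \<in> S \<longleftrightarrow> r \<odot>\<^bsub>M\<^esub> z \<in> S"
    if f: "f \<in> carrier (F 0)" and r: "r \<in> carrier R" "\<phi> f \<ominus>\<^bsub>M\<^esub> r \<odot>\<^bsub>M\<^esub> z \<in> S" for f r
  proof -
    have "\<phi> f = (\<phi> f \<ominus>\<^bsub>M\<^esub> r \<odot>\<^bsub>M\<^esub> z) \<oplus>\<^bsub>M\<^esub> r \<odot>\<^bsub>M\<^esub> z"
      using \<phi>D[OF f] r(1) z by (simp add: M.minus_eq M.a_assoc M.l_neg)
    then show ?thesis using submodule_add_mem_iff[OF S r(2), of "r \<odot>\<^bsub>M\<^esub> z"] r(1) z by simp
  qed
  have "\<phi> (d 0 f) \<in> S" if f: "f \<in> carrier (F (Suc 0))" for f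
  proof -
    obtain r where r: "r \<in> carrier R" "\<epsilon> (d 0 f) = J +> r" "\<phi> (d 0 f) \<ominus>\<^bsub>M\<^esub> r \<odot>\<^bsub>M\<^esub> z \<in> S"
      using P[OF d_closed[OF f]] unfolding P_def by blast
    have "J +> r = J" using r(2) \<epsilon>d f by (simp add: R.quot_ring_as_module_simps(2))
    then have "r \<in> J" using J.a_rcos_self[OF r(1)] by simp
    then have "r \<odot>\<^bsub>M\<^esub> z \<in> S" using Jz by (auto simp: colon_def)
    then show ?thesis using P_mem[OF d_closed[OF f] r(1,3)] by simp
  qed
  then have \<phi>S: "\<And>f. f \<in> carrier (F 0) \<Longrightarrow> \<phi> f \<in> S"
    using van \<phi> by (auto simp: ext_vanishes_mod_def)
  \<comment> \<open>Evaluate at a preimage of the class of 1. The representative \<open>r\<close>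
    supplied by \<open>P\<close> may differ from 1, but 1 - r lies in \<open>J\<close> and so sends
    \<open>z\<close> into \<open>S\<close>.\<close>
  have "J +> \<one> \<in> \<epsilon> ` carrier (F 0)" unfolding surj R.quot_ring_as_module_simps(1) by blast
  then obtain f where f: "f \<in> carrier (F 0)" "\<epsilon> f = J +> \<one>" by auto
  then obtain r where r: "r \<in> carrier R" "J +> \<one> = J +> r" "\<phi> f \<ominus>\<^bsub>M\<^esub> r \<odot>\<^bsub>M\<^esub> z \<in> S"
    using P[OF f(1)] unfolding P_def by auto
  have rz: "r \<odot>\<^bsub>M\<^esub> z \<in> S" using P_mem[OF f(1) r(1,3)] \<phi>S[OF f(1)] by simp
  have "\<one> \<ominus> r \<in> J" using R.quotient_eq_iff_same_a_r_cos[OF J R.one_closed r(1)] r(2) by simp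
  then have "(\<one> \<ominus> r) \<odot>\<^bsub>M\<^esub> z \<in> S" using Jz by (auto simp: colon_def)
  then have "(\<one> \<ominus> r) \<odot>\<^bsub>M\<^esub> z \<oplus>\<^bsub>M\<^esub> r \<odot>\<^bsub>M\<^esub> z \<in> S" using rz by (rule SD(4))
  also have "(\<one> \<ominus> r) \<odot>\<^bsub>M\<^esub> z \<oplus>\<^bsub>M\<^esub> r \<odot>\<^bsub>M\<^esub> z = z"
    using r(1) z by (simp add: R.minus_eq smult_l_distr smult_l_minus M.a_assoc M.l_neg)
  finally show ?thesis .
qed

section \<open>Depth and chains of primes\<close>

text \<open>
  \<open>F\<close> is a free resolution of the residue field \<open>k\<close>. The only property of \<open>k\<close> that matters is
  \<open>socle\<close>: if \<open>Hom(k, M/S) = 0\<close>, then no nonzero element of \<open>M/S\<close> is killed by the maximal ideal.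
\<close>

locale residue_resolution = acyclic_free_complex +
  assumes noeth: "noetherian_ring R" and acc: "acc_submodules R M (carrier M)" and loc: "local_cring R"
    and socle: "submodule S R M \<Longrightarrow> ext_vanishes_mod R F d M S 0 \<Longrightarrow> z \<in> carrier M \<Longrightarrow>
      max_ideal R \<subseteq> colon R M S z \<Longrightarrow> z \<in> S"
begin

text \<open>Otherwise the maximal ideal would consist of zero divisors modulo \<open>S\<close> and
  kill some element outside \<open>S\<close> modulo \<open>S\<close>, which \<open>socle\<close>
  excludes.\<close>

lemma exists_regular:
  assumes S: "submodule S R M" and van: "ext_vanishes_mod R F d M S 0"
  obtains x where "x \<in> max_ideal R" "x \<in> carrier R" "regular_mod M S x"
proof -
  interpret m: maximalideal "max_ideal R" R by (rule max_ideal_unique(1)[OF loc])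
  have "\<exists>x\<in>max_ideal R. regular_mod M S x"
  proof (rule ccontr)
    assume "\<not> ?thesis"
    then obtain z where "z \<in> carrier M" "z \<notin> S" "max_ideal R \<subseteq> colon R M S z"
      using zero_divisors_annihilate[OF noeth acc S m.is_ideal] by blast
    then show False using socle[OF S van] by blast
  qed
  then show thesis using that m.Icarr by blast
qed

text \<open>The bound of the depth by dim(R/p) at an associated prime p, in terms of chains. Each
  passage from \<open>S\<close> to S + xM uses up one vanishing degree and gains one prime.\<close>

lemma prime_chain_of_ext_vanishes:
  assumes "submodule S R M" and "\<And>j. j < n \<Longrightarrow> ext_vanishes_mod R F d M S j"
    and "z \<in> carrier M" and "primeideal (colon R M S z) R"
  shows "\<exists>p :: nat \<Rightarrow> 'a set. p 0 = colon R M S z \<and> (\<forall>i\<le>n. primeideal (p i) R) \<and> (\<forall>i<n. p i \<subset> p (Suc i))"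
  using assms
proof (induction n arbitrary: S z)
  case 0
  then show ?case by (intro exI[of _ "\<lambda>_. colon R M S z"]) simp
next
  case (Suc n)
  note S = Suc.prems(1) and z = Suc.prems(3)
  have "z \<notin> S"
    using one_mem_colon_iff[OF S z] primeideal.I_notcarr[OF Suc.prems(4)]
      ideal.one_imp_carrier[OF primeideal.axioms(1)[OF Suc.prems(4)]] by auto
  obtain x where x: "x \<in> max_ideal R" "x \<in> carrier R" "regular_mod M S x"
    using exists_regular[OF S] Suc.prems(2)[of 0] by blast
  let ?S = "add_scaled M S x"
  have S': "submodule ?S R M" by (rule submodule_add_scaled[OF S x(2)])
  \<comment> \<open>The Nakayama argument is applied with the colon of \<open>z\<close> itself as
    annihilating ideal; a prime colon above that of \<open>w\<close> becomes the next prime.\<close>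
  obtain w where w: "w \<in> carrier M" "w \<notin> ?S" and Sw: "colon R M S z \<subseteq> colon R M S w"
    using annihilated_mod_add_scaled[OF noeth acc loc S x z \<open>z \<notin> S\<close> subset_refl] by blast
  have "colon R M S w \<subseteq> colon R M ?S w"
    using subset_add_scaled[OF S x(2)] by (auto simp: colon_def)
  then have zw: "colon R M S z \<subseteq> colon R M ?S w" using Sw by (rule subset_trans[rotated])
  obtain v where v: "v \<in> carrier M" "v \<notin> ?S" "colon R M ?S w \<subseteq> colon R M ?S v"
    "primeideal (colon R M ?S v) R"
    by (rule colon_subset_prime_colon[OF noeth S' w])
  have "ext_vanishes_mod R F d M ?S j" if "j < n" for j
    using ext_vanishes_mod_add_scaled[OF S x(2,3)] Suc.prems(2) that by simp
  then obtain p :: "nat \<Rightarrow> 'a set" where p: "p 0 = colon R M ?S v" "\<forall>i\<le>n. primeideal (p i) R"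
    "\<forall>i<n. p i \<subset> p (Suc i)"
    using Suc.IH[OF S' _ v(1,4)] by blast
  \<comment> \<open>\<open>x\<close> makes the inclusion strict: it sends everything into S + xM,
    but it is regular modulo \<open>S\<close>.\<close>
  have "x \<in> colon R M ?S v" using smult_mem_add_scaled[OF S x(2) v(1)] x(2) by (simp add: colon_def)
  moreover have "x \<notin> colon R M S z" using x(3) z \<open>z \<notin> S\<close> by (auto simp: colon_def regular_mod_def)
  ultimately have less: "colon R M S z \<subset> p 0" using zw v(3) p(1) by blast
  have "primeideal (case_nat (colon R M S z) p i) R" if "i \<le> Suc n" for i
    using that p(2) Suc.prems(4) by (cases i) auto
  moreover have "case_nat (colon R M S z) p i \<subset> case_nat (colon R M S z) p (Suc i)" if "i < Suc n" for i
    using that p(3) less by (cases i) auto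
  ultimately show ?case by (intro exI[of _ "case_nat (colon R M S z) p"]) simp
qed

text \<open>For the zero submodule this is finiteness of the depth of a nonzero module. A maximal
  counterexample T is enlarged to T + xM, which is proper by Nakayama's lemma and differs from T by
  regularity of \<open>x\<close>.\<close>

lemma eq_carrier_of_ext_vanishes:
  assumes S: "submodule S R M" and van: "\<And>j. ext_vanishes_mod R F d M S j"
  shows "S = carrier M"
proof (rule ccontr)
  assume ne: "S \<noteq> carrier M"
  let ?A = "{S. submodule S R M \<and> S \<noteq> carrier M \<and> (\<forall>j. ext_vanishes_mod R F d M S j)}"
  have mem: "S \<in> ?A" using S van ne by blast
  have sub: "submodule T R M" if "T \<in> ?A" for T using that by blast
  obtain T where "T \<in> ?A" and max: "\<And>U. U \<in> ?A \<Longrightarrow> T \<subseteq> U \<Longrightarrow> U = T"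
    using exists_maximal_submodule[OF acc mem sub] by blast
  then have T: "submodule T R M" "T \<noteq> carrier M" "\<And>j. ext_vanishes_mod R F d M T j" by auto
  obtain z where z: "z \<in> carrier M" "z \<notin> T" using T(2) submoduleD(1)[OF T(1)] by blast
  obtain x where x: "x \<in> max_ideal R" "x \<in> carrier R" "regular_mod M T x"
    using exists_regular[OF T(1)] T(3)[of 0] by blast
  let ?T = "add_scaled M T x"
  \<comment> \<open>With the empty annihilating set, the Nakayama argument gives just properness of
    T + xM.\<close>
  obtain w where "w \<in> carrier M" "w \<notin> ?T"
    using annihilated_mod_add_scaled[OF noeth acc loc T(1) x z, of "{}"] by blast
  then have "?T \<in> ?A"
    using ext_vanishes_mod_add_scaled[OF T(1) x(2,3)] T(3) submodule_add_scaled[OF T(1) x(2)] by auto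
  then have "?T = T" using max subset_add_scaled[OF T(1) x(2)] by blast
  then have "x \<odot>\<^bsub>M\<^esub> z \<in> T" using smult_mem_add_scaled[OF T(1) x(2) z(1)] by simp
  then show False using x(3) z by (simp add: regular_mod_def)
qed

text \<open>\<open>J\<close> is an ideal killing the module resolved by \<open>G\<close>. Requiring
  \<open>i + l < n\<close> for each chain length \<open>l\<close> expresses i + dim(R/J) < n without
  a numerical dimension, and is preserved when \<open>i\<close> and \<open>n\<close> both drop by
  one.\<close>

lemma ext_vanishes_of_prime_chains:
  assumes G: "acyclic_free_complex R M G K \<delta>" and J: "ideal J R"
    and J0: "\<And>x f. x \<in> J \<Longrightarrow> f \<in> carrier (G 0) \<Longrightarrow> \<exists>g\<in>carrier (G (Suc 0)). \<delta> 0 g = x \<odot>\<^bsub>G 0\<^esub> f"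
    and "submodule S R M" and "\<And>j. j < n \<Longrightarrow> ext_vanishes_mod R F d M S j"
    and "\<And>l p. \<forall>k\<le>l. primeideal (p k) R \<and> J \<subseteq> p k \<Longrightarrow> \<forall>k<l. p k \<subset> p (Suc k) \<Longrightarrow> i + l < n"
  shows "ext_vanishes_mod R G \<delta> M S i"
  using assms(4-6)
proof (induction i arbitrary: S n rule: less_induct)
  case (less i)
  note S = less.prems(1) and van = less.prems(2) and chains = less.prems(3)
  show ?case
  proof (cases "\<exists>x\<in>J. regular_mod M S x")
    case True
    then obtain x where x: "x \<in> J" "regular_mod M S x" by blast
    have xR: "x \<in> carrier R" using ideal.Icarr[OF J x(1)] .
    show ?thesis
    proof (rule acyclic_free_complex.ext_vanishes_mod_lift[OF G S xR x(2) J0[OF x(1)]])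
      \<comment> \<open>For i = 0 this obligation is empty, which provides the base of the
        induction.\<close>
      fix m assume m: "i = Suc m"
      show "ext_vanishes_mod R G \<delta> M (add_scaled M S x) m"
      proof (rule less.IH)
        show "ext_vanishes_mod R F d M (add_scaled M S x) j" if "j < n - 1" for j
          using that van by (intro ext_vanishes_mod_add_scaled[OF S xR x(2)]) auto
        show "m + l < n - 1" if "\<forall>k\<le>l. primeideal (p k) R \<and> J \<subseteq> p k" "\<forall>k<l. p k \<subset> p (Suc k)" for l p
          using chains[OF that] m by simp
      qed (use m submodule_add_scaled[OF S xR] in auto)
    qed
  next
    case False
    obtain z where z: "z \<in> carrier M" "J \<subseteq> colon R M S z" "primeideal (colon R M S z) R"
      using zero_divisors_annihilate[OF noeth acc S J] False by blast
    obtain p :: "nat \<Rightarrow> 'a set" where p: "p 0 = colon R M S z" "\<forall>k\<le>n. primeideal (p k) R"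
      "\<forall>k<n. p k \<subset> p (Suc k)"
      using prime_chain_of_ext_vanishes[of S n z] S van z(1,3) by metis
    have "p 0 \<subseteq> p k" if "k \<le> n" for k
      using that
    proof (induction k)
      case (Suc k)
      then have "p 0 \<subseteq> p k" "p k \<subset> p (Suc k)" using p(3) by auto
      then show ?case by blast
    qed simp
    then have "\<forall>k\<le>n. primeideal (p k) R \<and> J \<subseteq> p k" using p(1,2) z(2) by blast
    \<comment> \<open>The chain above an associated prime that contains \<open>J\<close> has length
      \<open>n\<close>, which the bound on chains rules out.\<close>
    then have "i + n < n" using p(3) by (rule chains)
    then show ?thesis by simp
  qed
qed

end

section \<open>Standard resolutions and supports\<close>

lemma acyclic_free_complex_std_res:
  assumes "Module.module R M" and N: "Module.module R N"
  shows "acyclic_free_complex R M (std_res R N)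
    (case_nat (Gen ` carrier N) (\<lambda>m. rel_name R ` carrier (syzygy R N m))) (std_diff R N)"
proof (intro acyclic_free_complex.intro acyclic_free_complex_axioms.intro)
  fix n
  show "std_res R N n = free_module R
      (case n of 0 \<Rightarrow> Gen ` carrier N | Suc m \<Rightarrow> rel_name R ` carrier (syzygy R N m))"
    by (cases n) (simp_all add: free_cover_def)
  show "std_diff R N n \<in> module_homs R (std_res R N (Suc n)) (std_res R N n)"
    by (rule std_diff_hom[OF N])
  note exact = std_res_exact(3)[OF N, of n, unfolded a_kernel_def']
  show "std_diff R N n (std_diff R N (Suc n) f) = \<zero>\<^bsub>std_res R N n\<^esub>"
    if "f \<in> carrier (std_res R N (Suc (Suc n)))" for f
    using exact that by blast
  show "\<exists>g\<in>carrier (std_res R N (Suc (Suc n))). std_diff R N (Suc n) g = f"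
    if "f \<in> carrier (std_res R N (Suc n))" "std_diff R N n f = \<zero>\<^bsub>std_res R N n\<^esub>" for f
  proof -
    have "f \<in> std_diff R N (Suc n) ` carrier (std_res R N (Suc (Suc n)))" unfolding exact using that by blast
    then show ?thesis by blast
  qed
qed (fact assms(1))

lemma nonzero_Ext_iff:
  assumes "Module.module R M" and "Module.module R N"
  shows "nonzero_module (Ext R i N M) \<longleftrightarrow>
    \<not> ext_vanishes_mod R (std_res R N) (std_diff R N) M {\<zero>\<^bsub>M\<^esub>} i"
  unfolding Ext_def
  by (rule acyclic_free_complex.nonzero_Hom_cohomology_iff[OF acyclic_free_complex_std_res[OF assms]])

section \<open>Annihilator and support of a finitely generated module\<close>

definition annihilator :: "('a, 'r) ring_scheme \<Rightarrow> ('a, 'b, 'x) module_scheme \<Rightarrow> 'a set"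
  where "annihilator R N = {r \<in> carrier R. \<forall>y\<in>carrier N. r \<odot>\<^bsub>N\<^esub> y = \<zero>\<^bsub>N\<^esub>}"

context Module.module
begin

lemma ideal_annihilator: "ideal (annihilator R M) R"
proof (rule idealI)
  show "ring R" by (rule R.ring_axioms)
  show "subgroup (annihilator R M) (add_monoid R)"
    by (rule R.add.subgroupI)
      (auto simp: annihilator_def smult_l_distr smult_l_minus intro!: exI[of _ \<zero>] simp flip: a_inv_def)
qed (auto simp: annihilator_def smult_assoc1)

text \<open>The multiple dies under the augmentation and is therefore a boundary. This starts the
  null-homotopy of multiplication by \<open>r\<close>.\<close>

lemma std_diff_hits_annihilator_multiple:
  assumes r: "r \<in> annihilator R M" and f: "f \<in> carrier (std_res R M 0)"
  shows "\<exists>g\<in>carrier (std_res R M (Suc 0)). std_diff R M 0 g = r \<odot>\<^bsub>std_res R M 0\<^esub> f"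
proof -
  have rR: "r \<in> carrier R" using r by (simp add: annihilator_def)
  have hom: "std_aug R M \<in> module_homs R (std_res R M 0) M"
    using cover_map_hom[OF module_axioms, of Gen] by (simp add: std_aug_def inj_on_def)
  interpret F: Module.module R "std_res R M 0"
    by (simp add: free_cover_def module_free_module R.is_cring)
  have "std_aug R M (r \<odot>\<^bsub>std_res R M 0\<^esub> f) = r \<odot>\<^bsub>M\<^esub> std_aug R M f"
    by (rule module_homsD(3)[OF hom rR f])
  also have "\<dots> = \<zero>\<^bsub>M\<^esub>" using r module_homsD(1)[OF hom f] by (simp add: annihilator_def)
  finally have "r \<odot>\<^bsub>std_res R M 0\<^esub> f \<in> a_kernel (std_res R M 0) M (std_aug R M)"
    using F.smult_closed[OF rR f] by (simp add: a_kernel_def')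
  then have "r \<odot>\<^bsub>std_res R M 0\<^esub> f \<in> std_diff R M 0 ` carrier (std_res R M 1)"
    unfolding std_res_exact(2)[OF module_axioms] .
  then show ?thesis by auto
qed

text \<open>If the localization were zero, each generator would be killed by an element outside
  \<open>p\<close>. The product of these kills the whole module, so it lies in the annihilator but
  not in the prime \<open>p\<close>.\<close>

lemma prime_in_support:
  assumes fg: "fin_gen_module R M" and p: "primeideal p R" and ann: "annihilator R M \<subseteq> p"
  shows "p \<in> support R M"
proof -
  interpret p: primeideal p R by fact
  have "localization R M p \<noteq> {frac_rel R M p `` {(\<zero>\<^bsub>M\<^esub>, \<one>)}}"
  proof
    assume loc: "localization R M p = {frac_rel R M p `` {(\<zero>\<^bsub>M\<^esub>, \<one>)}}"
    have one: "\<one> \<in> carrier R - p" using p.one_imp_carrier p.I_notcarr by auto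
    have kill: "\<exists>u\<in>carrier R - p. u \<odot>\<^bsub>M\<^esub> x = \<zero>\<^bsub>M\<^esub>" if x: "x \<in> carrier M" for x
    proof -
      have "frac_rel R M p `` {(x, \<one>)} \<in> localization R M p"
        unfolding localization_def using x one by (intro quotientI) simp
      then have "frac_rel R M p `` {(x, \<one>)} = frac_rel R M p `` {(\<zero>\<^bsub>M\<^esub>, \<one>)}" using loc by simp
      moreover have "(x, \<one>) \<in> frac_rel R M p `` {(x, \<one>)}"
        using x one by (auto simp: frac_rel_def)
      ultimately have "(x, \<one>) \<in> frac_rel R M p `` {(\<zero>\<^bsub>M\<^esub>, \<one>)}" by simp
      then obtain u where "u \<in> carrier R - p" "u \<odot>\<^bsub>M\<^esub> (\<one> \<odot>\<^bsub>M\<^esub> \<zero>\<^bsub>M\<^esub>) = u \<odot>\<^bsub>M\<^esub> (\<one> \<odot>\<^bsub>M\<^esub> x)"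
        unfolding frac_rel_def by auto
      then show ?thesis using x by auto
    qed
    obtain A where A: "finite A" "A \<subseteq> carrier M" "module_span R M A = carrier M"
      using fg by (auto simp: fin_gen_module_def)
    have "\<exists>u\<in>carrier R - p. \<forall>x\<in>A. u \<odot>\<^bsub>M\<^esub> x = \<zero>\<^bsub>M\<^esub>"
      using A(1,2)
    proof (induction A rule: finite_induct)
      case empty
      then show ?case using one by blast
    next
      case (insert x A)
      then obtain u where u: "u \<in> carrier R - p" "\<forall>x\<in>A. u \<odot>\<^bsub>M\<^esub> x = \<zero>\<^bsub>M\<^esub>" by auto
      obtain v where v: "v \<in> carrier R - p" "v \<odot>\<^bsub>M\<^esub> x = \<zero>\<^bsub>M\<^esub>" using kill insert.prems by blast
      have "u \<otimes> v \<in> carrier R - p" using u(1) v(1) p.I_prime by auto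
      moreover have "(u \<otimes> v) \<odot>\<^bsub>M\<^esub> x = \<zero>\<^bsub>M\<^esub>" using u(1) v insert.prems by (simp add: smult_assoc1)
      moreover have "(u \<otimes> v) \<odot>\<^bsub>M\<^esub> y = \<zero>\<^bsub>M\<^esub>" if "y \<in> A" for y
        using u v(1) insert.prems that by (subst R.m_comm) (auto simp: smult_assoc1)
      ultimately show ?case by blast
    qed
    then obtain u where u: "u \<in> carrier R - p" "\<forall>x\<in>A. u \<odot>\<^bsub>M\<^esub> x = \<zero>\<^bsub>M\<^esub>" by blast
    let ?K = "{x \<in> carrier M. u \<odot>\<^bsub>M\<^esub> x = \<zero>\<^bsub>M\<^esub>}"
    have "u \<odot>\<^bsub>M\<^esub> (r \<odot>\<^bsub>M\<^esub> x) = r \<odot>\<^bsub>M\<^esub> (u \<odot>\<^bsub>M\<^esub> x)" if "r \<in> carrier R" "x \<in> carrier M" for r x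
      using that u(1) by (metis DiffD1 R.m_comm smult_assoc1)
    then have "submodule ?K R M"
      using u(1) by (intro submoduleI) (auto simp: smult_r_distr smult_r_minus M.add.inv_one)
    moreover have "A \<subseteq> ?K" using u(2) A(2) by blast
    ultimately have "carrier M \<subseteq> ?K" unfolding A(3)[symmetric] module_span_def by blast
    then have "u \<in> annihilator R M" using u(1) by (auto simp: annihilator_def)
    then show False using ann u(1) by blast
  qed
  then show ?thesis using p by (simp add: support_def)
qed

end

lemma residue_resolution_std_res:
  fixes R (structure)
  assumes noeth: "noetherian_ring R" and loc: "local_cring R"
    and M: "Module.module R M" "fin_gen_module R M"
  defines "k \<equiv> quot_module (ring_as_module R) (max_ideal R)"
  shows "Module.module R k"
    and "residue_resolution R M (std_res R k)
      (case_nat (Gen ` carrier k) (\<lambda>m. rel_name R ` carrier (syzygy R k m))) (std_diff R k)"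
proof -
  interpret M: Module.module R M by fact
  have J: "ideal (max_ideal R) R" by (rule maximalideal.axioms(1)[OF max_ideal_unique(1)[OF loc]])
  show k: "Module.module R k" unfolding k_def by (rule M.R.module_quot_ring_as_module[OF J])
  interpret acyclic_free_complex R M "std_res R k"
    "case_nat (Gen ` carrier k) (\<lambda>m. rel_name R ` carrier (syzygy R k m))" "std_diff R k"
    by (rule acyclic_free_complex_std_res[OF M(1) k])
  show "residue_resolution R M (std_res R k)
      (case_nat (Gen ` carrier k) (\<lambda>m. rel_name R ` carrier (syzygy R k m))) (std_diff R k)"
  proof (intro residue_resolution.intro residue_resolution_axioms.intro)
    show "acc_submodules R M (carrier M)" by (rule M.acc_submodules_fin_gen[OF noeth M(2)])
    fix S z
    assume *: "submodule S R M" "ext_vanishes_mod R (std_res R k) (std_diff R k) M S 0"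
      "z \<in> carrier M" "max_ideal R \<subseteq> colon R M S z"
    show "z \<in> S"
    proof (rule socle_subset_of_ext_vanishes[OF J _ _ _ *])
      show "std_aug R k \<in> module_homs R (std_res R k 0) (quot_module (ring_as_module R) (max_ideal R))"
        using cover_map_hom[OF k, of Gen] by (simp add: std_aug_def inj_on_def k_def)
      show "std_aug R k ` carrier (std_res R k 0) = carrier (quot_module (ring_as_module R) (max_ideal R))"
        using std_res_exact(1)[OF k] by (simp add: k_def)
      show "std_aug R k (std_diff R k 0 f) = \<zero>\<^bsub>quot_module (ring_as_module R) (max_ideal R)\<^esub>"
        if "f \<in> carrier (std_res R k 1)" for f
      proof -
        have "std_diff R k 0 f \<in> a_kernel (std_res R k 0) k (std_aug R k)"
          unfolding std_res_exact(2)[OF k, symmetric] using that by (rule imageI)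
        then show ?thesis by (simp add: a_kernel_def' k_def)
      qed
    qed
  qed (fact acyclic_free_complex_axioms noeth loc)+
qed

section \<open>The depth inequality\<close>

theorem theorem3p12:
  fixes R :: "('a, 'r) ring_scheme"
    and M :: "('a, 'b, 'x) module_scheme"
    and N :: "('a, 'c, 'y) module_scheme"
  assumes "noetherian_ring R" and "local_cring R"
    and "Module.module R M" and "fin_gen_module R M" and "nonzero_module M"
    and "Module.module R N" and "fin_gen_module R N" and "nonzero_module N"
  shows "ereal_of_enat (depth R N M) \<ge> ereal_of_enat (local_depth R M) - module_dim R N"
proof -
  interpret M: Module.module R M by fact
  interpret N: Module.module R N by fact
  define k where "k = quot_module (ring_as_module R) (max_ideal R)"
  have k: "Module.module R k"
    unfolding k_def by (rule residue_resolution_std_res[OF assms(1-4)])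
  interpret residue_resolution R M "std_res R k"
    "case_nat (Gen ` carrier k) (\<lambda>m. rel_name R ` carrier (syzygy R k m))" "std_diff R k"
    unfolding k_def by (rule residue_resolution_std_res[OF assms(1-4)])
  let ?E = "\<lambda>j. nonzero_module (Ext R j k M)"
  \<comment> \<open>Finiteness of the depth of \<open>M\<close>. In \<open>ereal\<close>, infinity
    minus anything is infinity, so an infinite depth would make the left-hand side infinite.\<close>
  have "\<exists>j. ?E j"
  proof (rule ccontr)
    assume "\<not> ?thesis"
    then have "{\<zero>\<^bsub>M\<^esub>} = carrier M"
      using nonzero_Ext_iff[OF assms(3) k] by (intro eq_carrier_of_ext_vanishes M.submodule_zero) blast
    then show False using assms(5) by (simp add: nonzero_module_def)
  qed
  then obtain n where n: "local_depth R M = enat n" "n = (LEAST j. ?E j)"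
    by (simp add: local_depth_def depth_def k_def)
  have van: "ext_vanishes_mod R (std_res R k) (std_diff R k) M {\<zero>\<^bsub>M\<^esub>} j" if "j < n" for j
    using not_less_Least[of j ?E] that n(2) nonzero_Ext_iff[OF assms(3) k] by blast
  have bound: "ereal (real n) - module_dim R N \<le> ereal (real i)" if i: "nonzero_module (Ext R i N M)" for i
  proof (rule ccontr)
    assume "\<not> ?thesis"
    then have less: "ereal (real i) < ereal (real n) - module_dim R N" by simp
    have "ext_vanishes_mod R (std_res R N) (std_diff R N) M {\<zero>\<^bsub>M\<^esub>} i"
    proof (rule ext_vanishes_of_prime_chains[OF acyclic_free_complex_std_res[OF assms(3,6)]
          N.ideal_annihilator N.std_diff_hits_annihilator_multiple M.submodule_zero van])
      fix l and p :: "nat \<Rightarrow> 'a set"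
      assume p: "\<forall>k\<le>l. primeideal (p k) R \<and> annihilator R N \<subseteq> p k" and chain: "\<forall>k<l. p k \<subset> p (Suc k)"
      have "\<forall>k\<le>l. p k \<in> support R N" using p N.prime_in_support[OF assms(7)] by blast
      \<comment> \<open>Each chain is compared with the supremum on its own, so finite and infinite
        dimension are treated alike.\<close>
      then have "ereal (real l) \<le> module_dim R N"
        unfolding module_dim_def using chain by (intro SUP_upper) blast
      then have "ereal (real n) - module_dim R N \<le> ereal (real n) - ereal (real l)"
        by (intro ereal_minus_mono) auto
      then have "ereal (real i) < ereal (real n) - ereal (real l)" using less by (rule less_le_trans[rotated])
      then have "real i < real n - real l" by simp
      then show "i + l < n" by linarith
    qed
    then show False using i nonzero_Ext_iff[OF assms(3,6)] by blast
  qed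
  show ?thesis
  proof (cases "\<exists>i. nonzero_module (Ext R i N M)")
    case True
    then have "nonzero_module (Ext R (LEAST i. nonzero_module (Ext R i N M)) N M)" by (rule LeastI_ex)
    then show ?thesis using bound True by (simp add: depth_def n(1))
  qed (simp add: depth_def)
qed

end
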